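(* Let $a>0$ be fixed, and let $V_1$ and $V_2$ belong to the admissible class $\tilde A$ of potentials. Let $\tilde D_1(k)$ and $\tilde D_2(k)$ be the corresponding functions and $\tilde\gamma_1,\tilde\gamma_2$ the corresponding constants, as defined in the context. If $\tilde D_1(k)=\tilde D_2(k)$ for all $k$, then $V_1=V_2$ almost everywhere. That is, provided there exists at least one $V$ in $\tilde A$ corresponding to $\tilde D(k)$, the function $\tilde D(k)$ uniquely determines $V$ in $\tilde A$. Equivalently stated: if $V_1$ and $V_2$ have the same special transmission eigenvalues with the same multiplicities (including the multiplicity of the eigenvalue $0$), and $\tilde\gamma_1=\tilde\gamma_2$, then $V_1=V_2$ almost everywhere.
   Context: Fix $a>0$. The admissible class $\tilde A$ consists of the real-valued potentials $V(y)$, $y>0$, that vanish outside the interval $[0,a]$ and are integrable on $(0,a)$. The function $\tilde D(k)$. For $k\in\mathbb C$ let $\tilde\phi(y;k)$ be the unique solution of $$\tilde\phi''(y;k)+k^2\tilde\phi(y;k)=V(y)\,\tilde\phi(y;k),\quad y>0,\qquad \tilde\phi(0;k)=0,\quad \tilde\phi'(0;k)=1,$$ where the prime denotes the $y$-derivative, and set $$\tilde D(k):=\frac{\sin(ka)}{k}\,\tilde\phi'(a;k)-\cos(ka)\,\tilde\phi(a;k)$$ (with $\sin(ka)/k:=a$ at $k=0$). $\tilde D(k)$ is an entire function of $k^2$. Special transmission eigenvalues. Let $\Omega\subset\mathbb R^3$ be the ball of radius $a$ centered at the origin and $V(\mathbf y)=V(|\mathbf y|)$. The special transmission eigenvalues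 are the values $k^2$ for which the system $$-\Delta\tilde\Psi+V\tilde\Psi=k^2\tilde\Psi,\quad -\Delta\tilde\Psi_0=k^2\tilde\Psi_0\ \text{ in }\Omega,\qquad \tilde\Psi=\tilde\Psi_0,\quad \frac{\partial\tilde\Psi}{\partial\mathbf n}=\frac{\partial\tilde\Psi_0}{\partial\mathbf n}\ \text{ on }\partial\Omega$$ has a nontrivial pair of solutions that are spherically symmetric and continuous in the closure of $\Omega$. It is known that they are exactly the values $k^2$ where $k$ is a zero of $\tilde D$. Multiplicity and $\tilde\gamma$. The multiplicity of a nonzero special transmission eigenvalue $\tilde k_n^2$ is the multiplicity of $\tilde k_n$ as a zero of $\tilde D(k)$; the multiplicity $\tilde d$ of the eigenvalue $0$ is the order of vanishing at $0$ of $\tilde D$ as a function of $k^2$ (so $\tilde d=0$ if $\tilde D(0)\neq0$). It is known that $$\tilde D(k)=\tilde\gamma\,k^{2\tilde d}\prod_{n=1}^\infty\Bigl(1-\frac{k^2}{\tilde k_n^2}\Bigr),$$ where $\tilde\gamma$ is a constant and the $\tilde k_n^2$ are the nonzero special transmission eigenvalues repeated according to multiplicity; $\tilde\gamma=0$ if $\tilde D\equiv0$. *)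

theory Defs
  imports "HOL-Complex_Analysis.Complex_Analysis"
begin

text \<open>
  A potential is a total function on the reals, of which only the values at positive arguments
  are ever constrained or used.
\<close>

definition admissible :: "real \<Rightarrow> (real \<Rightarrow> real) \<Rightarrow> bool" where
  "admissible a V \<longleftrightarrow> V absolutely_integrable_on {0<..<a} \<and> (\<forall>y>a. V y = 0)"

text \<open>
  Epsilon-delta absolute continuity. The elements of a division are nonempty compact
  intervals, with endpoints \<open>Inf K\<close> and \<open>Sup K\<close> and with pairwise disjoint interiors.
\<close>

definition abs_continuous :: "real \<Rightarrow> real \<Rightarrow> (real \<Rightarrow> complex) \<Rightarrow> bool" where
  "abs_continuous b c f \<longleftrightarrow>
     (\<forall>\<epsilon>>0. \<exists>\<delta>>0. \<forall>\<D> T. \<D> division_of T \<and> T \<subseteq> {b..c} \<and> (\<Sum>K\<in>\<D>. Sup K - Inf K) < \<delta> \<longrightarrow>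
        (\<Sum>K\<in>\<D>. norm (f (Sup K) - f (Inf K))) < \<epsilon>)"

text \<open>
  For a merely integrable potential, \<open>\<phi>'' + k\<^sup>2 \<phi> = V \<phi>\<close> has the usual Caratheodory meaning:
  \<open>\<phi>\<close> is differentiable, its derivative \<open>\<phi>'\<close> is locally absolutely continuous, and the equation
  holds almost everywhere. Initial values are one-sided at the origin.
\<close>

definition regular_solution ::
    "(real \<Rightarrow> real) \<Rightarrow> complex \<Rightarrow> (real \<Rightarrow> complex) \<Rightarrow> (real \<Rightarrow> complex) \<Rightarrow> bool" where
  "regular_solution V k \<phi> \<phi>' \<longleftrightarrow>
     (\<forall>y\<ge>0. (\<phi> has_vector_derivative \<phi>' y) (at y within {0..})) \<and>
     (\<forall>b>0. abs_continuous 0 b \<phi>') \<and>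
     (AE y in lebesgue. y > 0 \<longrightarrow>
        (\<exists>w. (\<phi>' has_vector_derivative w) (at y) \<and> w + k\<^sup>2 * \<phi> y = of_real (V y) * \<phi> y)) \<and>
     \<phi> 0 = 0 \<and> \<phi>' 0 = 1"

text \<open>
  The regular solution is unique on the half-line \<open>y \<ge> 0\<close> only (its values at negative
  arguments are arbitrary), so the description operator is applied to the value of \<open>D\<close>.
\<close>

definition D_fun :: "real \<Rightarrow> (real \<Rightarrow> real) \<Rightarrow> complex \<Rightarrow> complex" where
  "D_fun a V k = (THE d. \<exists>\<phi> \<phi>'. regular_solution V k \<phi> \<phi>' \<and>
     d = (if k = 0 then of_real a else sin (k * of_real a) / k) * \<phi>' a
           - cos (k * of_real a) * \<phi> a)"

definition has_partial :: "(real^3 \<Rightarrow> complex) \<Rightarrow> 3 \<Rightarrow> complex \<Rightarrow> real^3 \<Rightarrow> bool" where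
  "has_partial f i d x \<longleftrightarrow> ((\<lambda>t. f (x + t *\<^sub>R axis i 1)) has_vector_derivative d) (at 0)"

definition has_laplacian :: "(real^3 \<Rightarrow> complex) \<Rightarrow> complex \<Rightarrow> real^3 \<Rightarrow> bool" where
  "has_laplacian f l x \<longleftrightarrow>
     (\<exists>g h. (\<forall>i. \<forall>\<^sub>F z in nhds x. has_partial f i (g i z) z) \<and>
            (\<forall>i. has_partial (g i) i (h i) x) \<and> l = (\<Sum>i\<in>UNIV. h i))"

text \<open>
  Spherically symmetric strong solutions of \<open>- \<Delta>\<Psi> + V \<Psi> = \<mu> \<Psi>\<close> in the ball of radius \<open>a\<close>,
  continuous up to the boundary. As for the ordinary differential equation, the equation holds
  almost everywhere, and the radial derivative of the profile is locally absolutely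
  continuous away from the origin.
\<close>

definition radial_solution ::
    "real \<Rightarrow> (real \<Rightarrow> real) \<Rightarrow> complex \<Rightarrow> (real^3 \<Rightarrow> complex) \<Rightarrow> bool" where
  "radial_solution a V \<mu> \<Psi> \<longleftrightarrow>
     continuous_on (cball 0 a) \<Psi> \<and>
     (\<exists>\<psi> \<psi>'. (\<forall>x\<in>cball 0 a. \<Psi> x = \<psi> (norm x)) \<and>
        (\<forall>r\<in>{0<..<a}. (\<psi> has_vector_derivative \<psi>' r) (at r)) \<and>
        (\<forall>b c. 0 < b \<and> b \<le> c \<and> c < a \<longrightarrow> abs_continuous b c \<psi>')) \<and>
     (AE x in lebesgue. x \<in> ball 0 a \<longrightarrow>
        (\<exists>l. has_laplacian \<Psi> l x \<and> - l + of_real (V (norm x)) * \<Psi> x = \<mu> * \<Psi> x))"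

text \<open>
  The normal derivative at a boundary point \<open>x\<close> is taken from inside the ball, along the
  outward unit normal \<open>x /\<^sub>R a\<close>.
\<close>

definition has_normal_derivative ::
    "real \<Rightarrow> (real^3 \<Rightarrow> complex) \<Rightarrow> complex \<Rightarrow> real^3 \<Rightarrow> bool" where
  "has_normal_derivative a \<Psi> d x \<longleftrightarrow>
     ((\<lambda>t. \<Psi> (x + t *\<^sub>R (x /\<^sub>R a))) has_vector_derivative d) (at 0 within {..0})"

definition special_te :: "real \<Rightarrow> (real \<Rightarrow> real) \<Rightarrow> complex set" where
  "special_te a V = {\<mu>. \<exists>\<Psi> \<Psi>0.
     radial_solution a V \<mu> \<Psi> \<and> radial_solution a (\<lambda>_. 0) \<mu> \<Psi>0 \<and>
     (\<forall>x\<in>sphere 0 a. \<Psi> x = \<Psi>0 x \<and>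
        (\<exists>d. has_normal_derivative a \<Psi> d x \<and> has_normal_derivative a \<Psi>0 d x)) \<and>
     (\<exists>x\<in>cball 0 a. \<Psi> x \<noteq> 0 \<or> \<Psi>0 x \<noteq> 0)}"

text \<open>
  Since \<open>D\<close> is even, it does not matter which square root of the eigenvalue is used: a nonzero
  \<open>\<mu>\<close> gets the order of the zero of \<open>D\<close> at \<open>csqrt \<mu>\<close>, and \<open>\<mu> = 0\<close> gets the order at \<open>0\<close>
  of \<open>D\<close> as an entire function of \<open>k\<^sup>2\<close>, namely of \<open>\<lambda>z. D (csqrt z)\<close>. Where \<open>D\<close> does not
  vanish, \<open>zorder\<close> is \<open>0\<close>. If \<open>D\<close> is identically zero, no order exists and \<open>zorder\<close> is an
  unspecified value.
\<close>

definition te_mult :: "real \<Rightarrow> (real \<Rightarrow> real) \<Rightarrow> complex \<Rightarrow> nat" where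
  "te_mult a V \<mu> =
     (if \<mu> = 0 then nat (zorder (\<lambda>z. D_fun a V (csqrt z)) 0)
      else nat (zorder (D_fun a V) (csqrt \<mu>)))"

definition enumerates_nonzero_te :: "real \<Rightarrow> (real \<Rightarrow> real) \<Rightarrow> (nat \<Rightarrow> complex) \<Rightarrow> bool" where
  "enumerates_nonzero_te a V e \<longleftrightarrow>
     (\<forall>n. e n \<in> special_te a V - {0}) \<and>
     (\<forall>\<mu>\<in>special_te a V - {0}. finite {n. e n = \<mu>} \<and> card {n. e n = \<mu>} = te_mult a V \<mu>)"

definition D_const :: "real \<Rightarrow> (real \<Rightarrow> real) \<Rightarrow> complex" where
  "D_const a V =
     (if \<forall>k. D_fun a V k = 0 then 0
      else THE \<gamma>. \<exists>e. enumerates_nonzero_te a V e \<and>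
        (\<forall>k. convergent_prod (\<lambda>n. 1 - k\<^sup>2 / e n) \<and>
             D_fun a V k = \<gamma> * k ^ (2 * te_mult a V 0) * (\<Prod>n. 1 - k\<^sup>2 / e n)))"

end

theory Submission
  imports Defs
begin

text \<open>
  Write \<open>\<mu> = k\<^sup>2\<close>. Both implications pass through the entire function \<open>D_hat\<close> of \<open>\<mu>\<close> with
  \<open>D(k) = D_hat(k\<^sup>2)\<close>. It is the Wronskian at \<open>a\<close> of the regular solution \<open>\<phi>\<close> and of the regular
  solution of the free equation.

  \<^bold>\<open>From \<open>D\<close> to the boundary values.\<close> Let \<open>P\<close> and \<open>A\<close> be the differences of the values \<open>\<phi>'(a)\<close>
  and \<open>\<phi>(a)\<close> that belong to the two potentials. Put \<open>\<mu> = - \<kappa>\<^sup>2\<close>. Variation of constants gives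
  \<open>\<phi>'(a) + \<kappa> \<phi>(a) = exp(\<kappa> a) (1 + O(1/\<kappa>))\<close> in the half plane \<open>Re \<kappa> \<ge> 0\<close>, so
  \<open>exp(- \<kappa> a) (P + \<kappa> A) = O(1/\<kappa>)\<close> there. If the functions \<open>D\<close> coincide, the left hand side is an
  even function of \<open>\<kappa>\<close>, hence an entire function of \<open>\<mu>\<close> that vanishes at infinity, and it is
  zero by Liouville's theorem. So \<open>P = A = 0\<close> (\<open>boundary_values_from_D_hat\<close>).

  \<^bold>\<open>From the boundary values to the potential.\<close> Let \<open>\<psi>\<^sub>j\<close> and \<open>\<eta>\<^sub>j\<close> be the solutions for the \<open>j\<close>-th
  potential with Cauchy data \<open>(0, 1)\<close> and \<open>(1, 0)\<close> at the right end \<open>a\<close>. At a fixed point the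
  function \<open>E = \<psi>\<^sub>1 \<eta>\<^sub>2 - \<psi>\<^sub>2 \<eta>\<^sub>1\<close> is entire in \<open>\<mu>\<close>. Since the two regular solutions have the same
  values at \<open>a\<close>, the product of \<open>E\<close> with \<open>\<phi>'(a) + \<kappa> \<phi>(a)\<close> is a combination of products of regular
  solutions, which grow from the left, and of solutions that grow from the right; this yields
  \<open>E = O(1/\<kappa>)\<close>, and again \<open>E = 0\<close>. The Wronskian then forces
  \<open>(\<psi>\<^sub>1, \<eta>\<^sub>1) = \<plusminus> (\<psi>\<^sub>2, \<eta>\<^sub>2)\<close> with a sign that is constant along the interval, and the equation
  returns the same potential (\<open>proportional_solutions_agree\<close>, \<open>potential_from_boundary_values\<close>).

  \<^bold>\<open>From the eigenvalues to \<open>D\<close>.\<close> \<open>D_hat\<close> grows at most like \<open>exp(2 a sqrt\<bar>\<mu>\<bar>)\<close>, so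
  it is its lowest order term times the canonical product over its nonzero zeros
  (\<open>hadamard_product_order_half\<close>). It tends to \<open>0\<close> along the positive axis and is therefore
  never a nonzero polynomial, so that there is an infinite sequence of zeros whenever it does
  not vanish identically. Every zero is a special transmission eigenvalue
  (\<open>zeros_are_special_te\<close>); hence the eigenvalues with their multiplicities fix the product and
  the constant fixes the remaining factor (\<open>D_hat_from_spectral_data\<close>).

  The potential is merely integrable. Existence, uniqueness and all estimates are therefore
  derived from integral equations, and Lebesgue's theorems on absolutely continuous functions
  of one variable link these with the differential equation.
\<close>

section \<open>Absolute continuity and the Lebesgue integral on the line\<close>

lemma division_elem_real:
  assumes "D division_of (T::real set)" "K \<in> D"
  obtains u v where "K = {u..v}" "u \<le> v" "Inf K = u" "Sup K = v" "{u..v} \<subseteq> T"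
proof -
  obtain u v where K: "K = cbox u v" using assms by blast
  have "K \<noteq> {}" "K \<subseteq> T" using assms by blast+
  then have "u \<le> v" using K by auto
  then show thesis using that[of u v] K \<open>K \<subseteq> T\<close> by simp
qed

lemma sum_lengths_division_le:
  assumes D: "D division_of (T::real set)" and TU: "T \<subseteq> U" and U: "U \<in> lmeasurable"
  shows "(\<Sum>K\<in>D. Sup K - Inf K) \<le> measure lebesgue U"
proof -
  have "compact T" 
    using D division_of_finite[OF D] division_ofD(4,6)[OF D]
    by (metis compact_Union compact_cbox)
  then have T: "T \<in> lmeasurable" by (rule lmeasurable_compact)
  have "Sup K - Inf K = integral K (\<lambda>_. 1::real)" if "K \<in> D" for K
    using division_elem_real[OF D that] by (metis content_real integral_const_real mult.right_neutral real_scaleR_def)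
  then have "(\<Sum>K\<in>D. Sup K - Inf K) = (\<Sum>K\<in>D. integral K (\<lambda>_. 1::real))" by simp
  also have "\<dots> = integral T (\<lambda>_. 1)"
    by (rule integral_combine_division_topdown[symmetric, OF integrable_on_const[OF T] D])
  also have "\<dots> = measure lebesgue T" using T by (simp add: lmeasure_integral)
  also have "\<dots> \<le> measure lebesgue U" by (rule measure_mono_fmeasurable) (use T U TU in auto)
  finally show ?thesis .
qed

text \<open>
  By dominated convergence only a small part of the mass of \<open>g\<close> lies above a large height
  \<open>n\<close>; the part below contributes at most \<open>n\<close> times the length of the domain. The two parts
  together give the absolute continuity of the indefinite integral.
\<close>

lemma abs_integrable_excess_small:
  fixes g :: "real \<Rightarrow> real"
  assumes g: "g absolutely_integrable_on {b..c}" and g0: "\<And>x. 0 \<le> g x" and e: "e > 0"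
  obtains n :: nat where "(\<lambda>x. g x - min (g x) (real n)) integrable_on {b..c}"
    "integral {b..c} (\<lambda>x. g x - min (g x) (real n)) < e"
proof -
  have i: "(\<lambda>x. min (g x) (real n)) absolutely_integrable_on {b..c}" for n
    by (rule absolutely_integrable_min_1[OF g]) auto
  have gi: "g integrable_on {b..c}" using g by (rule set_lebesgue_integral_eq_integral(1))
  have int: "(\<lambda>x. g x - min (g x) (real n)) integrable_on {b..c}" for n
    by (rule integrable_diff[OF gi]) (use i[of n] set_lebesgue_integral_eq_integral(1) in blast)
  have "(\<lambda>n. integral {b..c} (\<lambda>x. g x - min (g x) (real n))) \<longlonglongrightarrow> integral {b..c} (\<lambda>x. 0::real)"
  proof (rule dominated_convergence(2)[OF int gi])
    fix x
    have "eventually (\<lambda>n. g x - min (g x) (real n) = 0) sequentially"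
    proof -
      obtain m :: nat where "g x \<le> real m" using real_arch_simple by blast
      then show ?thesis by (intro eventually_sequentiallyI[of m]) (auto simp: min_def)
    qed
    then show "(\<lambda>n. g x - min (g x) (real n)) \<longlonglongrightarrow> 0" by (rule tendsto_eventually)
  qed (use g0 in \<open>auto simp: min_def\<close>)
  then have "eventually (\<lambda>n. integral {b..c} (\<lambda>x. g x - min (g x) (real n)) < e) sequentially"
    using e by (auto dest: order_tendstoD(2))
  then obtain n where "integral {b..c} (\<lambda>x. g x - min (g x) (real n)) < e"
    by (auto simp: eventually_sequentially)
  then show thesis using that int by blast
qed

lemma abs_continuous_if_integral:
  fixes f :: "real \<Rightarrow> complex"
  assumes f: "f absolutely_integrable_on {b..c}"
    and F: "\<And>x y. b \<le> x \<Longrightarrow> x \<le> y \<Longrightarrow> y \<le> c \<Longrightarrow> F y - F x = integral {x..y} f"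
  shows "abs_continuous b c F"
  unfolding abs_continuous_def
proof (intro allI impI)
  fix e :: real assume e: "e > 0"
  define g where "g = (\<lambda>x. norm (f x))"
  have g: "g absolutely_integrable_on {b..c}" unfolding g_def using absolutely_integrable_norm[OF f] by (simp add: o_def)
  obtain n where n: "(\<lambda>x. g x - min (g x) (real n)) integrable_on {b..c}"
    "integral {b..c} (\<lambda>x. g x - min (g x) (real n)) < e/2"
    using abs_integrable_excess_small[OF g, of "e/2"] e unfolding g_def by auto
  let ?h = "\<lambda>x. g x - min (g x) (real n)"
  define d where "d = e / (2 * (real n + 1))"
  have d: "d > 0" using e by (simp add: d_def)
  show "\<exists>\<delta>>0. \<forall>\<D> T. \<D> division_of T \<and> T \<subseteq> {b..c} \<and> (\<Sum>K\<in>\<D>. Sup K - Inf K) < \<delta> \<longrightarrow>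
        (\<Sum>K\<in>\<D>. norm (F (Sup K) - F (Inf K))) < e"
  proof (intro exI[of _ d] conjI d allI impI, elim conjE)
    fix D T assume D: "D division_of T" and T: "T \<subseteq> {b..c}" and small: "(\<Sum>K\<in>D. Sup K - Inf K) < d"
    have le: "norm (F (Sup K) - F (Inf K)) \<le> real n * (Sup K - Inf K) + integral K ?h" if K: "K \<in> D" for K
    proof -
      obtain u v where uv: "K = {u..v}" "u \<le> v" "Inf K = u" "Sup K = v" "{u..v} \<subseteq> T"
        using division_elem_real[OF D K] by blast
      have sub: "{u..v} \<subseteq> {b..c}" using uv T by blast
      have fi: "f absolutely_integrable_on {u..v}" using absolutely_integrable_on_subinterval[OF f sub] .
      have gi: "g integrable_on {u..v}" using absolutely_integrable_on_subinterval[OF g sub] set_lebesgue_integral_eq_integral(1) by blast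
      have hi: "?h integrable_on {u..v}" using integrable_on_subinterval[OF n(1) sub] .
      have "norm (F v - F u) = norm (integral {u..v} f)" using F[of u v] sub uv(2) by auto
      also have "\<dots> \<le> integral {u..v} g" unfolding g_def
        by (rule integral_norm_bound_integral) (use fi gi set_lebesgue_integral_eq_integral(1) in \<open>auto simp: g_def\<close>)
      also have "\<dots> \<le> integral {u..v} (\<lambda>x. real n + ?h x)"
        by (rule integral_le) (use gi hi in \<open>auto intro!: integrable_add\<close>)
      also have "\<dots> = integral {u..v} (\<lambda>x. real n) + integral {u..v} ?h"
        by (rule integral_add) (use hi in auto)
      also have "integral {u..v} (\<lambda>x. real n) = real n * (v - u)" using uv(2) by simp
      finally show ?thesis using uv by simp
    qed
    have hT: "?h integrable_on T"
    proof (rule integrable_on_subdivision[OF D n(1) T]) qed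
    have "(\<Sum>K\<in>D. norm (F (Sup K) - F (Inf K))) \<le> (\<Sum>K\<in>D. real n * (Sup K - Inf K) + integral K ?h)"
      by (rule sum_mono) (use le in auto)
    also have "\<dots> = real n * (\<Sum>K\<in>D. Sup K - Inf K) + (\<Sum>K\<in>D. integral K ?h)"
      by (simp add: sum.distrib sum_distrib_left)
    also have "(\<Sum>K\<in>D. integral K ?h) = integral T ?h"
      by (rule integral_combine_division_topdown[symmetric, OF hT D])
    also have "integral T ?h \<le> integral {b..c} ?h"
      by (rule integral_subset_le[OF T hT n(1)]) auto
    also have "real n * (\<Sum>K\<in>D. Sup K - Inf K) \<le> real n * d"
      using small by (intro mult_left_mono) auto
    also have "real n * d \<le> e/2"
    proof -
      have "real n * e \<le> (real n + 1) * e" using e by (intro mult_right_mono) auto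
      then show ?thesis by (simp add: d_def field_simps)
    qed
    finally show "(\<Sum>K\<in>D. norm (F (Sup K) - F (Inf K))) < e" using n(2) by linarith
  qed
qed

text \<open>
  The fundamental theorem of calculus for absolutely continuous functions. The proof
  constructs a gauge: at points where the derivative exists the gauge makes the Riemann
  summands straddle it, as in the classical proof; at points of the exceptional null set the
  gauge confines the intervals to an open set of small measure, and there absolute continuity
  bounds the total increment.
\<close>

lemma has_integral_abs_continuous:
  fixes F :: "real \<Rightarrow> complex"
  assumes ac: "abs_continuous b c F" and bc: "b \<le> c" and N: "negligible N"
    and der: "\<And>x. x \<in> {b..c} - N \<Longrightarrow> (F has_vector_derivative f x) (at x within {b..c})"
  shows "(f has_integral (F c - F b)) {b..c}"
proof -
  define g where "g = (\<lambda>x. if x \<in> N then 0 else f x)"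
  have derg: "(F has_vector_derivative g x) (at x within {b..c})" if "x \<in> {b..c} - N" for x
    using der[OF that] that by (simp add: g_def)
  have "(g has_integral (F c - F b)) (cbox b c)"
    unfolding has_integral
  proof (intro allI impI)
    fix e0 :: real assume e0: "e0 > 0"
    define e where "e = e0 / (2 * (c - b + 1))"
    have e: "e > 0" using e0 bc by (simp add: e_def)
    have "\<forall>x. \<exists>d>0. x \<in> {b..c} - N \<longrightarrow>
         (\<forall>y\<in>{b..c}. norm (y-x) < d \<longrightarrow> norm (F y - F x - (y-x) *\<^sub>R g x) \<le> e * norm (y-x))"
      using derg[unfolded has_vector_derivative_def has_derivative_within_alt] e by (meson zero_less_one)
    then obtain d where d: "\<And>x. 0 < d x"
      "\<And>x y. \<lbrakk>x \<in> {b..c} - N; y \<in> {b..c}; norm (y-x) < d x\<rbrakk>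
                        \<Longrightarrow> norm (F y - F x - (y-x) *\<^sub>R g x) \<le> e * norm (y-x)"
      by metis
    obtain \<delta> where \<delta>: "\<delta> > 0" "\<And>\<D> T. \<D> division_of T \<Longrightarrow> T \<subseteq> {b..c} \<Longrightarrow> (\<Sum>K\<in>\<D>. Sup K - Inf K) < \<delta> \<Longrightarrow>
        (\<Sum>K\<in>\<D>. norm (F (Sup K) - F (Inf K))) < e0/2"
      using ac e0 unfolding abs_continuous_def by (meson half_gt_zero)
    have Nm: "N \<in> lmeasurable" "measure lebesgue N = 0" using N negligible_imp_measurable negligible_imp_measure0 by auto
    obtain U where U: "open U" "N \<subseteq> U" "U \<in> lmeasurable" "measure lebesgue U < \<delta>"
    proof -
      obtain U where U: "open U" "N \<subseteq> U" "(U - N) \<in> lmeasurable" "emeasure lebesgue (U - N) < ennreal \<delta>"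
        using sets_lebesgue_outer_open[OF fmeasurableD[OF Nm(1)] \<delta>(1)] by metis
      have eq: "U = N \<union> (U - N)" using U by blast
      have m: "measure lebesgue U \<le> measure lebesgue N + measure lebesgue (U - N)"
        using measure_Un_le[of N lebesgue "U - N"] eq Nm(1) U(3) by (metis fmeasurableD)
      have "measure lebesgue (U - N) < \<delta>" using U(3,4) \<delta>(1)
        by (simp add: emeasure_eq_measure2 ennreal_less_iff)
      moreover have "U \<in> lmeasurable" using eq Nm(1) U(3) by (metis fmeasurable.Un)
      ultimately show thesis using that U m Nm by auto
    qed
    have "\<forall>x. \<exists>r>0. x \<in> N \<longrightarrow> ball x r \<subseteq> U" using U by (meson open_contains_ball subsetD zero_less_one)
    then obtain r where r: "\<And>x. 0 < r x" "\<And>x. x \<in> N \<Longrightarrow> ball x (r x) \<subseteq> U" by metis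
    define \<gamma> where "\<gamma> = (\<lambda>x. ball x (if x \<in> N then r x else d x))"
    show "\<exists>\<gamma>. gauge \<gamma> \<and> (\<forall>\<D>. \<D> tagged_division_of cbox b c \<and> \<gamma> fine \<D> \<longrightarrow>
             norm ((\<Sum>(x, k)\<in>\<D>. measure lborel k *\<^sub>R g x) - (F c - F b)) < e0)"
    proof (intro exI[of _ \<gamma>] conjI allI impI)
      show "gauge \<gamma>" unfolding \<gamma>_def using d(1) r(1) by (intro gauge_ball_dependent) auto
      fix p assume "p tagged_division_of cbox b c \<and> \<gamma> fine p"
      then have p: "p tagged_division_of cbox b c" and fine: "\<gamma> fine p" by auto
      have p': "p tagged_division_of {b..c}" using p by simp
      have fin: "finite p" using p by blast
      have tot: "F c - F b = (\<Sum>(x,K)\<in>p. F(Sup K) - F(Inf K))" "c - b = (\<Sum>(x,K)\<in>p. Sup K - Inf K)"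
        using additive_tagged_division_1[OF bc p', of F] additive_tagged_division_1[OF bc p', of "\<lambda>x. x"] by auto
      \<comment> \<open>the terms tagged in the null set are controlled by absolute continuity, the others by the derivative\<close>
      define p1 where "p1 = {xK\<in>p. fst xK \<in> N}"
      define p2 where "p2 = {xK\<in>p. fst xK \<notin> N}"
      have split: "p = p1 \<union> p2" "p1 \<inter> p2 = {}" "finite p1" "finite p2" using fin by (auto simp: p1_def p2_def)
      define q where "q = (\<lambda>(x::real,K). measure lborel K *\<^sub>R g x - (F (Sup K) - F (Inf K)))"
      have form: "\<exists>u v. K = {u..v} \<and> u \<le> v \<and> Inf K = u \<and> Sup K = v \<and> {u..v} \<subseteq> {b..c} \<and> x \<in> {u..v}" if xKp: "(x,K) \<in> p" for x K
      proof -
        have "x \<in> K" "K \<subseteq> cbox b c" using tagged_division_ofD(2,3)[OF p xKp] by auto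
        moreover obtain u v where "K = cbox u v" using tagged_division_ofD(4)[OF p xKp] by auto
        ultimately have "K = {u..v}" "u \<le> v" "{u..v} \<subseteq> {b..c}" "x \<in> {u..v}" by auto
        then show ?thesis by (intro exI[of _ u] exI[of _ v]) simp
      qed
      have b2: "norm (q xK) \<le> e * (case xK of (x,K) \<Rightarrow> Sup K - Inf K)" if "xK \<in> p2" for xK
      proof -
        obtain x K where xK: "xK = (x,K)" "(x,K) \<in> p" "x \<notin> N" using \<open>xK \<in> p2\<close> by (cases xK) (auto simp: p2_def)
        obtain u v where uv: "K = {u..v}" "u \<le> v" "Inf K = u" "Sup K = v" "{u..v} \<subseteq> {b..c}" "x \<in> {u..v}"
          using form[OF xK(2)] by blast
        have "K \<subseteq> \<gamma> x" using fineD[OF fine xK(2)] .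
        then have "K \<subseteq> ball x (d x)" using xK(3) by (simp add: \<gamma>_def)
        then have "u \<in> ball x (d x)" "v \<in> ball x (d x)" using uv(1,2) by auto
        then have dd: "norm (u - x) < d x" "norm (v - x) < d x" by (auto simp: dist_norm norm_minus_commute)
        have "norm ((v - u) *\<^sub>R g x - (F v - F u)) = norm (F u - F x - (u - x) *\<^sub>R g x - (F v - F x - (v - x) *\<^sub>R g x))"
          by (auto simp: algebra_simps)
        also have "\<dots> \<le> norm (F u - F x - (u - x) *\<^sub>R g x) + norm (F v - F x - (v - x) *\<^sub>R g x)"
          by (rule norm_triangle_ineq4)
        also have "\<dots> \<le> e * norm (u - x) + e * norm (v - x)"
          by (intro add_mono d(2) dd) (use uv xK in auto)
        also have "\<dots> = e * (v - u)" using uv by (auto simp: field_simps)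
        finally show ?thesis using uv xK by (simp add: q_def)
      qed
      have part: "p1 tagged_partial_division_of {b..c}"
        by (rule tagged_partial_division_subset[of p]) (use p' in \<open>auto simp: p1_def tagged_division_of_def\<close>)
      then have tag1: "p1 tagged_division_of (\<Union>(snd ` p1))" by (rule tagged_partial_division_of_Union_self)
      have div1: "(snd ` p1) division_of (\<Union>(snd ` p1))" by (rule division_of_tagged_division[OF tag1])
      have sub1: "\<Union>(snd ` p1) \<subseteq> {b..c}" "\<Union>(snd ` p1) \<subseteq> U"
      proof -
        have "K \<subseteq> {b..c}" if "(x,K) \<in> p1" for x K using tagged_division_ofD(3)[OF p', of x K] that by (auto simp: p1_def)
        then show "\<Union>(snd ` p1) \<subseteq> {b..c}" by (intro Union_least) (metis imageE prod.collapse)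
        have "K \<subseteq> U" if "(x,K) \<in> p1" for x K
        proof -
          have "x \<in> N" "(x,K) \<in> p" using that by (auto simp: p1_def)
          then have "K \<subseteq> ball x (r x)" using fineD[OF fine, of x K] by (simp add: \<gamma>_def)
          then show ?thesis using r(2) \<open>x \<in> N\<close> by blast
        qed
        then show "\<Union>(snd ` p1) \<subseteq> U" by (intro Union_least) (metis imageE prod.collapse)
      qed
      have "(\<Sum>K\<in>snd ` p1. norm (F (Sup K) - F (Inf K))) < e0/2"
        by (rule \<delta>(2)[OF div1 sub1(1)]) (use sum_lengths_division_le[OF div1 sub1(2) U(3)] U(4) in linarith)
      moreover have "(\<Sum>(x,K)\<in>p1. norm (F (Sup K) - F (Inf K))) = (\<Sum>K\<in>snd ` p1. norm (F (Sup K) - F (Inf K)))"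
      proof -
        \<comment> \<open>intervals with different tags could coincide only if degenerate, where the summand is zero\<close>
        define H where "H = (\<lambda>K. if K = {} then 0 else norm (F (Sup K) - F (Inf K)))"
        have ne: "K \<noteq> {}" if "(x,K) \<in> p1" for x K using form[of x K] that by (auto simp: p1_def)
        have "(\<Sum>(x,K)\<in>p1. H K) = (\<Sum>K\<in>snd ` p1. H K)"
        proof (rule sum.over_tagged_division_lemma[OF tag1])
          fix u v :: real assume "box u v = {}"
          then consider "cbox u v = {}" | "u = v" by fastforce
          then show "H (cbox u v) = 0" by cases (auto simp: H_def)
        qed
        moreover have "(\<Sum>(x,K)\<in>p1. H K) = (\<Sum>(x,K)\<in>p1. norm (F (Sup K) - F (Inf K)))"
          by (rule sum.cong) (use ne in \<open>auto simp: H_def\<close>)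
        moreover have "(\<Sum>K\<in>snd ` p1. H K) = (\<Sum>K\<in>snd ` p1. norm (F (Sup K) - F (Inf K)))"
          by (rule sum.cong) (use ne in \<open>auto simp: H_def\<close>)
        ultimately show ?thesis by simp
      qed
      moreover have "norm (q xK) = (case xK of (x,K) \<Rightarrow> norm (F (Sup K) - F (Inf K)))" if "xK \<in> p1" for xK
        using that by (cases xK) (auto simp: q_def p1_def g_def norm_minus_commute)
      ultimately have b1: "(\<Sum>xK\<in>p1. norm (q xK)) < e0/2" by simp
      have "(\<Sum>(x, k)\<in>p. measure lborel k *\<^sub>R g x) - (F c - F b) = sum q p"
        unfolding tot q_def by (simp add: split_def sum_subtractf)
      also have "\<dots> = sum q p1 + sum q p2" unfolding split(1) using split by (intro sum.union_disjoint) auto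
      finally have "norm ((\<Sum>(x, k)\<in>p. measure lborel k *\<^sub>R g x) - (F c - F b)) \<le> norm (sum q p1) + norm (sum q p2)"
        by (simp only: norm_triangle_ineq)
      also have "\<dots> \<le> (\<Sum>xK\<in>p1. norm (q xK)) + (\<Sum>xK\<in>p2. norm (q xK))"
        by (intro add_mono norm_sum)
      also have "(\<Sum>xK\<in>p2. norm (q xK)) \<le> (\<Sum>xK\<in>p2. e * (case xK of (x,K) \<Rightarrow> Sup K - Inf K))"
        by (rule sum_mono) (use b2 in auto)
      also have "\<dots> \<le> (\<Sum>xK\<in>p. e * (case xK of (x,K) \<Rightarrow> Sup K - Inf K))"
      proof (rule sum_mono2[OF fin])
        show "p2 \<subseteq> p" using split by auto
        fix xK assume "xK \<in> p - p2"
        then show "0 \<le> e * (case xK of (x,K) \<Rightarrow> Sup K - Inf K)" using form[of "fst xK" "snd xK"] e by (auto simp: split_def)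
      qed
      also have "\<dots> = e * (c - b)" unfolding tot by (simp add: sum_distrib_left)
      also have "e * (c - b) \<le> e0/2"
      proof -
        have "e0 * (c - b) \<le> e0 * (c - b + 1)" using e0 by (intro mult_left_mono) auto
        then show ?thesis using bc by (simp add: e_def field_simps)
      qed
      finally show "norm ((\<Sum>(x, k)\<in>p. measure lborel k *\<^sub>R g x) - (F c - F b)) < e0" using b1 by linarith
    qed
  qed
  then show ?thesis using has_integral_spike[OF N, of "{b..c}" f g] by (simp add: g_def)
qed

text \<open>
  Averages over cubes with \<open>x\<close> as their lower corner converge almost everywhere; on the line
  this is the right-hand derivative of the indefinite integral.
\<close>

lemma right_lebesgue_points:
  fixes f :: "real \<Rightarrow> complex"
  assumes "\<And>u v. f integrable_on {u..v}"
  obtains N where "negligible N"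
    "\<And>x e. x \<notin> N \<Longrightarrow> 0 < e \<Longrightarrow> \<exists>d>0. \<forall>h. 0 < h \<and> h < d \<longrightarrow> norm (integral {x..x+h} f - h *\<^sub>R f x) \<le> e * h"
proof -
  obtain N where N: "negligible N" "\<And>x e. \<lbrakk>x \<notin> N; 0 < e\<rbrakk> \<Longrightarrow>
               \<exists>d>0. \<forall>h. 0 < h \<and> h < d \<longrightarrow>
                         norm(integral (cbox x (x + h *\<^sub>R One)) f /\<^sub>R h ^ DIM(real) - f x) < e"
    by (rule integrable_ccontinuous_explicit[of f]) (use assms in auto)
  have "\<exists>d>0. \<forall>h. 0 < h \<and> h < d \<longrightarrow> norm (integral {x..x+h} f - h *\<^sub>R f x) \<le> e * h" if xe: "x \<notin> N" "0 < e" for x e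
  proof -
    obtain d where d: "d > 0" "\<forall>h. 0 < h \<and> h < d \<longrightarrow> norm(integral {x..x+h} f /\<^sub>R h - f x) < e"
      using N(2)[OF xe] by auto
    have "norm (integral {x..x+h} f - h *\<^sub>R f x) \<le> e * h" if "0 < h" "h < d" for h
    proof -
      have "integral {x..x+h} f - h *\<^sub>R f x = h *\<^sub>R (integral {x..x+h} f /\<^sub>R h - f x)"
        using that by (simp add: scaleR_diff_right)
      then have "norm (integral {x..x+h} f - h *\<^sub>R f x) = h * norm (integral {x..x+h} f /\<^sub>R h - f x)"
        using that by simp
      also have "\<dots> \<le> h * e" using d(2) that by (intro mult_left_mono) (auto intro: less_imp_le)
      finally show ?thesis by (simp add: mult.commute)
    qed
    then show ?thesis using d(1) by blast
  qed
  then show thesis using that N(1) by blast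
qed

text \<open>
  The left-hand derivative of the indefinite integral of \<open>f\<close> is the right-hand one of the
  reflected function.
\<close>

lemma indefinite_integral_differentiable_ae:
  fixes f :: "real \<Rightarrow> complex"
  assumes f: "\<And>u v. f integrable_on {u..v}"
  obtains N where "negligible N"
    "\<And>a x. x \<notin> N \<Longrightarrow> a < x \<Longrightarrow> ((\<lambda>y. integral {a..y} f) has_vector_derivative f x) (at x)"
proof -
  obtain N1 where N1: "negligible N1"
    "\<And>x e. x \<notin> N1 \<Longrightarrow> 0 < e \<Longrightarrow> \<exists>d>0. \<forall>h. 0 < h \<and> h < d \<longrightarrow> norm (integral {x..x+h} f - h *\<^sub>R f x) \<le> e * h"
    using right_lebesgue_points[OF f] by blast
  have f': "(\<lambda>x. f (-x)) integrable_on {u..v}" for u v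
    using f[of "-v" "-u"] Henstock_Kurzweil_Integration.integrable_reflect_real[where f=f and a="-v" and b="-u"] by simp
  obtain N2 where N2: "negligible N2"
    "\<And>x e. x \<notin> N2 \<Longrightarrow> 0 < e \<Longrightarrow> \<exists>d>0. \<forall>h. 0 < h \<and> h < d \<longrightarrow> norm (integral {x..x+h} (\<lambda>x. f (-x)) - h *\<^sub>R f (-x)) \<le> e * h"
    using right_lebesgue_points[OF f'] by blast
  define N where "N = N1 \<union> uminus ` N2"
  have neg: "negligible N" unfolding N_def
    by (intro negligible_Un N1 negligible_differentiable_image_negligible N2)
       (auto intro!: derivative_intros simp: differentiable_on_def)
  have "((\<lambda>y. integral {a..y} f) has_vector_derivative f x) (at x)" if x: "x \<notin> N" "a < x" for a x
    unfolding has_vector_derivative_def has_derivative_at_alt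
  proof (intro conjI allI impI)
    show "bounded_linear (\<lambda>h. h *\<^sub>R f x)" by (rule bounded_linear_scaleR_left)
    fix e :: real assume e: "e > 0"
    obtain d1 where d1: "d1 > 0" "\<And>h. 0 < h \<Longrightarrow> h < d1 \<Longrightarrow> norm (integral {x..x+h} f - h *\<^sub>R f x) \<le> e * h"
      using N1(2)[of x e] x e by (auto simp: N_def)
    have "- x \<notin> N2" using x(1) unfolding N_def by (metis UnCI add.inverse_inverse imageI)
    then obtain d2 where d2: "d2 > 0" "\<And>h. 0 < h \<Longrightarrow> h < d2 \<Longrightarrow> norm (integral {-x..-x+h} (\<lambda>x. f (-x)) - h *\<^sub>R f x) \<le> e * h"
      using N2(2)[of "-x" e] e by auto
    define d where "d = Min {d1, d2, x - a}"
    have d: "d > 0" "d \<le> d1" "d \<le> d2" "d \<le> x - a" using d1 d2 x by (auto simp: d_def)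
    show "\<exists>d>0. \<forall>y. norm (y - x) < d \<longrightarrow>
         norm (integral {a..y} f - integral {a..x} f - (y - x) *\<^sub>R f x) \<le> e * norm (y - x)"
    proof (intro exI[of _ d] conjI d(1) allI impI)
      fix y assume y: "norm (y - x) < d"
      consider "y = x" | "y > x" | "y < x" by linarith
      then show "norm (integral {a..y} f - integral {a..x} f - (y - x) *\<^sub>R f x) \<le> e * norm (y - x)"
      proof cases
        case 1 then show ?thesis by simp
      next
        case 2
        have "integral {a..x} f + integral {x..y} f = integral {a..y} f"
          by (rule Henstock_Kurzweil_Integration.integral_combine) (use 2 x f in auto)
        then have "integral {a..y} f - integral {a..x} f = integral {x..x+(y-x)} f" by (simp add: algebra_simps)
        then show ?thesis using d1(2)[of "y - x"] 2 y d by simp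
      next
        case 3
        have ay: "a \<le> y" using y d 3 by auto
        have "integral {a..y} f + integral {y..x} f = integral {a..x} f"
          by (rule Henstock_Kurzweil_Integration.integral_combine) (use 3 ay f in auto)
        moreover have "integral {-x..-x+(x-y)} (\<lambda>x. f (-x)) = integral {y..x} f"
          using Henstock_Kurzweil_Integration.integral_reflect_real[of x y f] by simp
        ultimately have "integral {a..y} f - integral {a..x} f - (y - x) *\<^sub>R f x = - (integral {-x..-x+(x-y)} (\<lambda>x. f (-x)) - (x - y) *\<^sub>R f x)"
          by (simp add: algebra_simps)
        moreover have "norm (y - x) = x - y" using 3 by simp
          ultimately show ?thesis using d2(2)[of "x - y"] 3 y d by (simp only: norm_minus_cancel)
      qed
    qed
  qed
  then show thesis using that neg by blast
qed

section \<open>Primitives of integrable functions\<close>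

text \<open>
  \<open>F\<close> is absolutely continuous on \<open>[0, b]\<close> with almost everywhere derivative \<open>f\<close>. The integral
  form is what estimates use, and it determines \<open>F\<close> from \<open>f\<close> and \<open>F 0\<close>.
\<close>

definition primitive_on :: "real \<Rightarrow> (real \<Rightarrow> complex) \<Rightarrow> (real \<Rightarrow> complex) \<Rightarrow> bool" where
  "primitive_on b f F \<longleftrightarrow> f absolutely_integrable_on {0..b} \<and> (\<forall>y\<in>{0..b}. integral {0..y} f = F y - F 0)"

lemma absolutely_integrable_mult_continuous:
  fixes f G :: "real \<Rightarrow> complex"
  assumes f: "f absolutely_integrable_on {u..v}" and G: "continuous_on {u..v} G"
  shows "(\<lambda>t. f t * G t) absolutely_integrable_on {u..v}"
proof -
  have "(\<lambda>t. G t * f t) absolutely_integrable_on {u..v}"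
  proof (rule absolutely_integrable_bounded_measurable_product[where h="(*)" and f=G and g=f])
    show "bilinear ((*) :: complex \<Rightarrow> complex \<Rightarrow> complex)" by (simp add: bilinear_conv_bounded_bilinear bounded_bilinear_mult)
    show "G \<in> borel_measurable (lebesgue_on {u..v})" by (rule continuous_imp_measurable_on_sets_lebesgue[OF G]) simp
    show "bounded (G ` {u..v})" using compact_continuous_image[OF G] by (simp add: compact_imp_bounded)
  qed (use f in auto)
  then show ?thesis by (simp add: mult.commute)
qed

lemma primitive_onD:
  assumes "primitive_on b f F" "0 \<le> x" "x \<le> y" "y \<le> b"
  shows "integral {x..y} f = F y - F x" "f integrable_on {x..y}" "f absolutely_integrable_on {x..y}"
proof -
  have f: "f absolutely_integrable_on {0..b}" and F: "\<And>y. y \<in> {0..b} \<Longrightarrow> integral {0..y} f = F y - F 0"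
    using assms(1) by (auto simp: primitive_on_def)
  have fi: "f absolutely_integrable_on {u..v}" if "0 \<le> u" "v \<le> b" for u v
    by (rule absolutely_integrable_on_subinterval[OF f]) (use that in auto)
  show "f absolutely_integrable_on {x..y}" using fi assms by auto
  then show "f integrable_on {x..y}" using set_lebesgue_integral_eq_integral(1) by blast
  have "f integrable_on {0..y}" using fi[of 0 y] assms set_lebesgue_integral_eq_integral(1) by auto
  then have "integral {0..x} f + integral {x..y} f = integral {0..y} f"
    by (intro Henstock_Kurzweil_Integration.integral_combine) (use assms in auto)
  then show "integral {x..y} f = F y - F x" using F[of x] F[of y] assms by (simp add: algebra_simps)
qed

lemma primitive_on_abs_continuous: "primitive_on b f F \<Longrightarrow> abs_continuous 0 b F"
  by (rule abs_continuous_if_integral[where f=f], simp add: primitive_on_def, simp add: primitive_onD(1))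

lemma primitive_on_continuous:
  assumes "primitive_on b f F" shows "continuous_on {0..b} F"
proof (cases "0 \<le> b")
  case True
  have "f integrable_on {0..b}" using primitive_onD(2)[OF assms, of 0 b] True by auto
  then have "continuous_on {0..b} (\<lambda>y. F 0 + integral {0..y} f)"
    by (intro continuous_intros indefinite_integral_continuous_1)
  then show ?thesis by (rule continuous_on_eq) (use assms in \<open>auto simp: primitive_on_def\<close>)
qed auto

lemma primitive_on_le: "primitive_on b f F \<Longrightarrow> c \<le> b \<Longrightarrow> primitive_on c f F"
  unfolding primitive_on_def by (auto intro: absolutely_integrable_on_subinterval)

lemma primitive_on_cong:
  assumes "primitive_on b f F" "\<And>x. x \<in> {0..b} \<Longrightarrow> f x = g x" "\<And>x. x \<in> {0..b} \<Longrightarrow> F x = G x" 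
  shows "primitive_on b g G"
proof -
  have "integral {0..y} f = integral {0..y} g" if "y \<in> {0..b}" for y
    by (rule integral_cong) (use assms that in auto)
  moreover have "g absolutely_integrable_on {0..b}"
    using assms(1) by (auto simp: primitive_on_def intro: set_integrable_cong[THEN iffD1, OF refl refl assms(2)])
  ultimately show ?thesis using assms(1,3) by (auto simp: primitive_on_def)
qed

lemma primitive_on_differentiable_ae:
  assumes "primitive_on b f F"
  obtains N where "negligible N" "\<And>x. x \<in> {0<..<b} - N \<Longrightarrow> (F has_vector_derivative f x) (at x)"
proof -
  define g where "g = (\<lambda>x. if x \<in> {0..b} then f x else 0)"
  have f: "f absolutely_integrable_on {0..b}" using assms by (simp add: primitive_on_def)
  have "g integrable_on UNIV" unfolding g_def
    using f set_lebesgue_integral_eq_integral(1) integrable_restrict_UNIV by blast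
  then have gi: "g integrable_on {u..v}" for u v using integrable_on_subinterval by blast
  obtain N where N: "negligible N"
    "\<And>a x. x \<notin> N \<Longrightarrow> a < x \<Longrightarrow> ((\<lambda>y. integral {a..y} g) has_vector_derivative g x) (at x)"
    using indefinite_integral_differentiable_ae[OF gi] by blast
  have "(F has_vector_derivative f x) (at x)" if x: "x \<in> {0<..<b} - N" for x
  proof -
    have d: "((\<lambda>y. F 0 + integral {0..y} g) has_vector_derivative g x) (at x)"
      using N(2)[of x 0] x by (auto intro!: derivative_eq_intros)
    have e: "F 0 + integral {0..y} g = F y" if "y \<in> {0<..<b}" for y
    proof -
      have "integral {0..y} g = integral {0..y} f" by (rule integral_cong) (use that in \<open>auto simp: g_def\<close>)
      then show ?thesis using assms that by (auto simp: primitive_on_def)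
    qed
    have "(F has_vector_derivative g x) (at x)"
      by (rule has_vector_derivative_transform_within_open[OF d, of "{0<..<b}"]) (use x e in auto)
    then show ?thesis using x by (simp add: g_def)
  qed
  then show thesis using that N(1) by blast
qed

lemma abs_continuous_subinterval:
  assumes "abs_continuous b c F" "b \<le> b'" "c' \<le> c" shows "abs_continuous b' c' F"
proof -
  have sub: "{b'..c'} \<subseteq> {b..c}" using assms by auto
  show ?thesis unfolding abs_continuous_def
  proof (intro allI impI)
    fix e :: real assume "e > 0"
    then obtain \<delta> where \<delta>: "\<delta> > 0" "\<forall>\<D> T. \<D> division_of T \<and> T \<subseteq> {b..c} \<and> (\<Sum>K\<in>\<D>. Sup K - Inf K) < \<delta> \<longrightarrow>
        (\<Sum>K\<in>\<D>. norm (F (Sup K) - F (Inf K))) < e" using assms(1) unfolding abs_continuous_def by blast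
    show "\<exists>\<delta>>0. \<forall>\<D> T. \<D> division_of T \<and> T \<subseteq> {b'..c'} \<and> (\<Sum>K\<in>\<D>. Sup K - Inf K) < \<delta> \<longrightarrow>
        (\<Sum>K\<in>\<D>. norm (F (Sup K) - F (Inf K))) < e"
    proof (intro exI[of _ \<delta>] conjI \<delta>(1) allI impI)
      fix D T assume D: "D division_of T \<and> T \<subseteq> {b'..c'} \<and> (\<Sum>K\<in>D. Sup K - Inf K) < \<delta>"
      show "(\<Sum>K\<in>D. norm (F (Sup K) - F (Inf K))) < e"
      proof (rule \<delta>(2)[rule_format, of D T], intro conjI)
        show "T \<subseteq> {b..c}" using conjunct1[OF conjunct2[OF D]] sub by (rule order_trans)
        show "D division_of T" "(\<Sum>K\<in>D. Sup K - Inf K) < \<delta>" using conjunct1[OF D] conjunct2[OF conjunct2[OF D]] .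
      qed
    qed
  qed
qed

text \<open>
  Lebesgue's theorem: absolute continuity and the derivative almost everywhere suffice.
\<close>

lemma primitive_onI:
  assumes ac: "abs_continuous 0 b F" and f: "f absolutely_integrable_on {0..b}" and N: "negligible N"
    and der: "\<And>x. x \<in> {0<..<b} - N \<Longrightarrow> (F has_vector_derivative f x) (at x)"
  shows "primitive_on b f F"
  unfolding primitive_on_def
proof (intro conjI f ballI)
  fix y assume y: "y \<in> {0..b}"
  have "(f has_integral (F y - F 0)) {0..y}"
  proof (rule has_integral_abs_continuous)
    show "abs_continuous 0 y F" by (rule abs_continuous_subinterval[OF ac]) (use y in auto)
    show "negligible (N \<union> {0,b})" using N by (intro negligible_Un) auto
    fix x assume "x \<in> {0..y} - (N \<union> {0,b})"
    then show "(F has_vector_derivative f x) (at x within {0..y})"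
      using y by (intro has_vector_derivative_at_within[OF der]) auto
  qed (use y in auto)
  then show "integral {0..y} f = F y - F 0" by (simp add: integral_unique)
qed

lemma primitive_on_C1:
  assumes "\<And>x. x \<in> {0..b} \<Longrightarrow> (F has_vector_derivative f x) (at x within {0..b})" "continuous_on {0..b} f"
  shows "primitive_on b f F"
  unfolding primitive_on_def
proof (intro conjI ballI)
  show "f absolutely_integrable_on {0..b}" by (rule absolutely_integrable_continuous_real[OF assms(2)])
  fix y assume y: "y \<in> {0..b}"
  have "(f has_integral (F y - F 0)) {0..y}"
    by (rule fundamental_theorem_of_calculus) (use y in \<open>auto intro: has_vector_derivative_within_subset[OF assms(1)]\<close>)
  then show "integral {0..y} f = F y - F 0" by (simp add: integral_unique)
qed

lemma primitive_on_has_vector_derivative: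
  assumes F: "primitive_on b f F" and f: "continuous_on {0..b} f" and x: "x \<in> {0..b}"
  shows "(F has_vector_derivative f x) (at x within {0..b})"
proof -
  have "((\<lambda>y. F 0 + integral {0..y} f) has_vector_derivative f x) (at x within {0..b})"
    using integral_has_vector_derivative[OF f x] by (auto intro!: derivative_eq_intros)
  then show ?thesis
    by (rule has_vector_derivative_transform[OF x, rotated]) (use F in \<open>auto simp: primitive_on_def\<close>)
qed

lemma primitive_on_linear:
  assumes F: "primitive_on b f F" and G: "primitive_on b g G"
  shows "primitive_on b (\<lambda>t. c * f t + d * g t) (\<lambda>t. c * F t + d * G t)"
  unfolding primitive_on_def
proof (intro conjI ballI)
  have fi: "f absolutely_integrable_on {0..b}" "g absolutely_integrable_on {0..b}" using assms by (auto simp: primitive_on_def)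
  show "(\<lambda>t. c * f t + d * g t) absolutely_integrable_on {0..b}"
    using fi by (intro set_integral_add(1)) auto
  fix y assume y: "y \<in> {0..b}"
  have "f integrable_on {0..y}" "g integrable_on {0..y}" using primitive_onD(2)[OF F, of 0 y] primitive_onD(2)[OF G, of 0 y] y by auto
  then have "integral {0..y} (\<lambda>t. c * f t + d * g t) = c * integral {0..y} f + d * integral {0..y} g"
    by (subst integral_add) (auto intro: integrable_on_mult_right)
  then show "integral {0..y} (\<lambda>t. c * f t + d * g t) = c * F y + d * G y - (c * F 0 + d * G 0)"
    using primitive_onD(1)[OF F, of 0 y] primitive_onD(1)[OF G, of 0 y] y
    by (metis (no_types, lifting) atLeastAtMost_iff right_diff_distrib add_diff_add order_refl)
qed

lemma primitive_on_cmult: "primitive_on b f F \<Longrightarrow> primitive_on b (\<lambda>t. c * f t) (\<lambda>t. c * F t)"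
  using primitive_on_linear[of b f F f F c 0] by simp

lemma abs_continuous_mult:
  assumes F: "abs_continuous b c F" and G: "abs_continuous b c G"
    and A: "\<And>x. x \<in> {b..c} \<Longrightarrow> norm (F x) \<le> A" and B: "\<And>x. x \<in> {b..c} \<Longrightarrow> norm (G x) \<le> B"
  shows "abs_continuous b c (\<lambda>x. F x * G x)"
  unfolding abs_continuous_def
proof (intro allI impI)
  fix e :: real assume e: "e > 0"
  define M where "M = 1 + \<bar>A\<bar> + \<bar>B\<bar>"
  have M: "M > 0" "A \<le> M" "B \<le> M" by (auto simp: M_def)
  have e2: "e / (2*M) > 0" using e M by simp
  obtain d1 where d1: "d1 > 0" "\<And>\<D> T. \<D> division_of T \<Longrightarrow> T \<subseteq> {b..c} \<Longrightarrow> (\<Sum>K\<in>\<D>. Sup K - Inf K) < d1 \<Longrightarrow>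
        (\<Sum>K\<in>\<D>. norm (F (Sup K) - F (Inf K))) < e/(2*M)" using F e2 unfolding abs_continuous_def by meson
  obtain d2 where d2: "d2 > 0" "\<And>\<D> T. \<D> division_of T \<Longrightarrow> T \<subseteq> {b..c} \<Longrightarrow> (\<Sum>K\<in>\<D>. Sup K - Inf K) < d2 \<Longrightarrow>
        (\<Sum>K\<in>\<D>. norm (G (Sup K) - G (Inf K))) < e/(2*M)" using G e2 unfolding abs_continuous_def by meson
  show "\<exists>\<delta>>0. \<forall>\<D> T. \<D> division_of T \<and> T \<subseteq> {b..c} \<and> (\<Sum>K\<in>\<D>. Sup K - Inf K) < \<delta> \<longrightarrow>
        (\<Sum>K\<in>\<D>. norm (F (Sup K) * G (Sup K) - F (Inf K) * G (Inf K))) < e"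
  proof (intro exI[of _ "min d1 d2"] conjI allI impI)
    fix D T assume "D division_of T \<and> T \<subseteq> {b..c} \<and> (\<Sum>K\<in>D. Sup K - Inf K) < min d1 d2"
    then have D: "D division_of T" "T \<subseteq> {b..c}" "(\<Sum>K\<in>D. Sup K - Inf K) < d1" "(\<Sum>K\<in>D. Sup K - Inf K) < d2" by auto
    have "norm (F (Sup K) * G (Sup K) - F (Inf K) * G (Inf K))
       \<le> M * (norm (G (Sup K) - G (Inf K)) + norm (F (Sup K) - F (Inf K)))" if KD: "K \<in> D" for K
    proof -
      obtain u v where uv: "K = {u..v}" "u \<le> v" "Inf K = u" "Sup K = v" "{u..v} \<subseteq> T"
        using division_elem_real[OF D(1) KD] by blast
      have "{u..v} \<subseteq> {b..c}" using uv(5) D(2) by (rule order_trans)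
      then have "u \<in> {b..c}" "v \<in> {b..c}" using uv(2) by auto
      then have le: "norm (F v) \<le> M" "norm (G u) \<le> M" using A[of v] B[of u] M by linarith+
      have "F v * G v - F u * G u = F v * (G v - G u) + G u * (F v - F u)" by (simp add: algebra_simps)
      then have "norm (F v * G v - F u * G u) \<le> norm (F v) * norm (G v - G u) + norm (G u) * norm (F v - F u)"
        by (metis norm_mult norm_triangle_ineq)
      also have "\<dots> \<le> M * norm (G v - G u) + M * norm (F v - F u)"
        using le by (intro add_mono mult_right_mono) auto
      finally show ?thesis using uv by (simp add: algebra_simps)
    qed
    then have "(\<Sum>K\<in>D. norm (F (Sup K) * G (Sup K) - F (Inf K) * G (Inf K)))
      \<le> (\<Sum>K\<in>D. M * (norm (G (Sup K) - G (Inf K)) + norm (F (Sup K) - F (Inf K))))" by (intro sum_mono) auto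
    also have "\<dots> = M * ((\<Sum>K\<in>D. norm (G (Sup K) - G (Inf K))) + (\<Sum>K\<in>D. norm (F (Sup K) - F (Inf K))))"
      by (simp add: sum.distrib sum_distrib_left distrib_left)
    also have "\<dots> < M * (e/(2*M) + e/(2*M))"
      using d1(2)[OF D(1-3)] d2(2)[OF D(1,2,4)] M by (intro mult_strict_left_mono add_strict_mono) auto
    also have "\<dots> = e" using M by (simp add: field_simps)
    finally show "(\<Sum>K\<in>D. norm (F (Sup K) * G (Sup K) - F (Inf K) * G (Inf K))) < e" .
  qed (use d1 d2 in auto)
qed

text \<open>
  Integration by parts for integrable derivatives. A product of absolutely continuous functions
  is absolutely continuous, and the product rule holds where both factors are differentiable.
\<close>

lemma primitive_on_mult:
  assumes F: "primitive_on b f F" and G: "primitive_on b g G"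
  shows "primitive_on b (\<lambda>t. f t * G t + g t * F t) (\<lambda>t. F t * G t)"
proof -
  have cont: "continuous_on {0..b} F" "continuous_on {0..b} G" using assms primitive_on_continuous by auto
  have fi: "f absolutely_integrable_on {0..b}" "g absolutely_integrable_on {0..b}" using assms by (auto simp: primitive_on_def)
  obtain A where A: "\<forall>x\<in>{0..b}. norm (F x) \<le> A"
    using compact_imp_bounded[OF compact_continuous_image[OF cont(1)]] unfolding bounded_iff by auto
  obtain B where B: "\<forall>x\<in>{0..b}. norm (G x) \<le> B"
    using compact_imp_bounded[OF compact_continuous_image[OF cont(2)]] unfolding bounded_iff by auto
  obtain N1 where N1: "negligible N1" "\<And>x. x \<in> {0<..<b} - N1 \<Longrightarrow> (F has_vector_derivative f x) (at x)"
    using primitive_on_differentiable_ae[OF F] by blast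
  obtain N2 where N2: "negligible N2" "\<And>x. x \<in> {0<..<b} - N2 \<Longrightarrow> (G has_vector_derivative g x) (at x)"
    using primitive_on_differentiable_ae[OF G] by blast
  show ?thesis
  proof (rule primitive_onI)
    show "abs_continuous 0 b (\<lambda>t. F t * G t)"
      by (rule abs_continuous_mult[OF primitive_on_abs_continuous[OF F] primitive_on_abs_continuous[OF G] A[rule_format] B[rule_format]])
    show "(\<lambda>t. f t * G t + g t * F t) absolutely_integrable_on {0..b}"
      by (intro set_integral_add(1) absolutely_integrable_mult_continuous fi cont)
    show "negligible (N1 \<union> N2)" using N1 N2 by auto
    fix x assume "x \<in> {0<..<b} - (N1 \<union> N2)"
    then have "(F has_vector_derivative f x) (at x)" "(G has_vector_derivative g x) (at x)" using N1(2) N2(2) by auto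
    from has_vector_derivative_mult[OF this]
    show "((\<lambda>t. F t * G t) has_vector_derivative f x * G x + g x * F x) (at x)" by (simp add: algebra_simps)
  qed
qed

lemma primitive_on_unique_ae:
  assumes F: "primitive_on b f F" and G: "primitive_on b g G" and eq: "\<And>x. x \<in> {0..b} \<Longrightarrow> F x = G x"
  obtains N where "negligible N" "\<And>x. x \<in> {0<..<b} - N \<Longrightarrow> f x = g x"
proof -
  obtain N1 where N1: "negligible N1" "\<And>x. x \<in> {0<..<b} - N1 \<Longrightarrow> (F has_vector_derivative f x) (at x)"
    using primitive_on_differentiable_ae[OF F] by blast
  obtain N2 where N2: "negligible N2" "\<And>x. x \<in> {0<..<b} - N2 \<Longrightarrow> (G has_vector_derivative g x) (at x)"
    using primitive_on_differentiable_ae[OF G] by blast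
  have "f x = g x" if x: "x \<in> {0<..<b} - (N1 \<union> N2)" for x
  proof -
    have "(F has_vector_derivative g x) (at x)"
      by (rule has_vector_derivative_transform_within_open[where S="{0<..<b}", OF N2(2)]) (use x eq in auto)
    then show ?thesis using N1(2)[of x] x vector_derivative_unique_at by blast
  qed
  moreover have "negligible (N1 \<union> N2)" using N1 N2 by auto
  ultimately show thesis using that by blast
qed

section \<open>Solutions of the Schroedinger equation and their dependence on the energy\<close>

text \<open>
  Integration gains a factor \<open>1 / N\<close> in the supremum norm with weight \<open>exp (- N t)\<close>, while
  multiplication by an integrable function followed by integration costs only its norm in
  \<open>L\<^sup>1\<close> (the next lemma). The equation is of second order, so that the composition of the two
  is a contraction on the whole of a given bounded interval once \<open>N\<close> is large.
\<close>

lemma integral_exp_weight_le: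
  fixes p :: "real \<Rightarrow> complex"
  assumes p: "continuous_on {0..b} p" and le: "\<And>t. t \<in> {0..b} \<Longrightarrow> norm (p t) \<le> M * exp (N * t)"
    and N: "N > 0" and M: "M \<ge> 0" and y: "y \<in> {0..b}"
  shows "norm (integral {0..y} p) \<le> M / N * exp (N * y)"
proof -
  have hi: "((\<lambda>t. M * exp (N * t)) has_integral (M / N * exp (N * y) - M / N * exp (N * 0))) {0..y}"
    using y N by (intro fundamental_theorem_of_calculus)
      (auto intro!: derivative_eq_intros simp flip: has_real_derivative_iff_has_vector_derivative)
  have "norm (integral {0..y} p) \<le> integral {0..y} (\<lambda>t. M * exp (N * t))"
    by (rule integral_norm_bound_integral)
       (use le y has_integral_integrable[OF hi] in \<open>auto intro!: integrable_continuous_real continuous_on_subset[OF p]\<close>)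
  also have "\<dots> \<le> M / N * exp (N * y)" using integral_unique[OF hi] M N by simp
  finally show ?thesis .
qed

lemma integral_mult_exp_weight_le:
  fixes q \<phi> :: "real \<Rightarrow> complex"
  assumes q: "q absolutely_integrable_on {0..b}" and \<phi>: "continuous_on {0..b} \<phi>"
    and le: "\<And>t. t \<in> {0..b} \<Longrightarrow> norm (\<phi> t) \<le> M * exp (N * t)"
    and N: "N \<ge> 0" and M: "M \<ge> 0" and y: "y \<in> {0..b}"
  shows "norm (integral {0..y} (\<lambda>t. q t * \<phi> t)) \<le> integral {0..b} (\<lambda>t. norm (q t)) * M * exp (N * y)"
proof -
  have nq: "(\<lambda>t. norm (q t)) integrable_on {0..b}" using q by (simp add: absolutely_integrable_on_def)
  have nq': "(\<lambda>t. norm (q t)) integrable_on {0..y}" by (rule integrable_on_subinterval[OF nq]) (use y in auto)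
  have "(\<lambda>t. q t * \<phi> t) absolutely_integrable_on {0..y}"
    by (intro absolutely_integrable_mult_continuous absolutely_integrable_on_subinterval[OF q] continuous_on_subset[OF \<phi>]) (use y in auto)
  then have "norm (integral {0..y} (\<lambda>t. q t * \<phi> t)) \<le> integral {0..y} (\<lambda>t. norm (q t) * (M * exp (N * y)))"
  proof (intro integral_norm_bound_integral)
    fix t assume t: "t \<in> {0..y}"
    have "norm (\<phi> t) \<le> M * exp (N * t)" using le[of t] t y by auto
    also have "\<dots> \<le> M * exp (N * y)" using t M N by (intro mult_left_mono) (auto intro: mult_left_mono)
    finally show "norm (q t * \<phi> t) \<le> norm (q t) * (M * exp (N * y))" by (simp add: norm_mult mult_left_mono)
  qed (use nq' set_lebesgue_integral_eq_integral(1) in \<open>auto intro: integrable_on_mult_left\<close>)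
  also have "\<dots> = integral {0..y} (\<lambda>t. norm (q t)) * (M * exp (N * y))" by simp
  also have "\<dots> \<le> integral {0..b} (\<lambda>t. norm (q t)) * (M * exp (N * y))"
    by (intro mult_right_mono integral_subset_le nq nq') (use y M in auto)
  finally show ?thesis by (simp add: mult.assoc)
qed

lemma integral_abs_nonneg:
  fixes V :: "real \<Rightarrow> real"
  assumes "V absolutely_integrable_on {0..b}"
  shows "0 \<le> integral {0..b} (\<lambda>t. \<bar>V t\<bar>)"
  by (rule integral_nonneg) (use assms in \<open>auto simp: absolutely_integrable_on_def\<close>)

text \<open>
  The equation \<open>\<phi>'' = (V - \<mu>) \<phi>\<close> as a first order system for \<open>\<phi>\<close> and \<open>p = \<phi>'\<close>. No initial
  values are prescribed, so the notion is invariant under reflection of the interval.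
\<close>

definition schroedinger_on :: "(real \<Rightarrow> real) \<Rightarrow> complex \<Rightarrow> real \<Rightarrow> (real \<Rightarrow> complex) \<Rightarrow> (real \<Rightarrow> complex) \<Rightarrow> bool" where
  "schroedinger_on V \<mu> b \<phi> p \<longleftrightarrow>
     primitive_on b p \<phi> \<and> primitive_on b (\<lambda>t. (of_real (V t) - \<mu>) * \<phi> t) p"

lemma schroedinger_on_continuous:
  assumes "schroedinger_on V \<mu> b \<phi> p"
  shows "continuous_on {0..b} \<phi>" "continuous_on {0..b} p"
  using assms primitive_on_continuous unfolding schroedinger_on_def by auto

lemma schroedinger_on_le: "schroedinger_on V \<mu> b \<phi> p \<Longrightarrow> c \<le> b \<Longrightarrow> schroedinger_on V \<mu> c \<phi> p"
  unfolding schroedinger_on_def by (auto intro: primitive_on_le)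

lemma schroedinger_on_linear:
  assumes "schroedinger_on V \<mu> b \<phi> p" "schroedinger_on V \<mu> b \<psi> r"
  shows "schroedinger_on V \<mu> b (\<lambda>t. c * \<phi> t + d * \<psi> t) (\<lambda>t. c * p t + d * r t)"
  unfolding schroedinger_on_def
proof
  show "primitive_on b (\<lambda>t. c * p t + d * r t) (\<lambda>t. c * \<phi> t + d * \<psi> t)"
    using assms by (intro primitive_on_linear) (auto simp: schroedinger_on_def)
  have "primitive_on b (\<lambda>t. c * ((of_real (V t) - \<mu>) * \<phi> t) + d * ((of_real (V t) - \<mu>) * \<psi> t)) (\<lambda>t. c * p t + d * r t)"
    using assms by (intro primitive_on_linear) (auto simp: schroedinger_on_def)
  then show "primitive_on b (\<lambda>t. (of_real (V t) - \<mu>) * (c * \<phi> t + d * \<psi> t)) (\<lambda>t. c * p t + d * r t)"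
    by (simp add: algebra_simps)
qed

lemma absolutely_integrable_potential:
  fixes V :: "real \<Rightarrow> real"
  assumes "V absolutely_integrable_on {0..b}"
  shows "(\<lambda>t. of_real (V t) - \<mu> :: complex) absolutely_integrable_on {0..b}"
proof -
  have "(\<lambda>t. complex_of_real (V t)) absolutely_integrable_on {0..b}"
    using absolutely_integrable_linear[OF assms bounded_linear_of_real] by (simp add: o_def)
  then show ?thesis by (rule set_integral_diff(1)) (rule absolutely_integrable_on_const, simp)
qed

text \<open>
  With \<open>M\<close> the weighted supremum of \<open>p\<close>, the contraction property gives \<open>M \<le> (Q / N) M\<close> with
  \<open>Q < N\<close>, so \<open>M = 0\<close>.
\<close>

lemma schroedinger_on_zero:
  assumes V: "V absolutely_integrable_on {0..b}" and S: "schroedinger_on V \<mu> b \<phi> p" and z: "\<phi> 0 = 0" "p 0 = 0"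
    and y: "y \<in> {0..b}"
  shows "\<phi> y = 0 \<and> p y = 0"
proof -
  define q where "q = (\<lambda>t. complex_of_real (V t) - \<mu>)"
  have q: "q absolutely_integrable_on {0..b}" unfolding q_def by (rule absolutely_integrable_potential[OF V])
  define Q where "Q = integral {0..b} (\<lambda>t. norm (q t))"
  have Q: "Q \<ge> 0" unfolding Q_def by (rule integral_nonneg) (use q in \<open>auto simp: absolutely_integrable_on_def\<close>)
  \<comment> \<open>any \<open>N > Q\<close> makes the iteration a strict contraction\<close>
  define N where "N = Q + 1"
  have N: "N > 0" using Q by (simp add: N_def)
  note cont = schroedinger_on_continuous[OF S]
  have cw: "continuous_on {0..b} (\<lambda>t. exp (- N * t) * norm (p t))" by (intro continuous_intros cont)
  have "\<exists>y0\<in>{0..b}. \<forall>t\<in>{0..b}. exp (- N * t) * norm (p t) \<le> exp (- N * y0) * norm (p y0)"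
    by (rule continuous_attains_sup[OF _ _ cw]) (use y in auto)
  then obtain y0 where y0: "y0 \<in> {0..b}" "\<And>t. t \<in> {0..b} \<Longrightarrow> exp (- N * t) * norm (p t) \<le> exp (- N * y0) * norm (p y0)"
    by blast
  define M where "M = exp (- N * y0) * norm (p y0)"
  have M: "M \<ge> 0" by (simp add: M_def)
  have ple: "norm (p t) \<le> M * exp (N * t)" if "t \<in> {0..b}" for t
    using y0(2)[OF that] unfolding M_def[symmetric] by (simp add: exp_minus field_simps)
  have ph: "\<phi> t = integral {0..t} p" if "t \<in> {0..b}" for t
    using primitive_onD(1)[of b p \<phi> 0 t] S that z by (auto simp: schroedinger_on_def)
  have phle: "norm (\<phi> t) \<le> M / N * exp (N * t)" if "t \<in> {0..b}" for t
    unfolding ph[OF that] by (rule integral_exp_weight_le[OF cont(2) ple N M that])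
  have "p y0 = integral {0..y0} (\<lambda>t. q t * \<phi> t)"
    using primitive_onD(1)[of b _ p 0 y0] S y0 z by (auto simp: schroedinger_on_def q_def)
  then have "norm (p y0) \<le> Q * (M / N) * exp (N * y0)"
    using integral_mult_exp_weight_le[OF q cont(1) phle _ _ y0(1)] N M by (simp add: Q_def)
  then have "exp (- N * y0) * norm (p y0) \<le> exp (- N * y0) * (Q * (M / N) * exp (N * y0))" by (intro mult_left_mono) auto
  moreover have "exp (- N * y0) * (Q * (M / N) * exp (N * y0)) = Q * (M / N)"
    by (simp add: exp_minus field_simps)
  ultimately have "M \<le> Q * (M / N)" unfolding M_def[symmetric] by linarith
  then have "M * N \<le> Q * M" using N by (simp add: field_simps)
  then have "M = 0" using M by (simp add: N_def algebra_simps)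
  then show ?thesis using ple[OF y] phle[OF y] by simp
qed

lemma schroedinger_on_unique:
  assumes V: "V absolutely_integrable_on {0..b}" and S: "schroedinger_on V \<mu> b \<phi> p" "schroedinger_on V \<mu> b \<psi> r"
    and z: "\<phi> 0 = \<psi> 0" "p 0 = r 0" and y: "y \<in> {0..b}"
  shows "\<phi> y = \<psi> y" "p y = r y"
  using schroedinger_on_zero[OF V schroedinger_on_linear[OF S, of 1 "-1"] _ _ y] z by auto

text \<open>
  Picard iteration for the derivative of the solution with Cauchy data \<open>(c0, c1)\<close> at \<open>0\<close>.
\<close>

primrec picard :: "(real \<Rightarrow> real) \<Rightarrow> complex \<Rightarrow> complex \<Rightarrow> complex \<Rightarrow> nat \<Rightarrow> real \<Rightarrow> complex" where
  "picard V c0 c1 \<mu> 0 = (\<lambda>y. c1)"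
| "picard V c0 c1 \<mu> (Suc n) = (\<lambda>y. c1 + integral {0..y} (\<lambda>t. (of_real (V t) - \<mu>) * (c0 + integral {0..t} (picard V c0 c1 \<mu> n))))"

text \<open>
  The limit exists at \<open>y \<ge> 0\<close> for locally integrable \<open>V\<close>; elsewhere the value is arbitrary.
\<close>

definition schr_deriv :: "(real \<Rightarrow> real) \<Rightarrow> complex \<Rightarrow> complex \<Rightarrow> complex \<Rightarrow> real \<Rightarrow> complex" where
  "schr_deriv V c0 c1 \<mu> y = lim (\<lambda>n. picard V c0 c1 \<mu> n y)"

definition schr_sol :: "(real \<Rightarrow> real) \<Rightarrow> complex \<Rightarrow> complex \<Rightarrow> complex \<Rightarrow> real \<Rightarrow> complex" where
  "schr_sol V c0 c1 \<mu> y = c0 + integral {0..y} (schr_deriv V c0 c1 \<mu>)"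

text \<open>
  Polynomials in \<open>\<mu>\<close> whose coefficients are continuous functions of \<open>y\<close>, generated inductively so
  that no degrees or coefficients have to be named. The Picard iterates have this form, and so
  their holomorphic dependence on \<open>\<mu>\<close> needs no differentiation under the integral sign.
\<close>

inductive poly_family :: "(complex \<Rightarrow> real \<Rightarrow> complex) \<Rightarrow> bool" where
  const: "(\<And>b. continuous_on {0..b} g) \<Longrightarrow> poly_family (\<lambda>\<mu> y. g y)"
| add: "poly_family h \<Longrightarrow> poly_family k \<Longrightarrow> poly_family (\<lambda>\<mu> y. h \<mu> y + k \<mu> y)"
| mult: "poly_family h \<Longrightarrow> poly_family (\<lambda>\<mu> y. \<mu> * h \<mu> y)"

lemma poly_family_continuous: "poly_family h \<Longrightarrow> continuous_on {0..b} (h \<mu>)"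
  by (induction rule: poly_family.induct) (auto intro!: continuous_intros)

lemma poly_family_holomorphic: "poly_family h \<Longrightarrow> (\<lambda>\<mu>. h \<mu> y) holomorphic_on A"
  by (induction rule: poly_family.induct) (auto intro!: holomorphic_intros)

lemma poly_family_integral:
  assumes q: "\<And>b. q absolutely_integrable_on {0..b}" and h: "poly_family h"
  shows "poly_family (\<lambda>\<mu> y. integral {0..y} (\<lambda>t. q t * h \<mu> t))"
  using h
proof (induction rule: poly_family.induct)
  case (const g)
  have "(\<lambda>t. q t * g t) integrable_on {0..b}" for b
    using absolutely_integrable_mult_continuous[OF q const] set_lebesgue_integral_eq_integral(1) by blast
  then show ?case by (intro poly_family.const indefinite_integral_continuous_1)
next
  case (add h k)
  have int: "(\<lambda>t. q t * h \<mu> t) integrable_on {0..y}" "(\<lambda>t. q t * k \<mu> t) integrable_on {0..y}" for \<mu> y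
    using absolutely_integrable_mult_continuous[OF q poly_family_continuous] add set_lebesgue_integral_eq_integral(1) by blast+
  have "(\<lambda>\<mu> y. integral {0..y} (\<lambda>t. q t * (h \<mu> t + k \<mu> t)))
      = (\<lambda>\<mu> y. integral {0..y} (\<lambda>t. q t * h \<mu> t) + integral {0..y} (\<lambda>t. q t * k \<mu> t))"
    by (intro ext) (simp add: distrib_left integral_add[OF int])
  then show ?case using poly_family.add[OF add.IH] by simp
next
  case (mult h)
  have "(\<lambda>\<mu> y. integral {0..y} (\<lambda>t. q t * (\<mu> * h \<mu> t))) = (\<lambda>\<mu> y. \<mu> * integral {0..y} (\<lambda>t. q t * h \<mu> t))"
    by (intro ext) (simp add: mult.left_commute)
  then show ?case using poly_family.mult[OF mult.IH] by simp
qed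

context
  fixes V :: "real \<Rightarrow> real" and c0 c1 :: complex
  assumes V: "\<And>b. V absolutely_integrable_on {0..b}"
begin

lemma poly_family_picard: "poly_family (\<lambda>\<mu> y. picard V c0 c1 \<mu> n y)"
proof (induction n)
  case 0 then show ?case by (auto intro: poly_family.const)
next
  case (Suc n)
  have one: "(\<lambda>t. c::complex) absolutely_integrable_on {0..b}" for b :: real and c
    by (rule absolutely_integrable_continuous_real) simp
  have Vc: "(\<lambda>t. complex_of_real (V t)) absolutely_integrable_on {0..b}" for b
    using absolutely_integrable_potential[OF V, of b 0] by simp
  have 1: "poly_family (\<lambda>\<mu> y. c0 + integral {0..y} (picard V c0 c1 \<mu> n))" (is "poly_family ?h")
    using poly_family_integral[where q="\<lambda>_. 1", OF one Suc] by (intro poly_family.add poly_family.const) auto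
  have 2: "poly_family (\<lambda>\<mu> y. c1 + (integral {0..y} (\<lambda>t. of_real (V t) * ?h \<mu> t) + \<mu> * integral {0..y} (\<lambda>t. (-1) * ?h \<mu> t)))"
    using one by (intro poly_family.add poly_family.mult poly_family.const poly_family_integral 1 Vc) auto
  have "integral {0..y} (\<lambda>t. (of_real (V t) - \<mu>) * ?h \<mu> t)
     = integral {0..y} (\<lambda>t. of_real (V t) * ?h \<mu> t) + \<mu> * integral {0..y} (\<lambda>t. (-1) * ?h \<mu> t)" for \<mu> y
  proof -
    have "(\<lambda>t. of_real (V t) * ?h \<mu> t) integrable_on {0..y}" "(\<lambda>t. \<mu> * ((-1) * ?h \<mu> t)) integrable_on {0..y}"
      using absolutely_integrable_mult_continuous[OF Vc poly_family_continuous[OF 1]] set_lebesgue_integral_eq_integral(1)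
      by (blast, intro integrable_continuous_real continuous_intros poly_family_continuous[OF 1])
    then have "integral {0..y} (\<lambda>t. of_real (V t) * ?h \<mu> t + \<mu> * ((-1) * ?h \<mu> t))
       = integral {0..y} (\<lambda>t. of_real (V t) * ?h \<mu> t) + integral {0..y} (\<lambda>t. \<mu> * ((-1) * ?h \<mu> t))"
      by (rule integral_add)
    moreover have "(\<lambda>t. (complex_of_real (V t) - \<mu>) * ?h \<mu> t) = (\<lambda>t. of_real (V t) * ?h \<mu> t + \<mu> * ((-1) * ?h \<mu> t))"
      by (intro ext) (simp add: algebra_simps)
    ultimately show ?thesis by (simp only: integral_mult_right)
  qed
  then show ?case using 2 by simp
qed

lemmas picard_continuous = poly_family_continuous[OF poly_family_picard]

lemma integral_norm_potential_le:
  assumes "norm \<mu> \<le> R" "0 \<le> b"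
  shows "integral {0..b} (\<lambda>t. norm (complex_of_real (V t) - \<mu>)) \<le> integral {0..b} (\<lambda>t. \<bar>V t\<bar>) + R * b"
proof -
  have V': "(\<lambda>t. \<bar>V t\<bar>) integrable_on {0..b}" using V[of b] by (simp add: absolutely_integrable_on_def)
  have "integral {0..b} (\<lambda>t. norm (complex_of_real (V t) - \<mu>)) \<le> integral {0..b} (\<lambda>t. \<bar>V t\<bar> + R)"
  proof (rule integral_le)
    fix t show "norm (complex_of_real (V t) - \<mu>) \<le> \<bar>V t\<bar> + R"
      using norm_triangle_ineq4[of "complex_of_real (V t)" \<mu>] assms by simp
  qed (use absolutely_integrable_potential[OF V] V' in \<open>auto simp: absolutely_integrable_on_def intro!: integrable_add\<close>)
  also have "\<dots> = integral {0..b} (\<lambda>t. \<bar>V t\<bar>) + R * b" using V' assms by (subst integral_add) auto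
  finally show ?thesis .
qed

text \<open>
  The increments of the iteration decay like \<open>2^(-n)\<close> in the norm with weight \<open>exp (- N t)\<close>, where
  \<open>N\<close> depends on \<open>b\<close> and on a bound \<open>R\<close> for \<open>\<mu>\<close> only. Uniformity in \<open>\<mu>\<close> is what makes the limit
  entire.
\<close>

lemma picard_uniformly_convergent:
  assumes R: "R \<ge> 0" and b: "b \<ge> 0"
  shows "uniformly_convergent_on ({0..b} \<times> cball 0 R) (\<lambda>n x. picard V c0 c1 (snd x) n (fst x))"
proof -
  define Q where "Q = integral {0..b} (\<lambda>t. \<bar>V t\<bar>) + R * b"
  \<comment> \<open>this weight makes the contraction factor at most one half\<close>
  define N where "N = 2 * Q + 1"
  define M where "M = Q * (norm c0 + norm c1 * exp b)"
  have Q: "Q \<ge> 0" using R b integral_abs_nonneg[OF V, of b] by (simp add: Q_def)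
  then have N: "N > 0" by (simp add: N_def)
  have M: "M \<ge> 0" using Q by (simp add: M_def)
  have ci: "(\<lambda>t. picard V c0 c1 \<mu> n t) integrable_on {0..y}" for \<mu> n y
    by (rule integrable_continuous_real[OF picard_continuous])
  have phic: "continuous_on {0..y} (\<lambda>t. c0 + integral {0..t} (picard V c0 c1 \<mu> n))" for \<mu> n y
    by (intro continuous_intros indefinite_integral_continuous_1 ci)
  have qi: "(\<lambda>t. (complex_of_real (V t) - \<mu>) * (c0 + integral {0..t} (picard V c0 c1 \<mu> n))) integrable_on {0..y}" for \<mu> n y
    using absolutely_integrable_mult_continuous[OF absolutely_integrable_potential[OF V] phic] set_lebesgue_integral_eq_integral(1) by blast
  have diff: "norm (picard V c0 c1 \<mu> (Suc n) y - picard V c0 c1 \<mu> n y) \<le> M / 2 ^ n * exp (N * y)"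
    if mu: "norm \<mu> \<le> R" and y: "y \<in> {0..b}" for \<mu> n y
    using y
  proof (induction n arbitrary: y)
    case 0
    have "norm (integral {0..t} (\<lambda>_. c1)) \<le> norm c1 / 1 * exp (1 * t)" if "t \<in> {0..b}" for t
      by (rule integral_exp_weight_le[OF _ _ _ _ that]) (auto simp: mult_le_cancel_left1)
    then have "norm (c0 + integral {0..t} (\<lambda>_. c1)) \<le> (norm c0 + norm c1 * exp b) * exp (0 * t)" if "t \<in> {0..b}" for t
      using that norm_triangle_ineq[of c0 "integral {0..t} (\<lambda>_. c1)"] 
        mult_left_mono[of "exp t" "exp b" "norm c1"] by fastforce
    from integral_mult_exp_weight_le[OF absolutely_integrable_potential[OF V, of b \<mu>] phic[of b \<mu> 0, simplified picard.simps] this _ _ 0]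
    have "norm (picard V c0 c1 \<mu> (Suc 0) y - picard V c0 c1 \<mu> 0 y)
       \<le> integral {0..b} (\<lambda>t. norm (complex_of_real (V t) - \<mu>)) * (norm c0 + norm c1 * exp b)" by simp
    also have "\<dots> \<le> M" unfolding M_def Q_def using integral_norm_potential_le[OF mu b] by (intro mult_right_mono) auto
    also have "M \<le> M * exp (N * y)" using M N 0 by (simp add: mult_le_cancel_left1)
    finally show ?case by simp
  next
    case (Suc n)
    let ?d = "\<lambda>t. picard V c0 c1 \<mu> (Suc n) t - picard V c0 c1 \<mu> n t"
    have dc: "continuous_on {0..y} ?d" for y by (intro continuous_on_diff picard_continuous)
    have d1: "norm (integral {0..t} ?d) \<le> M / 2 ^ n / N * exp (N * t)" if "t \<in> {0..b}" for t
      by (rule integral_exp_weight_le[OF dc _ N _ that]) (use Suc.IH M in auto)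
    have "norm (integral {0..y} (\<lambda>t. (complex_of_real (V t) - \<mu>) * integral {0..t} ?d))
       \<le> integral {0..b} (\<lambda>t. norm (complex_of_real (V t) - \<mu>)) * (M / 2 ^ n / N) * exp (N * y)"
      by (rule integral_mult_exp_weight_le[OF absolutely_integrable_potential[OF V] _ d1])
         (use M N Suc.prems in \<open>auto intro!: indefinite_integral_continuous_1 integrable_continuous_real[OF dc] simp del: picard.simps\<close>)
    also have "\<dots> \<le> Q * (M / 2 ^ n / N) * exp (N * y)"
      using integral_norm_potential_le[OF mu b] M N by (intro mult_right_mono) (auto simp: Q_def)
    also have "Q * (M / 2 ^ n / N) * exp (N * y) \<le> M / 2 ^ Suc n * exp (N * y)"
    proof (intro mult_right_mono)
      have "Q / N \<le> 1 / 2" using N by (simp add: N_def field_simps)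
      then have "(M / 2 ^ n) * (Q / N) \<le> (M / 2 ^ n) * (1 / 2)" using M by (intro mult_left_mono) auto
      then show "Q * (M / 2 ^ n / N) \<le> M / 2 ^ Suc n" by (simp add: field_simps)
    qed auto
    also have "(\<lambda>t. (complex_of_real (V t) - \<mu>) * integral {0..t} ?d) =
        (\<lambda>t. (complex_of_real (V t) - \<mu>) * (c0 + integral {0..t} (picard V c0 c1 \<mu> (Suc n)))
           - (complex_of_real (V t) - \<mu>) * (c0 + integral {0..t} (picard V c0 c1 \<mu> n)))"
      by (intro ext) (simp add: integral_diff[OF ci ci] right_diff_distrib[symmetric] del: picard.simps)
    finally show ?case
      using integral_diff[OF qi qi, of y \<mu> "Suc n" \<mu> n] by simp
  qed
  have "uniformly_convergent_on ({0..b} \<times> cball 0 R)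
     (\<lambda>n x. \<Sum>i<n. picard V c0 c1 (snd x) (Suc i) (fst x) - picard V c0 c1 (snd x) i (fst x))"
  proof (rule Weierstrass_m_test')
    fix n x assume "x \<in> {0..b} \<times> cball (0::complex) R"
    then have x: "norm (snd x) \<le> R" "fst x \<in> {0..b}" by auto
    have "norm (picard V c0 c1 (snd x) (Suc n) (fst x) - picard V c0 c1 (snd x) n (fst x)) \<le> M / 2 ^ n * exp (N * fst x)"
      by (rule diff[OF x])
    also have "\<dots> \<le> M / 2 ^ n * exp (N * b)" using x(2) N M by (intro mult_left_mono) auto
    finally show "norm (picard V c0 c1 (snd x) (Suc n) (fst x) - picard V c0 c1 (snd x) n (fst x)) \<le> (M * exp (N * b)) * (1/2) ^ n"
      by (simp add: power_divide mult_ac)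
  next
    show "summable (\<lambda>n. (M * exp (N * b)) * (1/2) ^ n)" by (intro summable_mult summable_geometric) simp
  qed
  then have "uniformly_convergent_on ({0..b} \<times> cball 0 R)
     (\<lambda>n x. picard V c0 c1 (snd x) n (fst x) - c1)"
    by (subst (asm) sum_lessThan_telescope) simp
  then have "uniformly_convergent_on ({0..b} \<times> cball 0 R)
     (\<lambda>n x. (picard V c0 c1 (snd x) n (fst x) - c1) + c1)"
    by (intro uniformly_convergent_add uniformly_convergent_on_const)
  then show ?thesis by simp
qed

lemma picard_uniform_limit:
  assumes R: "R \<ge> 0" and b: "b \<ge> 0" and e: "e > 0"
  shows "\<forall>\<^sub>F n in sequentially. \<forall>y\<in>{0..b}. \<forall>\<mu>\<in>cball 0 R. norm (picard V c0 c1 \<mu> n y - schr_deriv V c0 c1 \<mu> y) < e"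
proof -
  have "uniform_limit ({0..b} \<times> cball 0 R) (\<lambda>n x. picard V c0 c1 (snd x) n (fst x)) (\<lambda>x. lim (\<lambda>n. picard V c0 c1 (snd x) n (fst x))) sequentially"
    using picard_uniformly_convergent[OF R b] by (simp add: uniformly_convergent_uniform_limit_iff)
  from uniform_limitD[OF this e] show ?thesis
    by (rule eventually_mono) (auto simp: dist_norm schr_deriv_def)
qed

lemma schr_deriv_continuous: "continuous_on {0..b} (schr_deriv V c0 c1 \<mu>)"
proof (cases "b \<ge> 0")
  case True
  have "uniform_limit {0..b} (picard V c0 c1 \<mu>) (schr_deriv V c0 c1 \<mu>) sequentially"
  proof (rule uniform_limitI)
    fix e :: real assume "e > 0"
    from picard_uniform_limit[OF norm_ge_zero[of \<mu>] True this]
    show "\<forall>\<^sub>F n in sequentially. \<forall>x\<in>{0..b}. dist (picard V c0 c1 \<mu> n x) (schr_deriv V c0 c1 \<mu> x) < e"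
      by eventually_elim (auto simp: dist_norm)
  qed
  then show ?thesis by (rule uniform_limit_theorem[rotated]) (auto simp: picard_continuous)
qed auto

lemma schr_sol_uniform_limit:
  assumes R: "R \<ge> 0" and b: "b \<ge> 0" and e: "e > 0"
  shows "\<forall>\<^sub>F n in sequentially. \<forall>y\<in>{0..b}. \<forall>\<mu>\<in>cball 0 R. norm (c0 + integral {0..y} (picard V c0 c1 \<mu> n) - schr_sol V c0 c1 \<mu> y) < e"
proof -
  have "e / (2 * exp b) > 0" using e by simp
  from picard_uniform_limit[OF R b this] show ?thesis
  proof eventually_elim
    case (elim n)
    show ?case
    proof (intro ballI)
      fix y and \<mu> :: complex assume y: "y \<in> {0..b}" and mu: "\<mu> \<in> cball 0 R"
      have "norm (integral {0..y} (\<lambda>t. picard V c0 c1 \<mu> n t - schr_deriv V c0 c1 \<mu> t)) \<le> e / (2 * exp b) / 1 * exp (1 * y)"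
      proof (rule integral_exp_weight_le[OF _ _ _ _ y])
        fix t assume t: "t \<in> {0..b}"
        have "norm (picard V c0 c1 \<mu> n t - schr_deriv V c0 c1 \<mu> t) \<le> e / (2 * exp b)" using elim t mu by (auto intro: less_imp_le)
        also have "\<dots> \<le> e / (2 * exp b) * exp (1 * t)"
          using mult_left_mono[of 1 "exp (1 * t)" "e / (2 * exp b)"] t e by simp
        finally show "norm (picard V c0 c1 \<mu> n t - schr_deriv V c0 c1 \<mu> t) \<le> e / (2 * exp b) * exp (1 * t)" .
      qed (use e in \<open>auto intro!: continuous_intros picard_continuous schr_deriv_continuous\<close>)
      also have "\<dots> \<le> e / (2 * exp b) * exp b" using mult_left_mono[of "exp y" "exp b" "e / (2 * exp b)"] y e by simp
      also have "\<dots> < e" using e by simp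
      finally show "norm (c0 + integral {0..y} (picard V c0 c1 \<mu> n) - schr_sol V c0 c1 \<mu> y) < e"
        by (subst (asm) integral_diff)
           (auto simp: schr_sol_def intro!: integrable_continuous_real picard_continuous schr_deriv_continuous)
    qed
  qed
qed

lemma schr_sol_continuous: "continuous_on {0..b} (schr_sol V c0 c1 \<mu>)"
  unfolding schr_sol_def[abs_def]
  by (intro continuous_intros indefinite_integral_continuous_1 integrable_continuous_real schr_deriv_continuous)

lemma schr_deriv_integral_equation:
  assumes y: "y \<ge> 0"
  shows "schr_deriv V c0 c1 \<mu> y = c1 + integral {0..y} (\<lambda>t. (of_real (V t) - \<mu>) * schr_sol V c0 c1 \<mu> t)"
proof -
  let ?q = "\<lambda>t. complex_of_real (V t) - \<mu>"
  define Q where "Q = integral {0..y} (\<lambda>t. norm (?q t))"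
  have Q: "Q \<ge> 0" unfolding Q_def
    by (rule integral_nonneg) (use absolutely_integrable_potential[OF V] in \<open>auto simp: absolutely_integrable_on_def\<close>)
  have phic: "continuous_on {0..y} (\<lambda>t. c0 + integral {0..t} (picard V c0 c1 \<mu> n))" for n
    by (intro continuous_intros indefinite_integral_continuous_1 integrable_continuous_real picard_continuous)
  have qi: "(\<lambda>t. ?q t * g t) integrable_on {0..y}" if "continuous_on {0..y} g" for g
    using absolutely_integrable_mult_continuous[OF absolutely_integrable_potential[OF V] that] set_lebesgue_integral_eq_integral(1) by blast
  have "(\<lambda>n. picard V c0 c1 \<mu> n y) \<longlonglongrightarrow> schr_deriv V c0 c1 \<mu> y"
  proof (rule tendstoI)
    fix e :: real assume "e > 0"
    from picard_uniform_limit[OF norm_ge_zero[of \<mu>] y this]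
    show "\<forall>\<^sub>F n in sequentially. dist (picard V c0 c1 \<mu> n y) (schr_deriv V c0 c1 \<mu> y) < e"
      by eventually_elim (use y in \<open>auto simp: dist_norm\<close>)
  qed
  then have 1: "(\<lambda>n. picard V c0 c1 \<mu> (Suc n) y) \<longlonglongrightarrow> schr_deriv V c0 c1 \<mu> y" by (rule LIMSEQ_Suc)
  have 2: "(\<lambda>n. picard V c0 c1 \<mu> (Suc n) y) \<longlonglongrightarrow> c1 + integral {0..y} (\<lambda>t. ?q t * schr_sol V c0 c1 \<mu> t)"
  proof (rule tendstoI)
    fix e :: real assume e: "e > 0"
    have "e / (Q + 1) > 0" using e Q by simp
    from schr_sol_uniform_limit[OF norm_ge_zero[of \<mu>] y this]
    show "\<forall>\<^sub>F n in sequentially. dist (picard V c0 c1 \<mu> (Suc n) y) (c1 + integral {0..y} (\<lambda>t. ?q t * schr_sol V c0 c1 \<mu> t)) < e"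
    proof eventually_elim
      case (elim n)
      let ?d = "\<lambda>t. (c0 + integral {0..t} (picard V c0 c1 \<mu> n)) - schr_sol V c0 c1 \<mu> t"
      have dc: "continuous_on {0..y} ?d" by (intro continuous_on_diff phic schr_sol_continuous)
      have "norm (integral {0..y} (\<lambda>t. ?q t * ?d t)) \<le> Q * (e / (Q + 1)) * exp (0 * y)"
        unfolding Q_def
        by (rule integral_mult_exp_weight_le[OF absolutely_integrable_potential[OF V] dc])
           (use elim e y Q in \<open>auto intro: less_imp_le simp: Q_def[symmetric]\<close>)
      also have "\<dots> < e" using e Q by (simp add: field_simps)
      finally show ?case
        by (simp add: dist_norm right_diff_distrib integral_diff[OF qi[OF phic] qi[OF schr_sol_continuous]])
    qed
  qed
  show ?thesis by (rule LIMSEQ_unique[OF 1 2])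
qed

lemma schroedinger_on_schr_sol: "schroedinger_on V \<mu> b (schr_sol V c0 c1 \<mu>) (schr_deriv V c0 c1 \<mu>)"
  unfolding schroedinger_on_def primitive_on_def
proof (intro conjI ballI)
  show "schr_deriv V c0 c1 \<mu> absolutely_integrable_on {0..b}"
    by (rule absolutely_integrable_continuous_real[OF schr_deriv_continuous])
  show "(\<lambda>t. (complex_of_real (V t) - \<mu>) * schr_sol V c0 c1 \<mu> t) absolutely_integrable_on {0..b}"
    by (rule absolutely_integrable_mult_continuous[OF absolutely_integrable_potential[OF V] schr_sol_continuous])
qed (use schr_deriv_integral_equation[of 0 \<mu>] in \<open>auto simp: schr_sol_def schr_deriv_integral_equation\<close>)

lemma schr_initial: "schr_sol V c0 c1 \<mu> 0 = c0" "schr_deriv V c0 c1 \<mu> 0 = c1"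
  using schr_deriv_integral_equation[of 0 \<mu>] by (auto simp: schr_sol_def)

lemma schr_holomorphic:
  assumes y: "y \<ge> 0"
  shows "(\<lambda>\<mu>. schr_sol V c0 c1 \<mu> y) holomorphic_on UNIV" "(\<lambda>\<mu>. schr_deriv V c0 c1 \<mu> y) holomorphic_on UNIV"
proof -
  have *: "g holomorphic_on UNIV"
    if f: "\<And>n. f n holomorphic_on UNIV"
      and lim: "\<And>R e. R \<ge> 0 \<Longrightarrow> e > 0 \<Longrightarrow> \<forall>\<^sub>F n in sequentially. \<forall>\<mu>\<in>cball 0 R. norm (f n \<mu> - g \<mu>) < e"
    for f :: "nat \<Rightarrow> complex \<Rightarrow> complex" and g
  proof (rule holomorphic_uniform_sequence[OF open_UNIV])
    show "f n holomorphic_on UNIV" for n by (rule f)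
    fix x :: complex
    have "uniform_limit (cball x 1) f g sequentially"
    proof (rule uniform_limitI)
      fix e :: real assume e: "e > 0"
      have "cball x 1 \<subseteq> cball 0 (norm x + 1)" by (auto simp: dist_norm) (metis add.commute norm_triangle_sub order_trans add_left_mono norm_minus_commute)
      then show "\<forall>\<^sub>F n in sequentially. \<forall>z\<in>cball x 1. dist (f n z) (g z) < e"
        using eventually_mono[OF lim[of "norm x + 1" e]] e by (auto simp: dist_norm subset_iff elim!: eventually_mono)
    qed
    then show "\<exists>d>0. cball x d \<subseteq> UNIV \<and> uniform_limit (cball x d) f g sequentially" by (intro exI[of _ 1]) auto
  qed
  have one: "(\<lambda>t. c::complex) absolutely_integrable_on {0..b}" for b :: real and c
    by (rule absolutely_integrable_continuous_real) simp
  show "(\<lambda>\<mu>. schr_sol V c0 c1 \<mu> y) holomorphic_on UNIV"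
  proof (rule *)
    show "(\<lambda>\<mu>. c0 + integral {0..y} (picard V c0 c1 \<mu> n)) holomorphic_on UNIV" for n
      using poly_family_holomorphic[OF poly_family_integral[where q="\<lambda>_. 1", OF one poly_family_picard]]
      by (intro holomorphic_intros) auto
    fix R e :: real assume "R \<ge> 0" "e > 0"
    from schr_sol_uniform_limit[OF this(1) y this(2)]
    show "\<forall>\<^sub>F n in sequentially. \<forall>\<mu>\<in>cball 0 R. norm (c0 + integral {0..y} (picard V c0 c1 \<mu> n) - schr_sol V c0 c1 \<mu> y) < e"
      by eventually_elim (use y in auto)
  qed
  show "(\<lambda>\<mu>. schr_deriv V c0 c1 \<mu> y) holomorphic_on UNIV"
  proof (rule *)
    show "(\<lambda>\<mu>. picard V c0 c1 \<mu> n y) holomorphic_on UNIV" for n by (rule poly_family_holomorphic[OF poly_family_picard])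
    fix R e :: real assume "R \<ge> 0" "e > 0"
    from picard_uniform_limit[OF this(1) y this(2)]
    show "\<forall>\<^sub>F n in sequentially. \<forall>\<mu>\<in>cball 0 R. norm (picard V c0 c1 \<mu> n y - schr_deriv V c0 c1 \<mu> y) < e"
      by eventually_elim (use y in auto)
  qed
qed

end

section \<open>Asymptotics at high energy and agreement of proportional solutions\<close>

text \<open>
  For \<open>\<mu> = - \<kappa>\<^sup>2\<close> the combination \<open>p + \<kappa> \<phi>\<close> solves the first order equation
  \<open>u' = \<kappa> u + V \<phi>\<close>, which the factor \<open>exp (- \<kappa> y)\<close> integrates. Replacing \<open>\<kappa>\<close> by \<open>- \<kappa>\<close>
  gives the companion \<open>p - \<kappa> \<phi>\<close>, and the pair recovers \<open>\<phi>\<close> and \<open>p\<close>.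
\<close>

lemma exp_variation_of_constants:
  assumes S: "schroedinger_on V (- (\<kappa>\<^sup>2)) b \<phi> p" and y: "y \<in> {0..b}"
  shows "exp (- \<kappa> * of_real y) * (p y + \<kappa> * \<phi> y)
       = (p 0 + \<kappa> * \<phi> 0) + integral {0..y} (\<lambda>t. of_real (V t) * (exp (- \<kappa> * of_real t) * \<phi> t))"
proof -
  have 1: "primitive_on b (\<lambda>t. - \<kappa> * exp (- \<kappa> * of_real t)) (\<lambda>t. exp (- \<kappa> * of_real t))"
  proof (rule primitive_on_C1)
    fix x assume "x \<in> {0..b}"
    have "((\<lambda>z. exp (- \<kappa> * z)) has_field_derivative exp (- \<kappa> * of_real x) * (- \<kappa>)) (at (of_real x))"
      by (auto intro!: derivative_eq_intros)
    from has_vector_derivative_real_field[OF this]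
    show "((\<lambda>t. exp (- \<kappa> * of_real t)) has_vector_derivative - \<kappa> * exp (- \<kappa> * of_real x)) (at x within {0..b})"
      by (simp add: mult.commute)
  qed (auto intro!: continuous_intros)
  have 2: "primitive_on b (\<lambda>t. 1 * ((of_real (V t) - - (\<kappa>\<^sup>2)) * \<phi> t) + \<kappa> * p t) (\<lambda>t. 1 * p t + \<kappa> * \<phi> t)"
    using S by (intro primitive_on_linear) (auto simp: schroedinger_on_def)
  have "primitive_on b (\<lambda>t. of_real (V t) * (exp (- \<kappa> * of_real t) * \<phi> t)) (\<lambda>t. exp (- \<kappa> * of_real t) * (p t + \<kappa> * \<phi> t))"
    by (rule primitive_on_cong[OF primitive_on_mult[OF 1 2]]) (auto simp: algebra_simps power2_eq_square)
  from primitive_onD(1)[OF this, of 0 y] y show ?thesis by (simp add: algebra_simps)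
qed

lemma variation_error_le:
  assumes V: "V absolutely_integrable_on {0..b}" and S: "schroedinger_on V (- (\<kappa>\<^sup>2)) b \<phi> p"
    and M: "\<And>t. t \<in> {0..b} \<Longrightarrow> norm (\<phi> t) \<le> M * exp (\<bar>Re \<kappa>\<bar> * t)" "M \<ge> 0" and y: "y \<in> {0..b}"
  shows "norm (p y + \<kappa> * \<phi> y - exp (\<kappa> * of_real y) * (p 0 + \<kappa> * \<phi> 0))
       \<le> integral {0..b} (\<lambda>t. \<bar>V t\<bar>) * M * exp (\<bar>Re \<kappa>\<bar> * y)"
proof -
  let ?I = "integral {0..y} (\<lambda>t. of_real (V t) * (exp (- \<kappa> * of_real t) * \<phi> t))"
  have sub: "{0..y} \<subseteq> {0..b}" using y by auto
  have Vc: "(\<lambda>t. complex_of_real (V t)) absolutely_integrable_on {0..y}"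
    using absolutely_integrable_potential[OF absolutely_integrable_on_subinterval[OF V sub], of 0] by simp
  have "exp (\<kappa> * of_real y) * (exp (- \<kappa> * of_real y) * (p y + \<kappa> * \<phi> y)) = p y + \<kappa> * \<phi> y"
    by (simp add: exp_minus field_simps)
  then have "p y + \<kappa> * \<phi> y = exp (\<kappa> * of_real y) * ((p 0 + \<kappa> * \<phi> 0) + ?I)"
    unfolding exp_variation_of_constants[OF S y] by (rule sym)
  then have "p y + \<kappa> * \<phi> y - exp (\<kappa> * of_real y) * (p 0 + \<kappa> * \<phi> 0) = exp (\<kappa> * of_real y) * ?I"
    by (simp add: algebra_simps)
  also have "\<dots> = integral {0..y} (\<lambda>t. of_real (V t) * (exp (\<kappa> * of_real (y - t)) * \<phi> t))"
  proof -
    have "exp (\<kappa> * of_real y) * ?I = integral {0..y} (\<lambda>t. exp (\<kappa> * of_real y) * (of_real (V t) * (exp (- \<kappa> * of_real t) * \<phi> t)))"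
      by simp
    also have "\<dots> = integral {0..y} (\<lambda>t. of_real (V t) * (exp (\<kappa> * of_real (y - t)) * \<phi> t))"
      by (rule integral_cong) (simp add: exp_diff exp_minus field_simps)
    finally show ?thesis .
  qed
  also have "norm \<dots> \<le> integral {0..y} (\<lambda>t. norm (complex_of_real (V t))) * (M * exp (\<bar>Re \<kappa>\<bar> * y)) * exp (0 * y)"
  proof (rule integral_mult_exp_weight_le[OF Vc])
    show "continuous_on {0..y} (\<lambda>t. exp (\<kappa> * of_real (y - t)) * \<phi> t)"
      by (intro continuous_intros continuous_on_subset[OF schroedinger_on_continuous(1)[OF S] sub])
    fix t assume t: "t \<in> {0..y}"
    have "norm (exp (\<kappa> * of_real (y - t))) = exp (Re \<kappa> * (y - t))" by (simp add: norm_exp_eq_Re)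
    also have "\<dots> \<le> exp (\<bar>Re \<kappa>\<bar> * (y - t))" using t by (auto intro: mult_right_mono)
    finally have "norm (exp (\<kappa> * of_real (y - t)) * \<phi> t) \<le> exp (\<bar>Re \<kappa>\<bar> * (y - t)) * (M * exp (\<bar>Re \<kappa>\<bar> * t))"
      unfolding norm_mult using M t y by (intro mult_mono) auto
    also have "\<dots> = M * exp (\<bar>Re \<kappa>\<bar> * y) * exp (0 * t)"
      by (simp add: right_diff_distrib exp_diff field_simps)
    finally show "norm (exp (\<kappa> * of_real (y - t)) * \<phi> t) \<le> M * exp (\<bar>Re \<kappa>\<bar> * y) * exp (0 * t)" .
  qed (use M y in auto)
  also have "\<dots> \<le> integral {0..b} (\<lambda>t. \<bar>V t\<bar>) * (M * exp (\<bar>Re \<kappa>\<bar> * y)) * exp (0 * y)"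
  proof (intro mult_right_mono)
    have Vb: "(\<lambda>t. \<bar>V t\<bar>) integrable_on {0..b}" using V by (simp add: absolutely_integrable_on_def)
    show "integral {0..y} (\<lambda>t. norm (complex_of_real (V t))) \<le> integral {0..b} (\<lambda>t. \<bar>V t\<bar>)"
      by (simp, rule integral_subset_le[OF sub integrable_on_subinterval[OF Vb sub] Vb]) auto
  qed (use M in auto)
  finally show ?thesis by (simp add: mult_ac)
qed

text \<open>
  Let \<open>A\<close> be the supremum of \<open>exp (- \<bar>Re \<kappa>\<bar> t) \<bar>p \<plusminus> \<kappa> \<phi>\<bar>\<close>. Since \<open>2 \<kappa> \<phi>\<close> is the difference of
  the two combinations, \<open>\<phi>\<close> is smaller by a factor \<open>1 / \<bar>\<kappa>\<bar>\<close>, and variation of constants gives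
  \<open>A \<le> B + W A / \<bar>\<kappa>\<bar> \<le> B + A / 2\<close>, where \<open>W\<close> is the norm of \<open>V\<close> in \<open>L\<^sup>1\<close>.
\<close>

lemma schroedinger_on_bounds:
  assumes V: "V absolutely_integrable_on {0..b}" and S: "schroedinger_on V (- (\<kappa>\<^sup>2)) b \<phi> p"
    and \<kappa>: "\<kappa> \<noteq> 0" "2 * integral {0..b} (\<lambda>t. \<bar>V t\<bar>) \<le> norm \<kappa>"
    and B: "norm (p 0 + \<kappa> * \<phi> 0) \<le> B" "norm (p 0 - \<kappa> * \<phi> 0) \<le> B" and y: "y \<in> {0..b}"
  shows "norm (\<phi> y) \<le> 2 * B / norm \<kappa> * exp (\<bar>Re \<kappa>\<bar> * y)"
    and "norm (p y) \<le> 2 * B * exp (\<bar>Re \<kappa>\<bar> * y)"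
    and "norm (p y + \<kappa> * \<phi> y - exp (\<kappa> * of_real y) * (p 0 + \<kappa> * \<phi> 0))
       \<le> integral {0..b} (\<lambda>t. \<bar>V t\<bar>) * (2 * B / norm \<kappa>) * exp (\<bar>Re \<kappa>\<bar> * y)"
proof -
  define W where "W = integral {0..b} (\<lambda>t. \<bar>V t\<bar>)"
  define w where "w = (\<lambda>t. exp (- \<bar>Re \<kappa>\<bar> * t) * max (norm (p t + \<kappa> * \<phi> t)) (norm (p t - \<kappa> * \<phi> t)))"
  have B0: "B \<ge> 0" using B(1) norm_ge_zero order_trans by blast
  have S': "schroedinger_on V (- ((-\<kappa>)\<^sup>2)) b \<phi> p" using S by simp
  have W0: "W \<ge> 0" unfolding W_def by (rule integral_abs_nonneg[OF V])
  have cw: "continuous_on {0..b} w" unfolding w_def by (intro continuous_intros schroedinger_on_continuous[OF S])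
  have "\<exists>y0\<in>{0..b}. \<forall>t\<in>{0..b}. w t \<le> w y0" by (rule continuous_attains_sup[OF _ _ cw]) (use y in auto)
  then obtain y0 where y0: "y0 \<in> {0..b}" "\<And>t. t \<in> {0..b} \<Longrightarrow> w t \<le> w y0" by blast
  define A where "A = w y0"
  have A0: "A \<ge> 0" by (auto simp: A_def w_def le_max_iff_disj)
  have le1: "norm (p t + \<kappa> * \<phi> t) \<le> A * exp (\<bar>Re \<kappa>\<bar> * t)" and le2: "norm (p t - \<kappa> * \<phi> t) \<le> A * exp (\<bar>Re \<kappa>\<bar> * t)"
    if "t \<in> {0..b}" for t
  proof -
    have "max (norm (p t + \<kappa> * \<phi> t)) (norm (p t - \<kappa> * \<phi> t)) = exp (\<bar>Re \<kappa>\<bar> * t) * w t"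
      by (simp add: w_def exp_minus)
    also have "\<dots> \<le> exp (\<bar>Re \<kappa>\<bar> * t) * A" using y0(2)[OF that] by (intro mult_left_mono) (auto simp: A_def)
    finally show "norm (p t + \<kappa> * \<phi> t) \<le> A * exp (\<bar>Re \<kappa>\<bar> * t)" "norm (p t - \<kappa> * \<phi> t) \<le> A * exp (\<bar>Re \<kappa>\<bar> * t)"
      by (auto simp: mult.commute)
  qed
  have ph: "norm (\<phi> t) \<le> A / norm \<kappa> * exp (\<bar>Re \<kappa>\<bar> * t)" if t: "t \<in> {0..b}" for t
  proof -
    have "(p t + \<kappa> * \<phi> t) - (p t - \<kappa> * \<phi> t) = 2 * \<kappa> * \<phi> t" by simp
    then have "2 * norm \<kappa> * norm (\<phi> t) \<le> norm (p t + \<kappa> * \<phi> t) + norm (p t - \<kappa> * \<phi> t)"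
      by (metis norm_mult norm_numeral norm_triangle_ineq4)
    also have "\<dots> \<le> A * exp (\<bar>Re \<kappa>\<bar> * t) + A * exp (\<bar>Re \<kappa>\<bar> * t)" using le1[OF t] le2[OF t] by simp
    finally show ?thesis using \<kappa>(1) by (simp add: field_simps)
  qed
  have pn: "norm (p t) \<le> A * exp (\<bar>Re \<kappa>\<bar> * t)" if t: "t \<in> {0..b}" for t
  proof -
    have "(p t + \<kappa> * \<phi> t) + (p t - \<kappa> * \<phi> t) = 2 * p t" by simp
    then have "2 * norm (p t) \<le> norm (p t + \<kappa> * \<phi> t) + norm (p t - \<kappa> * \<phi> t)"
      by (metis norm_mult norm_numeral norm_triangle_ineq)
    then show ?thesis using le1[OF t] le2[OF t] by simp
  qed
  have AK: "A / norm \<kappa> \<ge> 0" using A0 by simp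
  have WA: "W * (A / norm \<kappa>) \<le> A / 2"
  proof -
    have "2 * W * A \<le> norm \<kappa> * A" using \<kappa>(2) A0 unfolding W_def by (intro mult_right_mono) auto
    then show ?thesis using \<kappa>(1) by (simp add: field_simps)
  qed
  have step: "norm (p y0 + k * \<phi> y0) \<le> (B + A / 2) * exp (\<bar>Re \<kappa>\<bar> * y0)"
    if k: "k = \<kappa> \<or> k = - \<kappa>" for k
  proof -
    have Sk: "schroedinger_on V (- (k\<^sup>2)) b \<phi> p" and Rk: "\<bar>Re k\<bar> = \<bar>Re \<kappa>\<bar>" and Bk: "norm (p 0 + k * \<phi> 0) \<le> B"
      using S k B by auto
    have "norm (p y0 + k * \<phi> y0 - exp (k * of_real y0) * (p 0 + k * \<phi> 0)) \<le> W * (A / norm \<kappa>) * exp (\<bar>Re \<kappa>\<bar> * y0)"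
      using variation_error_le[OF V Sk _ AK y0(1)] ph Rk by (simp add: W_def)
    also have "\<dots> \<le> A / 2 * exp (\<bar>Re \<kappa>\<bar> * y0)" using WA by (intro mult_right_mono) auto
    finally have 1: "norm (p y0 + k * \<phi> y0 - exp (k * of_real y0) * (p 0 + k * \<phi> 0)) \<le> A / 2 * exp (\<bar>Re \<kappa>\<bar> * y0)" .
    have "norm (exp (k * of_real y0)) = exp (Re k * y0)" by (simp add: norm_exp_eq_Re)
    also have "\<dots> \<le> exp (\<bar>Re \<kappa>\<bar> * y0)" unfolding Rk[symmetric] using y0(1) by (auto intro: mult_right_mono)
    finally have "norm (exp (k * of_real y0) * (p 0 + k * \<phi> 0)) \<le> exp (\<bar>Re \<kappa>\<bar> * y0) * B"
      unfolding norm_mult using Bk by (intro mult_mono) auto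
    then have "norm (p y0 + k * \<phi> y0) \<le> A / 2 * exp (\<bar>Re \<kappa>\<bar> * y0) + exp (\<bar>Re \<kappa>\<bar> * y0) * B"
      using 1 norm_triangle_sub[of "p y0 + k * \<phi> y0" "exp (k * of_real y0) * (p 0 + k * \<phi> 0)"] by linarith
    then show ?thesis by (simp add: algebra_simps)
  qed
  have "max (norm (p y0 + \<kappa> * \<phi> y0)) (norm (p y0 - \<kappa> * \<phi> y0)) \<le> (B + A / 2) * exp (\<bar>Re \<kappa>\<bar> * y0)"
    using step[of \<kappa>] step[of "- \<kappa>"] by simp
  then have "exp (- \<bar>Re \<kappa>\<bar> * y0) * max (norm (p y0 + \<kappa> * \<phi> y0)) (norm (p y0 - \<kappa> * \<phi> y0))
      \<le> exp (- \<bar>Re \<kappa>\<bar> * y0) * ((B + A / 2) * exp (\<bar>Re \<kappa>\<bar> * y0))" by (intro mult_left_mono) auto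
  also have "\<dots> = B + A / 2" by (simp add: exp_minus field_simps)
  finally have A: "A \<le> 2 * B" by (simp add: A_def w_def)
  have AB: "A / norm \<kappa> \<le> 2 * B / norm \<kappa>" using A by (simp add: divide_right_mono)
  have 1: "norm (\<phi> y) \<le> 2 * B / norm \<kappa> * exp (\<bar>Re \<kappa>\<bar> * y)" if "y \<in> {0..b}" for y
    using ph[OF that] mult_right_mono[OF AB, of "exp (\<bar>Re \<kappa>\<bar> * y)"] by simp
  show "norm (\<phi> y) \<le> 2 * B / norm \<kappa> * exp (\<bar>Re \<kappa>\<bar> * y)" by (rule 1[OF y])
  show "norm (p y) \<le> 2 * B * exp (\<bar>Re \<kappa>\<bar> * y)"
    by (rule order_trans[OF pn[OF y] mult_right_mono[OF A]]) simp
  show "norm (p y + \<kappa> * \<phi> y - exp (\<kappa> * of_real y) * (p 0 + \<kappa> * \<phi> 0))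
       \<le> integral {0..b} (\<lambda>t. \<bar>V t\<bar>) * (2 * B / norm \<kappa>) * exp (\<bar>Re \<kappa>\<bar> * y)"
    by (rule variation_error_le[OF V S 1 _ y]) (use B0 in auto)
qed

lemma wronskian_constant:
  assumes S: "schroedinger_on V \<mu> b \<phi> p" "schroedinger_on V \<mu> b \<psi> r" and y: "y \<in> {0..b}"
  shows "\<phi> y * r y - p y * \<psi> y = \<phi> 0 * r 0 - p 0 * \<psi> 0"
proof -
  have 1: "primitive_on b (\<lambda>t. p t * r t + (of_real (V t) - \<mu>) * \<psi> t * \<phi> t) (\<lambda>t. \<phi> t * r t)"
    using S by (intro primitive_on_mult) (auto simp: schroedinger_on_def)
  have 2: "primitive_on b (\<lambda>t. (of_real (V t) - \<mu>) * \<phi> t * \<psi> t + r t * p t) (\<lambda>t. p t * \<psi> t)"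
    using S by (intro primitive_on_mult) (auto simp: schroedinger_on_def)
  have "primitive_on b (\<lambda>t. 0) (\<lambda>t. \<phi> t * r t - p t * \<psi> t)"
    by (rule primitive_on_cong[OF primitive_on_linear[OF 1 2, of 1 "-1"]]) (auto simp: algebra_simps)
  from primitive_onD(1)[OF this, of 0 y] y show ?thesis by simp
qed

lemma has_integral_flip:
  fixes f :: "real \<Rightarrow> 'a::euclidean_space"
  assumes "(f has_integral i) {u..v}"
  shows "((\<lambda>t. f (b - t)) has_integral i) {b - v..b - u}"
proof -
  have "((\<lambda>x. f ((-1) *\<^sub>R x + b)) has_integral (1 / (\<bar>-1\<bar> ^ DIM(real))) *\<^sub>R i) ((\<lambda>x. (1 / (-1)) *\<^sub>R x + - ((1 / (-1)) *\<^sub>R b)) ` cbox u v)"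
    by (rule has_integral_affinity) (use assms in auto)
  moreover have "(\<lambda>x. (1 / (-1)) *\<^sub>R x + - ((1 / (-1)) *\<^sub>R b)) ` cbox u v = {b - v..b - u}"
  proof -
    have "(\<lambda>x. (1 / (-1)) *\<^sub>R x + - ((1 / (-1)) *\<^sub>R b)) = (\<lambda>x. b - x)" by auto
    then show ?thesis by (auto simp: image_iff intro!: bexI[of _ "b - _"])
  qed
  ultimately show ?thesis by (simp add: algebra_simps)
qed

lemma absolutely_integrable_flip:
  fixes f :: "real \<Rightarrow> 'a::euclidean_space"
  assumes "f absolutely_integrable_on {u..v}"
  shows "(\<lambda>t. f (b - t)) absolutely_integrable_on {b - v..b - u}"
  using assms has_integral_flip[of f] has_integral_flip[of "\<lambda>t. norm (f t)"]
  unfolding absolutely_integrable_on_def integrable_on_def by meson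

lemma primitive_on_flip:
  assumes F: "primitive_on b f F"
  shows "primitive_on b (\<lambda>t. - f (b - t)) (\<lambda>t. F (b - t))"
  unfolding primitive_on_def
proof (intro conjI ballI)
  have "f absolutely_integrable_on {0..b}" using F by (simp add: primitive_on_def)
  from absolutely_integrable_flip[OF this, of b] show "(\<lambda>t. - f (b - t)) absolutely_integrable_on {0..b}"
    by (auto simp: absolutely_integrable_on_def dest: integrable_neg)
  fix y assume y: "y \<in> {0..b}"
  have "(f has_integral (F b - F (b - y))) {b - y..b}"
    using primitive_onD(1,2)[OF F, of "b - y" b] y by (metis diff_ge_0_iff_ge atLeastAtMost_iff cancel_comm_monoid_add_class.diff_cancel diff_le_eq integrable_integral le_add_same_cancel1 order_refl)
  from integral_unique[OF has_integral_neg[OF has_integral_flip[OF this, of b]]]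
  show "integral {0..y} (\<lambda>t. - f (b - t)) = F (b - y) - F (b - 0)" by simp
qed

lemma schroedinger_on_flip:
  assumes S: "schroedinger_on V \<mu> b \<phi> p" and U: "\<And>t. t \<in> {0..b} \<Longrightarrow> U t = V (b - t)"
  shows "schroedinger_on U \<mu> b (\<lambda>t. \<phi> (b - t)) (\<lambda>t. - p (b - t))"
  unfolding schroedinger_on_def
proof
  show "primitive_on b (\<lambda>t. - p (b - t)) (\<lambda>t. \<phi> (b - t))"
    using S by (intro primitive_on_flip) (auto simp: schroedinger_on_def)
  have "primitive_on b (\<lambda>t. - ((of_real (V (b - t)) - \<mu>) * \<phi> (b - t))) (\<lambda>t. p (b - t))"
    using S primitive_on_flip unfolding schroedinger_on_def by blast
  from primitive_on_cmult[OF this, of "-1"]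
  show "primitive_on b (\<lambda>t. (of_real (U t) - \<mu>) * \<phi> (b - t)) (\<lambda>t. - p (b - t))"
    by (rule primitive_on_cong) (auto simp: U)
qed

text \<open>
  Every \<open>\<mu>\<close> is \<open>- \<kappa>\<^sup>2\<close> for some \<open>\<kappa>\<close> in the closed right half plane, so decay there is decay in all
  directions of the \<open>\<mu>\<close>-plane, and Liouville's theorem applies.
\<close>

lemma entire_eq_zero_if_decays:
  assumes f: "f holomorphic_on UNIV"
    and dec: "\<And>\<kappa>. Re \<kappa> \<ge> 0 \<Longrightarrow> norm \<kappa> \<ge> K \<Longrightarrow> norm (f (- (\<kappa>\<^sup>2))) \<le> C / norm \<kappa>"
  shows "f \<mu> = 0"
proof (rule Liouville_weak_0[OF f])
  show "(f \<longlongrightarrow> 0) at_infinity"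
    unfolding Lim_at_infinity
  proof (intro allI impI)
    fix e :: real assume e: "e > 0"
    define B where "B = \<bar>K\<bar> + \<bar>C\<bar> / e + 1"
    have B: "B > 0" using e by (auto simp: B_def intro!: add_nonneg_pos)
    show "\<exists>b. \<forall>x. b \<le> norm x \<longrightarrow> dist (f x) 0 < e"
    proof (intro exI[of _ "B\<^sup>2"] allI impI)
      fix x :: complex assume x: "B\<^sup>2 \<le> norm x"
      define \<kappa> where "\<kappa> = csqrt (- x)"
      have k2: "\<kappa>\<^sup>2 = - x" by (simp add: \<kappa>_def)
      have "(norm \<kappa>)\<^sup>2 = norm x" by (metis k2 norm_minus_cancel norm_power)
      then have nk: "norm \<kappa> \<ge> B" using x B by (metis power2_le_imp_le norm_ge_zero)
      have "Re \<kappa> \<ge> 0" unfolding \<kappa>_def using Re_csqrt by blast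
      moreover have "K \<le> norm \<kappa>" using nk divide_nonneg_pos[of "\<bar>C\<bar>" e] e abs_ge_self[of K] abs_ge_zero[of C] unfolding B_def by linarith
      ultimately have "norm (f x) \<le> C / norm \<kappa>" using dec[of \<kappa>] k2 by simp
      also have "\<dots> \<le> \<bar>C\<bar> / norm \<kappa>" by (simp add: divide_right_mono)
      also have "\<dots> < e"
      proof -
        have "\<bar>C\<bar> / e < norm \<kappa>" using nk abs_ge_zero[of K] unfolding B_def by linarith
        then have "\<bar>C\<bar> < norm \<kappa> * e" by (simp only: pos_divide_less_eq[OF e])
        moreover have "norm \<kappa> > 0" using nk B by linarith
        ultimately show ?thesis by (simp add: pos_divide_less_eq mult.commute)
      qed
      finally show "dist (f x) 0 < e" by simp
    qed
  qed
qed

text \<open>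
  Differentiate \<open>\<psi>1 \<eta>2 = \<psi>2 \<eta>1\<close> and eliminate the derivatives by means of the Wronskians
  \<open>\<psi> \<eta>' - \<psi>' \<eta> = - 1\<close>: this leaves \<open>\<eta>1\<^sup>2 = \<eta>2\<^sup>2\<close> and \<open>\<psi>1\<^sup>2 = \<psi>2\<^sup>2\<close>. The two vectors
  \<open>(\<psi>, \<eta>)\<close> never vanish and agree up to sign at every point. The sets where the sign is plus and
  minus are closed and disjoint, so by connectedness the sign is the one at \<open>0\<close>.
\<close>

lemma proportional_solutions_agree:
  assumes a: "a > 0"
    and S1: "schroedinger_on V1 \<mu> a \<psi>1 r1" "schroedinger_on V1 \<mu> a \<eta>1 s1"
    and S2: "schroedinger_on V2 \<mu> a \<psi>2 r2" "schroedinger_on V2 \<mu> a \<eta>2 s2"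
    and ini: "\<psi>1 0 = 0" "r1 0 = 1" "\<eta>1 0 = 1" "s1 0 = 0" "\<psi>2 0 = 0" "r2 0 = 1" "\<eta>2 0 = 1" "s2 0 = 0"
    and quot: "\<And>y. y \<in> {0..a} \<Longrightarrow> \<psi>1 y * \<eta>2 y = \<psi>2 y * \<eta>1 y"
  obtains N where "negligible N" "\<And>y. y \<in> {0<..<a} - N \<Longrightarrow> V1 y = V2 y"
proof -
  have w1: "\<psi>1 y * s1 y - r1 y * \<eta>1 y = -1" and w2: "\<psi>2 y * s2 y - r2 y * \<eta>2 y = -1" if "y \<in> {0..a}" for y
    using wronskian_constant[OF S1 that] wronskian_constant[OF S2 that] ini by auto
  have d: "(\<psi>1 has_vector_derivative r1 y) (at y within {0..a})" "(\<eta>1 has_vector_derivative s1 y) (at y within {0..a})"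
    "(\<psi>2 has_vector_derivative r2 y) (at y within {0..a})" "(\<eta>2 has_vector_derivative s2 y) (at y within {0..a})"
    if "y \<in> {0..a}" for y
    using S1 S2 schroedinger_on_continuous[OF S1(1)] schroedinger_on_continuous[OF S1(2)]
      schroedinger_on_continuous[OF S2(1)] schroedinger_on_continuous[OF S2(2)] that
    by (auto intro!: primitive_on_has_vector_derivative simp: schroedinger_on_def)
  have unq: "f' = g'" if "(f has_vector_derivative f') (at y within {0..a})" "(g has_vector_derivative g') (at y within {0..a})"
    "\<And>t. t \<in> {0..a} \<Longrightarrow> f t = g t" "y \<in> {0..a}" for f g :: "real \<Rightarrow> complex" and f' g' y
  proof -
    have "(f has_vector_derivative g') (at y within {0..a})"
      using has_vector_derivative_transform[OF that(4) that(3) that(2)] by simp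
    then show ?thesis using vector_derivative_unique_within_closed_interval[of 0 a y f f' g'] a that by auto
  qed
  have sq: "\<eta>1 y * \<eta>1 y = \<eta>2 y * \<eta>2 y" "\<psi>1 y * \<psi>1 y = \<psi>2 y * \<psi>2 y" if y: "y \<in> {0..a}" for y
  proof -
    have e: "\<psi>1 y * s2 y + r1 y * \<eta>2 y = \<psi>2 y * s1 y + r2 y * \<eta>1 y"
      by (rule unq[OF has_vector_derivative_mult[OF d(1)[OF y] d(4)[OF y]] has_vector_derivative_mult[OF d(3)[OF y] d(2)[OF y]] quot y])
    have p: "\<psi>1 y * \<eta>2 y = \<psi>2 y * \<eta>1 y" by (rule quot[OF y])
    have r1: "r1 y * \<eta>1 y = \<psi>1 y * s1 y + 1" and r2: "r2 y * \<eta>2 y = \<psi>2 y * s2 y + 1"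
      using w1[OF y] w2[OF y] by (auto simp: algebra_simps)
    show "\<eta>1 y * \<eta>1 y = \<eta>2 y * \<eta>2 y" using e p r1 r2 by algebra
    show "\<psi>1 y * \<psi>1 y = \<psi>2 y * \<psi>2 y" using e p r1 r2 by algebra
  qed
  define P where "P = {y\<in>{0..a}. \<psi>1 y - \<psi>2 y = 0} \<inter> {y\<in>{0..a}. \<eta>1 y - \<eta>2 y = 0}"
  define Q where "Q = {y\<in>{0..a}. \<psi>1 y + \<psi>2 y = 0} \<inter> {y\<in>{0..a}. \<eta>1 y + \<eta>2 y = 0}"
  have cont: "continuous_on {0..a} \<psi>1" "continuous_on {0..a} \<psi>2" "continuous_on {0..a} \<eta>1" "continuous_on {0..a} \<eta>2"
    using S1 S2 schroedinger_on_continuous by blast+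
  have "closed P" "closed Q" unfolding P_def Q_def
    by (intro closed_Int continuous_closed_preimage_constant continuous_intros cont closed_atLeastAtMost)+
  moreover have "P \<inter> Q \<inter> {0..a} = {}"
  proof -
    have False if "y \<in> P" "y \<in> Q" for y
    proof -
      have "\<psi>1 y = 0" "\<eta>1 y = 0" "y \<in> {0..a}" using that by (auto simp: P_def Q_def)
      then show False using w1[of y] by simp
    qed
    then show ?thesis by blast
  qed
  moreover have "{0..a} \<subseteq> P \<union> Q"
  proof
    fix y assume y: "y \<in> {0..a}"
    have "\<eta>1 y = \<eta>2 y \<or> \<eta>1 y = - \<eta>2 y" "\<psi>1 y = \<psi>2 y \<or> \<psi>1 y = - \<psi>2 y"
      using sq[OF y] by (auto simp: square_eq_iff)
    moreover have "\<psi>1 y = \<psi>2 y" if "\<eta>1 y = \<eta>2 y" "\<eta>2 y \<noteq> 0" using quot[OF y] that by simp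
    moreover have "\<psi>1 y = - \<psi>2 y" if "\<eta>1 y = - \<eta>2 y" "\<eta>2 y \<noteq> 0"
    proof -
      have "(\<psi>1 y + \<psi>2 y) * \<eta>2 y = 0" using quot[OF y] that by (simp add: algebra_simps)
      then show ?thesis using that(2) by (simp add: add_eq_0_iff2)
    qed
    ultimately show "y \<in> P \<union> Q" using y unfolding P_def Q_def by (cases "\<eta>2 y = 0") auto
  qed
  ultimately have "P \<inter> {0..a} = {} \<or> Q \<inter> {0..a} = {}"
    by (intro connected_closedD[OF connected_Icc]) auto
  moreover have "0 \<in> P" using ini a by (simp add: P_def)
  ultimately have "{0..a} \<subseteq> P" using \<open>{0..a} \<subseteq> P \<union> Q\<close> a by fastforce
  then have eq: "\<psi>1 y = \<psi>2 y" "\<eta>1 y = \<eta>2 y" if "y \<in> {0..a}" for y using that by (auto simp: P_def)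
  have deq: "r1 y = r2 y" "s1 y = s2 y" if y: "y \<in> {0..a}" for y
    using unq[OF d(1)[OF y] d(3)[OF y] eq(1) y] unq[OF d(2)[OF y] d(4)[OF y] eq(2) y] by auto
  obtain N1 where N1: "negligible N1" "\<And>x. x \<in> {0<..<a} - N1 \<Longrightarrow> (of_real (V1 x) - \<mu>) * \<psi>1 x = (of_real (V2 x) - \<mu>) * \<psi>2 x"
    using primitive_on_unique_ae[of a "\<lambda>t. (of_real (V1 t) - \<mu>) * \<psi>1 t" r1 "\<lambda>t. (of_real (V2 t) - \<mu>) * \<psi>2 t" r2]
      S1 S2 deq unfolding schroedinger_on_def by blast
  obtain N2 where N2: "negligible N2" "\<And>x. x \<in> {0<..<a} - N2 \<Longrightarrow> (of_real (V1 x) - \<mu>) * \<eta>1 x = (of_real (V2 x) - \<mu>) * \<eta>2 x"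
    using primitive_on_unique_ae[of a "\<lambda>t. (of_real (V1 t) - \<mu>) * \<eta>1 t" s1 "\<lambda>t. (of_real (V2 t) - \<mu>) * \<eta>2 t" s2]
      S1 S2 deq unfolding schroedinger_on_def by blast
  have "V1 x = V2 x" if x: "x \<in> {0<..<a} - (N1 \<union> N2)" for x
  proof -
    have x': "x \<in> {0..a}" using x by auto
    have "\<psi>1 x \<noteq> 0 \<or> \<eta>1 x \<noteq> 0" using w1[OF x'] by auto
    moreover have "(of_real (V1 x) - \<mu>) * \<psi>1 x = (of_real (V2 x) - \<mu>) * \<psi>1 x" "(of_real (V1 x) - \<mu>) * \<eta>1 x = (of_real (V2 x) - \<mu>) * \<eta>1 x"
      using N1(2)[of x] N2(2)[of x] eq[OF x'] x by auto
    ultimately have "complex_of_real (V1 x) = of_real (V2 x)" by auto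
    then show ?thesis by simp
  qed
  moreover have "negligible (N1 \<union> N2)" using N1 N2 by auto
  ultimately show thesis using that by blast
qed

section \<open>The potential is determined by the characteristic function\<close>

text \<open>
  The function \<open>D\<close> in the variable \<open>\<mu> = k\<^sup>2\<close>: at \<open>a\<close> the free regular solution is \<open>sin (k a) / k\<close>
  and its derivative is \<open>cos (k a)\<close>.
\<close>

definition D_hat :: "real \<Rightarrow> (real \<Rightarrow> real) \<Rightarrow> complex \<Rightarrow> complex" where
  "D_hat a V \<mu> = schr_sol (\<lambda>_. 0) 0 1 \<mu> a * schr_deriv V 0 1 \<mu> a - schr_deriv (\<lambda>_. 0) 0 1 \<mu> a * schr_sol V 0 1 \<mu> a"

lemma absolutely_integrable_zero_potential: "(\<lambda>_. 0 :: real) absolutely_integrable_on {0..b::real}"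
  by simp

lemma free_exp:
  assumes a: "a \<ge> 0"
  shows "schr_deriv (\<lambda>_. 0) 0 1 (- (\<kappa>\<^sup>2)) a + \<kappa> * schr_sol (\<lambda>_. 0) 0 1 (- (\<kappa>\<^sup>2)) a = exp (\<kappa> * of_real a)"
proof -
  note S = schroedinger_on_schr_sol[OF absolutely_integrable_zero_potential, of "- (\<kappa>\<^sup>2)" a 0 1]
  have "exp (- \<kappa> * of_real a) * (schr_deriv (\<lambda>_. 0) 0 1 (- (\<kappa>\<^sup>2)) a + \<kappa> * schr_sol (\<lambda>_. 0) 0 1 (- (\<kappa>\<^sup>2)) a) = 1"
    using exp_variation_of_constants[OF S, of a] a by (simp add: schr_initial)
  then have "exp (\<kappa> * of_real a) * (exp (- \<kappa> * of_real a) * (schr_deriv (\<lambda>_. 0) 0 1 (- (\<kappa>\<^sup>2)) a + \<kappa> * schr_sol (\<lambda>_. 0) 0 1 (- (\<kappa>\<^sup>2)) a)) = exp (\<kappa> * of_real a)"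
    by simp
  moreover have "exp (\<kappa> * of_real a) * (exp (- \<kappa> * of_real a) * x) = x" for x
    by (simp add: exp_minus field_simps)
  ultimately show ?thesis by metis
qed

lemma free_pythagoras:
  assumes a: "a \<ge> 0"
  shows "(schr_deriv (\<lambda>_. 0) 0 1 \<mu> a)\<^sup>2 + \<mu> * (schr_sol (\<lambda>_. 0) 0 1 \<mu> a)\<^sup>2 = 1"
proof -
  define \<kappa> where "\<kappa> = csqrt (- \<mu>)"
  have k: "- (\<kappa>\<^sup>2) = \<mu>" by (simp add: \<kappa>_def)
  let ?C = "schr_deriv (\<lambda>_. 0) 0 1 \<mu> a" and ?S = "schr_sol (\<lambda>_. 0) 0 1 \<mu> a"
  have "(?C + \<kappa> * ?S) * (?C + (- \<kappa>) * ?S) = exp (\<kappa> * of_real a) * exp ((- \<kappa>) * of_real a)"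
    using free_exp[OF a, of \<kappa>] free_exp[OF a, of "- \<kappa>"] k by simp
  also have "\<dots> = 1" by (simp flip: exp_add)
  finally have "?C\<^sup>2 + (- (\<kappa>\<^sup>2)) * ?S\<^sup>2 = 1" by (simp add: algebra_simps power2_eq_square)
  then show ?thesis by (simp add: k)
qed

lemma regular_solution_asymptotics:
  assumes V: "\<And>b. V absolutely_integrable_on {0..b}" and a: "a \<ge> 0"
    and \<kappa>: "\<kappa> \<noteq> 0" "2 * integral {0..a} (\<lambda>t. \<bar>V t\<bar>) \<le> norm \<kappa>" and y: "y \<in> {0..a}"
  shows "norm (schr_sol V 0 1 (- (\<kappa>\<^sup>2)) y) \<le> 2 / norm \<kappa> * exp (\<bar>Re \<kappa>\<bar> * y)"
    and "norm (schr_deriv V 0 1 (- (\<kappa>\<^sup>2)) y) \<le> 2 * exp (\<bar>Re \<kappa>\<bar> * y)"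
    and "norm (schr_deriv V 0 1 (- (\<kappa>\<^sup>2)) y + \<kappa> * schr_sol V 0 1 (- (\<kappa>\<^sup>2)) y - exp (\<kappa> * of_real y))
       \<le> 2 * integral {0..a} (\<lambda>t. \<bar>V t\<bar>) / norm \<kappa> * exp (\<bar>Re \<kappa>\<bar> * y)"
proof -
  note S = schroedinger_on_schr_sol[OF V, of "- (\<kappa>\<^sup>2)" a 0 1]
  note i = schr_initial[OF V, of 0 1]
  note b = schroedinger_on_bounds[OF V S \<kappa> _ _ y, of 1, unfolded i, simplified]
  show "norm (schr_sol V 0 1 (- (\<kappa>\<^sup>2)) y) \<le> 2 / norm \<kappa> * exp (\<bar>Re \<kappa>\<bar> * y)"
    "norm (schr_deriv V 0 1 (- (\<kappa>\<^sup>2)) y) \<le> 2 * exp (\<bar>Re \<kappa>\<bar> * y)"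
    "norm (schr_deriv V 0 1 (- (\<kappa>\<^sup>2)) y + \<kappa> * schr_sol V 0 1 (- (\<kappa>\<^sup>2)) y - exp (\<kappa> * of_real y))
       \<le> 2 * integral {0..a} (\<lambda>t. \<bar>V t\<bar>) / norm \<kappa> * exp (\<bar>Re \<kappa>\<bar> * y)"
    using b by (simp_all add: mult_ac)
qed

text \<open>
  With \<open>S\<close> and \<open>C\<close> the free solution and its derivative at \<open>a\<close>, equality of the functions \<open>D_hat\<close>
  says \<open>S P = C A\<close>. Then \<open>R = C P + \<mu> S A\<close>, an entire function of \<open>\<mu>\<close>, equals
  \<open>(C - \<kappa> S) (P + \<kappa> A) = exp (- \<kappa> a) (P + \<kappa> A)\<close>, which tends to \<open>0\<close> at infinity. Finally
  \<open>S P - C A = 0\<close> and \<open>C P + \<mu> S A = 0\<close> is a linear system for \<open>P\<close> and \<open>A\<close> with determinant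
  \<open>C\<^sup>2 + \<mu> S\<^sup>2 = 1\<close>.
\<close>

lemma boundary_values_from_D_hat:
  assumes V1: "\<And>b. V1 absolutely_integrable_on {0..b}" and V2: "\<And>b. V2 absolutely_integrable_on {0..b}" and a: "a > 0"
    and D: "\<And>\<mu>. D_hat a V1 \<mu> = D_hat a V2 \<mu>"
  shows "schr_sol V1 0 1 \<mu> a = schr_sol V2 0 1 \<mu> a" "schr_deriv V1 0 1 \<mu> a = schr_deriv V2 0 1 \<mu> a"
proof -
  define A where "A = (\<lambda>\<mu>. schr_sol V1 0 1 \<mu> a - schr_sol V2 0 1 \<mu> a)"
  define P where "P = (\<lambda>\<mu>. schr_deriv V1 0 1 \<mu> a - schr_deriv V2 0 1 \<mu> a)"
  define S where "S = (\<lambda>\<mu>. schr_sol (\<lambda>_. 0) 0 1 \<mu> a)"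
  define C where "C = (\<lambda>\<mu>. schr_deriv (\<lambda>_. 0) 0 1 \<mu> a)"
  have SP: "S \<mu> * P \<mu> = C \<mu> * A \<mu>" for \<mu>
    using D[of \<mu>] by (simp add: D_hat_def S_def C_def A_def P_def algebra_simps)
  define R where "R = (\<lambda>\<mu>. C \<mu> * P \<mu> + \<mu> * S \<mu> * A \<mu>)"
  have holR: "R holomorphic_on UNIV" unfolding R_def A_def P_def S_def C_def
    using a by (intro holomorphic_intros schr_holomorphic V1 V2 absolutely_integrable_zero_potential) auto
  \<comment> \<open>here the equality of the functions \<open>D_hat\<close> enters, through \<open>SP\<close>\<close>
  have fac: "R (- (\<kappa>\<^sup>2)) = exp (- \<kappa> * of_real a) * (P (- (\<kappa>\<^sup>2)) + \<kappa> * A (- (\<kappa>\<^sup>2)))" for \<kappa>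
  proof -
    have "exp (- \<kappa> * of_real a) = C (- (\<kappa>\<^sup>2)) - \<kappa> * S (- (\<kappa>\<^sup>2))"
      using free_exp[of a "- \<kappa>"] a by (simp add: C_def S_def)
    then show ?thesis using SP[of "- (\<kappa>\<^sup>2)"] unfolding R_def by algebra
  qed
  define W where "W = integral {0..a} (\<lambda>t. \<bar>V1 t\<bar>) + integral {0..a} (\<lambda>t. \<bar>V2 t\<bar>)"
  have W0: "integral {0..a} (\<lambda>t. \<bar>V1 t\<bar>) \<ge> 0" "integral {0..a} (\<lambda>t. \<bar>V2 t\<bar>) \<ge> 0"
    by (intro integral_abs_nonneg V1 V2)+
  have R0: "R \<mu> = 0" for \<mu>
  proof (rule entire_eq_zero_if_decays[OF holR, of "2 * W + 1" "2 * W"])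
    fix \<kappa> :: complex assume k: "Re \<kappa> \<ge> 0" "2 * W + 1 \<le> norm \<kappa>"
    have k0: "\<kappa> \<noteq> 0" using k W0 by (auto simp: W_def)
    have b1: "norm (schr_deriv V1 0 1 (- (\<kappa>\<^sup>2)) a + \<kappa> * schr_sol V1 0 1 (- (\<kappa>\<^sup>2)) a - exp (\<kappa> * of_real a))
       \<le> 2 * integral {0..a} (\<lambda>t. \<bar>V1 t\<bar>) / norm \<kappa> * exp (\<bar>Re \<kappa>\<bar> * a)"
      by (rule regular_solution_asymptotics(3)[OF V1]) (use a k k0 W0 in \<open>auto simp: W_def\<close>)
    have b2: "norm (schr_deriv V2 0 1 (- (\<kappa>\<^sup>2)) a + \<kappa> * schr_sol V2 0 1 (- (\<kappa>\<^sup>2)) a - exp (\<kappa> * of_real a))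
       \<le> 2 * integral {0..a} (\<lambda>t. \<bar>V2 t\<bar>) / norm \<kappa> * exp (\<bar>Re \<kappa>\<bar> * a)"
      by (rule regular_solution_asymptotics(3)[OF V2]) (use a k k0 W0 in \<open>auto simp: W_def\<close>)
    have "P (- (\<kappa>\<^sup>2)) + \<kappa> * A (- (\<kappa>\<^sup>2)) =
       (schr_deriv V1 0 1 (- (\<kappa>\<^sup>2)) a + \<kappa> * schr_sol V1 0 1 (- (\<kappa>\<^sup>2)) a - exp (\<kappa> * of_real a))
     - (schr_deriv V2 0 1 (- (\<kappa>\<^sup>2)) a + \<kappa> * schr_sol V2 0 1 (- (\<kappa>\<^sup>2)) a - exp (\<kappa> * of_real a))"
      by (simp add: P_def A_def algebra_simps)
    then have "norm (P (- (\<kappa>\<^sup>2)) + \<kappa> * A (- (\<kappa>\<^sup>2)))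
      \<le> 2 * integral {0..a} (\<lambda>t. \<bar>V1 t\<bar>) / norm \<kappa> * exp (\<bar>Re \<kappa>\<bar> * a) + 2 * integral {0..a} (\<lambda>t. \<bar>V2 t\<bar>) / norm \<kappa> * exp (\<bar>Re \<kappa>\<bar> * a)"
      using norm_triangle_le_diff[OF add_mono[OF b1 b2]] by simp
    also have "\<dots> = 2 * W / norm \<kappa> * exp (Re \<kappa> * a)" using k by (simp add: W_def add_divide_distrib algebra_simps)
    finally have PA: "norm (P (- (\<kappa>\<^sup>2)) + \<kappa> * A (- (\<kappa>\<^sup>2))) \<le> 2 * W / norm \<kappa> * exp (Re \<kappa> * a)" .
    have "norm (R (- (\<kappa>\<^sup>2))) = exp (- (Re \<kappa> * a)) * norm (P (- (\<kappa>\<^sup>2)) + \<kappa> * A (- (\<kappa>\<^sup>2)))"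
      unfolding fac norm_mult by (simp add: norm_exp_eq_Re)
    also have "\<dots> \<le> exp (- (Re \<kappa> * a)) * (2 * W / norm \<kappa> * exp (Re \<kappa> * a))"
      by (rule mult_left_mono[OF PA]) simp
    also have "\<dots> = 2 * W / norm \<kappa>" by (simp add: exp_minus field_simps)
    finally show "norm (R (- (\<kappa>\<^sup>2))) \<le> 2 * W / norm \<kappa>" .
  qed
  have PA: "P \<mu> = 0 \<and> A \<mu> = 0" for \<mu>
  proof -
    have 1: "C \<mu> * P \<mu> + \<mu> * S \<mu> * A \<mu> = 0" using R0[of \<mu>] by (simp add: R_def)
    have 2: "(C \<mu>)\<^sup>2 + \<mu> * (S \<mu>)\<^sup>2 = 1" unfolding C_def S_def using a by (intro free_pythagoras) auto
    show ?thesis using 1 2 SP[of \<mu>] by algebra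
  qed
  show "schr_sol V1 0 1 \<mu> a = schr_sol V2 0 1 \<mu> a" "schr_deriv V1 0 1 \<mu> a = schr_deriv V2 0 1 \<mu> a"
    using PA[of \<mu>] by (auto simp: P_def A_def)
qed

text \<open>
  Solutions with Cauchy data at the right end are solutions with data at \<open>0\<close> for the reflected
  potential. Cutting it off outside \<open>[0, a]\<close> keeps it integrable on all bounded intervals.
\<close>

definition reflected :: "real \<Rightarrow> (real \<Rightarrow> real) \<Rightarrow> real \<Rightarrow> real" where
  "reflected a V t = (if t \<in> {0..a} then V (a - t) else 0)"

lemma reflected_absolutely_integrable:
  assumes V: "V absolutely_integrable_on {0..a}"
  shows "reflected a V absolutely_integrable_on {0..b}"
proof -
  have "(\<lambda>t. V (a - t)) absolutely_integrable_on {0..a}" using absolutely_integrable_flip[OF V, of a] by simp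
  then have "reflected a V absolutely_integrable_on UNIV"
    unfolding reflected_def[abs_def] by (subst absolutely_integrable_restrict_UNIV)
  then show ?thesis by (rule absolutely_integrable_on_subinterval) simp
qed

lemma integral_abs_reflected:
  assumes V: "V absolutely_integrable_on {0..a}"
  shows "integral {0..a} (\<lambda>t. \<bar>reflected a V t\<bar>) = integral {0..a} (\<lambda>t. \<bar>V t\<bar>)"
proof -
  have "(\<lambda>t. \<bar>V t\<bar>) integrable_on {0..a}" using V by (simp add: absolutely_integrable_on_def)
  from integral_unique[OF has_integral_flip[OF integrable_integral[OF this], of a]]
  have "integral {0..a} (\<lambda>t. \<bar>V (a - t)\<bar>) = integral {0..a} (\<lambda>t. \<bar>V t\<bar>)" by simp
  moreover have "integral {0..a} (\<lambda>t. \<bar>reflected a V t\<bar>) = integral {0..a} (\<lambda>t. \<bar>V (a - t)\<bar>)"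
    by (rule integral_cong) (simp add: reflected_def)
  ultimately show ?thesis by simp
qed

text \<open>
  Seen from the right end, both sides solve the reflected equation with the same Cauchy data; the
  derivative at \<open>a\<close> changes its sign under the reflection.
\<close>

lemma regular_solution_from_right:
  assumes V: "\<And>b. V absolutely_integrable_on {0..b}" and y: "y \<in> {0..a}"
  shows "schr_sol V 0 1 \<mu> y = schr_sol V 0 1 \<mu> a * schr_sol (reflected a V) 1 0 \<mu> (a - y)
       - schr_deriv V 0 1 \<mu> a * schr_sol (reflected a V) 0 1 \<mu> (a - y)"
proof -
  let ?U = "reflected a V"
  have U: "?U absolutely_integrable_on {0..b}" for b by (rule reflected_absolutely_integrable[OF V])
  have f: "schroedinger_on ?U \<mu> a (\<lambda>t. schr_sol V 0 1 \<mu> (a - t)) (\<lambda>t. - schr_deriv V 0 1 \<mu> (a - t))"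
    by (rule schroedinger_on_flip[OF schroedinger_on_schr_sol[OF V]]) (simp add: reflected_def)
  note l = schroedinger_on_linear[OF schroedinger_on_schr_sol[OF U, of \<mu> a 1 0] schroedinger_on_schr_sol[OF U, of \<mu> a 0 1],
      of "schr_sol V 0 1 \<mu> a" "- schr_deriv V 0 1 \<mu> a"]
  have "schr_sol V 0 1 \<mu> (a - (a - y)) = schr_sol V 0 1 \<mu> a * schr_sol ?U 1 0 \<mu> (a - y) + - schr_deriv V 0 1 \<mu> a * schr_sol ?U 0 1 \<mu> (a - y)"
    by (rule schroedinger_on_unique(1)[OF U f l]) (use y schr_initial[OF U] in auto)
  then show ?thesis by simp
qed

text \<open>
  The decisive identity is
  \<open>(P + \<kappa> A) E = \<phi>\<^sub>2 (\<eta>\<^sub>1 + \<kappa> \<psi>\<^sub>1) - \<phi>\<^sub>1 (\<eta>\<^sub>2 + \<kappa> \<psi>\<^sub>2)\<close> with the common boundary values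
  \<open>A = \<phi>(a)\<close> and \<open>P = \<phi>'(a)\<close>. For \<open>Re \<kappa> \<ge> 0\<close> the regular solutions at \<open>y\<close> are
  \<open>O(exp (\<kappa> y) / \<kappa>)\<close> and the other factors are \<open>O(exp (\<kappa> (a - y)))\<close>, while \<open>P + \<kappa> A\<close> is at least
  half as large as \<open>exp (\<kappa> a)\<close>. Hence \<open>E = O(1/\<kappa>)\<close>.
\<close>

lemma potential_from_boundary_values:
  assumes V1: "\<And>b. V1 absolutely_integrable_on {0..b}" and V2: "\<And>b. V2 absolutely_integrable_on {0..b}" and a: "a > 0"
    and eq: "\<And>\<mu>. schr_sol V1 0 1 \<mu> a = schr_sol V2 0 1 \<mu> a" "\<And>\<mu>. schr_deriv V1 0 1 \<mu> a = schr_deriv V2 0 1 \<mu> a"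
  obtains N where "negligible N" "\<And>y. y \<in> {0<..<a} - N \<Longrightarrow> V1 y = V2 y"
proof -
  define U1 where "U1 = reflected a V1"
  define U2 where "U2 = reflected a V2"
  have U1: "U1 absolutely_integrable_on {0..b}" and U2: "U2 absolutely_integrable_on {0..b}" for b
    unfolding U1_def U2_def by (rule reflected_absolutely_integrable[OF V1], rule reflected_absolutely_integrable[OF V2])
  define W1 where "W1 = integral {0..a} (\<lambda>t. \<bar>V1 t\<bar>)"
  define W2 where "W2 = integral {0..a} (\<lambda>t. \<bar>V2 t\<bar>)"
  have W0: "W1 \<ge> 0" "W2 \<ge> 0" unfolding W1_def W2_def
    by (intro integral_abs_nonneg V1 V2)+
  have WU: "integral {0..a} (\<lambda>t. \<bar>U1 t\<bar>) = W1" "integral {0..a} (\<lambda>t. \<bar>U2 t\<bar>) = W2"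
    unfolding U1_def U2_def W1_def W2_def using integral_abs_reflected V1 V2 by auto
  have quot: "schr_sol U1 0 1 \<mu> s * schr_sol U2 1 0 \<mu> s - schr_sol U2 0 1 \<mu> s * schr_sol U1 1 0 \<mu> s = 0" if s: "s \<in> {0..a}" for \<mu> s
  proof -
    define E where "E = (\<lambda>\<mu>. schr_sol U1 0 1 \<mu> s * schr_sol U2 1 0 \<mu> s - schr_sol U2 0 1 \<mu> s * schr_sol U1 1 0 \<mu> s)"
    have holE: "E holomorphic_on UNIV" unfolding E_def
      using s by (intro holomorphic_intros schr_holomorphic U1 U2) auto
    define K where "K = 4 * W1 + 4 * W2 + 1"
    have "E \<mu> = 0"
    proof (rule entire_eq_zero_if_decays[OF holE, of K 32])
      fix \<kappa> :: complex assume k: "Re \<kappa> \<ge> 0" "K \<le> norm \<kappa>"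
      have k0: "\<kappa> \<noteq> 0" using k W0 by (auto simp: K_def)
      have kW: "2 * W1 \<le> norm \<kappa>" "2 * W2 \<le> norm \<kappa>" "4 * W1 \<le> norm \<kappa>" using k W0 by (auto simp: K_def)
      define m where "m = - (\<kappa>\<^sup>2)"
      \<comment> \<open>\<open>s\<close> is the distance from the right end, at which the solutions for \<open>U1\<close> and \<open>U2\<close> start\<close>
      define y where "y = a - s"
      have y: "y \<in> {0..a}" "s = a - y" using s by (auto simp: y_def)
      define A where "A = schr_sol V1 0 1 m a"
      define P where "P = schr_deriv V1 0 1 m a"
      define Z1 where "Z1 = schr_sol U1 1 0 m s + \<kappa> * schr_sol U1 0 1 m s"
      define Z2 where "Z2 = schr_sol U2 1 0 m s + \<kappa> * schr_sol U2 0 1 m s"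
      have f1: "schr_sol V1 0 1 m y = A * schr_sol U1 1 0 m s - P * schr_sol U1 0 1 m s"
        using regular_solution_from_right[OF V1 y(1), of m] y by (simp add: A_def P_def U1_def)
      have f2: "schr_sol V2 0 1 m y = A * schr_sol U2 1 0 m s - P * schr_sol U2 0 1 m s"
        using regular_solution_from_right[OF V2 y(1), of m] y eq by (simp add: A_def P_def U2_def)
      have id: "(P + \<kappa> * A) * E m = schr_sol V2 0 1 m y * Z1 - schr_sol V1 0 1 m y * Z2"
        unfolding f1 f2 Z1_def Z2_def E_def by (simp add: algebra_simps)
      have Zb: "norm (schr_sol U 1 0 m s + \<kappa> * schr_sol U 0 1 m s) \<le> 4 * exp (Re \<kappa> * s)"
        if U: "\<And>b. U absolutely_integrable_on {0..b}" and kU: "2 * integral {0..a} (\<lambda>t. \<bar>U t\<bar>) \<le> norm \<kappa>" for U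
      proof -
        note l = schroedinger_on_linear[OF schroedinger_on_schr_sol[OF U, of m a 1 0] schroedinger_on_schr_sol[OF U, of m a 0 1], of 1 \<kappa>]
        have "norm (1 * schr_sol U 1 0 m s + \<kappa> * schr_sol U 0 1 m s) \<le> 2 * (2 * norm \<kappa>) / norm \<kappa> * exp (\<bar>Re \<kappa>\<bar> * s)"
          by (rule schroedinger_on_bounds(1)[OF U l[unfolded m_def] k0 kU _ _ s, folded m_def])
             (simp_all add: schr_initial[OF U] norm_mult)
        then show ?thesis using k k0 by simp
      qed
      have Z: "norm Z1 \<le> 4 * exp (Re \<kappa> * s)" "norm Z2 \<le> 4 * exp (Re \<kappa> * s)"
        unfolding Z1_def Z2_def using Zb[OF U1] Zb[OF U2] kW WU by auto
      have F: "norm (schr_sol V1 0 1 m y) \<le> 2 / norm \<kappa> * exp (Re \<kappa> * y)" "norm (schr_sol V2 0 1 m y) \<le> 2 / norm \<kappa> * exp (Re \<kappa> * y)"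
        using regular_solution_asymptotics(1)[OF V1 _ k0 _ y(1)] regular_solution_asymptotics(1)[OF V2 _ k0 _ y(1)] kW a k
        by (auto simp: W1_def W2_def m_def)
      have "norm ((P + \<kappa> * A) * E m) \<le> norm (schr_sol V2 0 1 m y) * norm Z1 + norm (schr_sol V1 0 1 m y) * norm Z2"
        unfolding id by (metis norm_mult norm_triangle_ineq4)
      also have "\<dots> \<le> (2 / norm \<kappa> * exp (Re \<kappa> * y)) * (4 * exp (Re \<kappa> * s)) + (2 / norm \<kappa> * exp (Re \<kappa> * y)) * (4 * exp (Re \<kappa> * s))"
        by (intro add_mono mult_mono F Z) auto
      also have "\<dots> = 16 / norm \<kappa> * (exp (Re \<kappa> * y) * exp (Re \<kappa> * s))" by (simp add: field_simps)
      also have "exp (Re \<kappa> * y) * exp (Re \<kappa> * s) = exp (Re \<kappa> * a)" by (simp add: y_def algebra_simps flip: exp_add)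
      finally have up: "norm (P + \<kappa> * A) * norm (E m) \<le> 16 / norm \<kappa> * exp (Re \<kappa> * a)" by (simp add: norm_mult)
      have "norm (P + \<kappa> * A - exp (\<kappa> * of_real a)) \<le> 2 * W1 / norm \<kappa> * exp (\<bar>Re \<kappa>\<bar> * a)"
        unfolding P_def A_def W1_def m_def
        by (rule regular_solution_asymptotics(3)[OF V1 _ k0]) (use a kW in \<open>auto simp: W1_def\<close>)
      also have "\<dots> \<le> 1 / 2 * exp (\<bar>Re \<kappa>\<bar> * a)" using kW k0 by (intro mult_right_mono) (auto simp: field_simps)
      finally have "norm (P + \<kappa> * A - exp (\<kappa> * of_real a)) \<le> 1 / 2 * exp (Re \<kappa> * a)" using k by simp
      moreover have "norm (exp (\<kappa> * of_real a)) = exp (Re \<kappa> * a)" by (simp add: norm_exp_eq_Re)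
      ultimately have "1 / 2 * exp (Re \<kappa> * a) \<le> norm (P + \<kappa> * A)"
        using norm_triangle_sub[of "exp (\<kappa> * of_real a)" "P + \<kappa> * A"] by (simp add: norm_minus_commute)
      then have "1 / 2 * exp (Re \<kappa> * a) * norm (E m) \<le> norm (P + \<kappa> * A) * norm (E m)" by (intro mult_right_mono) auto
      also note up
      finally have "exp (Re \<kappa> * a) * (norm (E m)) \<le> exp (Re \<kappa> * a) * (32 / norm \<kappa>)" by (simp add: mult_ac)
      then show "norm (E (- (\<kappa>\<^sup>2))) \<le> 32 / norm \<kappa>"
        by (simp only: mult_le_cancel_left_pos[OF exp_gt_zero] m_def)
    qed
    then show ?thesis by (simp add: E_def)
  qed
  obtain N where N: "negligible N" "\<And>y. y \<in> {0<..<a} - N \<Longrightarrow> U1 y = U2 y"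
    by (rule proportional_solutions_agree[OF a schroedinger_on_schr_sol[OF U1, of 0 a 0 1] schroedinger_on_schr_sol[OF U1, of 0 a 1 0]
        schroedinger_on_schr_sol[OF U2, of 0 a 0 1] schroedinger_on_schr_sol[OF U2, of 0 a 1 0]])
       (use quot[of _ 0] schr_initial[OF U1] schr_initial[OF U2] in auto)
  have "negligible ((\<lambda>x. a - x) ` N)"
    by (rule negligible_differentiable_image_negligible[OF _ N(1)]) (auto intro!: derivative_intros simp: differentiable_on_def)
  moreover have "V1 y = V2 y" if y: "y \<in> {0<..<a} - (\<lambda>x. a - x) ` N" for y
  proof -
    have "a - y \<notin> N" using y by (metis DiffD2 diff_diff_eq2 add_diff_cancel_left' imageI)
    then have "U1 (a - y) = U2 (a - y)" using N(2)[of "a - y"] y by auto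
    then show ?thesis using y by (simp add: U1_def U2_def reflected_def)
  qed
  ultimately show thesis using that by blast
qed

lemma potential_from_D_hat:
  assumes "\<And>b. V1 absolutely_integrable_on {0..b}" "\<And>b. V2 absolutely_integrable_on {0..b}" "a > 0"
    and "\<And>\<mu>. D_hat a V1 \<mu> = D_hat a V2 \<mu>"
  obtains N where "negligible N" "\<And>y. y \<in> {0<..<a} - N \<Longrightarrow> V1 y = V2 y"
  using potential_from_boundary_values[OF assms(1-3) boundary_values_from_D_hat[OF assms]] by blast

section \<open>Caratheodory solutions\<close>

lemma admissible_absolutely_integrable:
  assumes "admissible a V"
  shows "V absolutely_integrable_on {0..b}"
proof -
  have "V absolutely_integrable_on {0..a}"
    using assms by (simp add: admissible_def absolutely_integrable_on_Icc_iff_Ioo)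
  then have "(\<lambda>t. if t \<in> {0..a} then V t else 0) absolutely_integrable_on UNIV"
    by (subst absolutely_integrable_restrict_UNIV)
  then have "(\<lambda>t. if t \<in> {0..a} then V t else 0) absolutely_integrable_on {0..b}"
    by (rule absolutely_integrable_on_subinterval) simp
  moreover have "(if t \<in> {0..a} then V t else 0) = V t" if "t \<in> {0..b}" for t
    using assms that by (auto simp: admissible_def)
  ultimately show ?thesis by (subst (asm) set_integrable_cong[OF refl refl]) auto
qed

lemma AE_lebesgue_iff_negligible: "(AE x in lebesgue. P x) \<longleftrightarrow> (\<exists>N. negligible N \<and> (\<forall>x. x \<notin> N \<longrightarrow> P x))"
  by (subst eventually_ae_filter_negligible) blast

lemma at_within_Icc_eq_Ici:
  fixes y :: real
  assumes "y < b" shows "at y within {0..b} = at y within {0..}"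
  by (rule at_within_nhd[of _ "{..<b}"]) (use assms in auto)

lemma at_within_Ici_pos:
  fixes y :: real
  assumes "0 < y" shows "at y within {0..} = at y"
proof -
  have "at y within {0..} = at y within UNIV"
    by (rule at_within_nhd[of _ "{0<..}"]) (use assms in auto)
  then show ?thesis by simp
qed

text \<open>
  The derivative is absolutely continuous and its almost everywhere derivative \<open>(V - k\<^sup>2) \<phi>\<close> is
  integrable because \<open>\<phi>\<close> is continuous; so it is the integral of the latter.
\<close>

lemma regular_solution_imp_schroedinger_on:
  assumes V: "\<And>b. V absolutely_integrable_on {0..b}" and r: "regular_solution V k \<phi> \<phi>'"
  shows "schroedinger_on V (k\<^sup>2) b \<phi> \<phi>'"
proof -
  have *: "schroedinger_on V (k\<^sup>2) b \<phi> \<phi>'" if b: "b > 0" for b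
  proof -
    have d: "(\<phi> has_vector_derivative \<phi>' y) (at y within {0..b})" if "y \<in> {0..b}" for y
      using r that unfolding regular_solution_def
      by (auto intro!: has_vector_derivative_within_subset[of \<phi> "\<phi>' y" y "{0..}" "{0..b}"])
    have c: "continuous_on {0..b} \<phi>"
      using d has_vector_derivative_continuous continuous_on_eq_continuous_within by blast
    have qi: "(\<lambda>t. (of_real (V t) - k\<^sup>2) * \<phi> t) absolutely_integrable_on {0..b}"
      by (rule absolutely_integrable_mult_continuous[OF absolutely_integrable_potential[OF V] c])
    obtain N where N: "negligible N" "\<And>y. y \<notin> N \<Longrightarrow> y > 0 \<Longrightarrow> \<exists>w. (\<phi>' has_vector_derivative w) (at y) \<and> w + k\<^sup>2 * \<phi> y = of_real (V y) * \<phi> y"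
      using r unfolding regular_solution_def AE_lebesgue_iff_negligible by blast
    have 2: "primitive_on b (\<lambda>t. (of_real (V t) - k\<^sup>2) * \<phi> t) \<phi>'"
    proof (rule primitive_onI[OF _ qi N(1)])
      show "abs_continuous 0 b \<phi>'" using r b by (simp add: regular_solution_def)
      fix y assume y: "y \<in> {0<..<b} - N"
      then obtain w where w: "(\<phi>' has_vector_derivative w) (at y)" "w + k\<^sup>2 * \<phi> y = of_real (V y) * \<phi> y" using N(2)[of y] by auto
      have "w = (of_real (V y) - k\<^sup>2) * \<phi> y" using w(2) by (simp add: left_diff_distrib eq_diff_eq)
      then show "(\<phi>' has_vector_derivative (of_real (V y) - k\<^sup>2) * \<phi> y) (at y)" using w(1) by simp
    qed
    have 1: "primitive_on b \<phi>' \<phi>" by (rule primitive_on_C1[OF d primitive_on_continuous[OF 2]])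
    show ?thesis using 1 2 by (simp add: schroedinger_on_def)
  qed
  show ?thesis by (rule schroedinger_on_le[OF *[of "\<bar>b\<bar> + 1"]]) auto
qed

lemma schroedinger_on_imp_regular_solution:
  assumes S: "\<And>b. schroedinger_on V (k\<^sup>2) b \<phi> p" and ini: "\<phi> 0 = 0" "p 0 = 1"
  shows "regular_solution V k \<phi> p"
  unfolding regular_solution_def
proof (intro conjI allI impI ini)
  fix y :: real assume y: "0 \<le> y"
  have "(\<phi> has_vector_derivative p y) (at y within {0..y+1})"
    using S[of "y+1"] schroedinger_on_continuous[OF S, of "y+1"] y
    by (intro primitive_on_has_vector_derivative) (auto simp: schroedinger_on_def)
  then show "(\<phi> has_vector_derivative p y) (at y within {0..})" by (simp add: at_within_Icc_eq_Ici)
next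
  fix b :: real
  show "abs_continuous 0 b p" using S[of b] primitive_on_abs_continuous by (auto simp: schroedinger_on_def)
next
  have "\<exists>N. negligible N \<and> (\<forall>x. x \<in> {0<..<real n} - N \<longrightarrow> (p has_vector_derivative (of_real (V x) - k\<^sup>2) * \<phi> x) (at x))" for n
  proof -
    have "primitive_on (real n) (\<lambda>t. (of_real (V t) - k\<^sup>2) * \<phi> t) p" using S[of "real n"] by (simp add: schroedinger_on_def)
    from primitive_on_differentiable_ae[OF this] show ?thesis by metis
  qed
  then obtain N where N: "\<And>n. negligible (N n)"
    "\<And>n x. x \<in> {0<..<real n} - N n \<Longrightarrow> (p has_vector_derivative (of_real (V x) - k\<^sup>2) * \<phi> x) (at x)" by metis
  show "AE y in lebesgue. 0 < y \<longrightarrow> (\<exists>w. (p has_vector_derivative w) (at y) \<and> w + k\<^sup>2 * \<phi> y = of_real (V y) * \<phi> y)"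
    unfolding AE_lebesgue_iff_negligible
  proof (intro exI[of _ "\<Union>n. N n"] conjI allI impI)
    show "negligible (\<Union>n. N n)" by (rule negligible_Union_nat[OF N(1)])
    fix y assume y: "y \<notin> (\<Union>n. N n)" "0 < y"
    obtain n :: nat where "y < real n" using reals_Archimedean2 by blast
    then have "(p has_vector_derivative (of_real (V y) - k\<^sup>2) * \<phi> y) (at y)" using N(2)[of y n] y by auto
    then show "\<exists>w. (p has_vector_derivative w) (at y) \<and> w + k\<^sup>2 * \<phi> y = of_real (V y) * \<phi> y"
      by (intro exI[of _ "(of_real (V y) - k\<^sup>2) * \<phi> y"]) (simp add: algebra_simps)
  qed
qed

lemma regular_solution_schr_sol:
  assumes "\<And>b. V absolutely_integrable_on {0..b}"
  shows "regular_solution V k (schr_sol V 0 1 (k\<^sup>2)) (schr_deriv V 0 1 (k\<^sup>2))"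
  by (rule schroedinger_on_imp_regular_solution) (use schroedinger_on_schr_sol[OF assms] schr_initial[OF assms] in auto)

lemma regular_solution_unique:
  assumes V: "\<And>b. V absolutely_integrable_on {0..b}" and r: "regular_solution V k \<phi> \<phi>'" and y: "y \<ge> 0"
  shows "\<phi> y = schr_sol V 0 1 (k\<^sup>2) y" "\<phi>' y = schr_deriv V 0 1 (k\<^sup>2) y"
  using schroedinger_on_unique[OF V regular_solution_imp_schroedinger_on[OF V r] schroedinger_on_schr_sol[OF V], of 0 1 y y] r y
    schr_initial[OF V, of 0 1] by (auto simp: regular_solution_def)

lemma free_solution_trig:
  assumes a: "a \<ge> 0"
  shows "schr_deriv (\<lambda>_. 0) 0 1 (k\<^sup>2) a = cos (k * of_real a)"
    and "schr_sol (\<lambda>_. 0) 0 1 (k\<^sup>2) a = (if k = 0 then of_real a else sin (k * of_real a) / k)"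
proof -
  let ?C = "schr_deriv (\<lambda>_. 0) 0 1 (k\<^sup>2) a" and ?S = "schr_sol (\<lambda>_. 0) 0 1 (k\<^sup>2) a"
  have 1: "?C + \<i> * k * ?S = exp (\<i> * (k * of_real a))"
    using free_exp[OF a, of "\<i> * k"] by (simp add: power_mult_distrib mult.assoc)
  have 2: "?C - \<i> * k * ?S = exp (- (\<i> * (k * of_real a)))"
    using free_exp[OF a, of "- (\<i> * k)"] by (simp add: power_mult_distrib mult.assoc)
  show "?C = cos (k * of_real a)"
  proof -
    have "2 * ?C = exp (\<i> * (k * of_real a)) + exp (- (\<i> * (k * of_real a)))" unfolding 1[symmetric] 2[symmetric] by simp
    then show ?thesis by (simp add: cos_exp_eq field_simps)
  qed
  show "?S = (if k = 0 then of_real a else sin (k * of_real a) / k)"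
  proof (cases "k = 0")
    case False
    have "2 * \<i> * (k * ?S) = exp (\<i> * (k * of_real a)) - exp (- (\<i> * (k * of_real a)))" unfolding 1[symmetric] 2[symmetric] by (simp add: mult.assoc)
    then have "k * ?S = sin (k * of_real a)" by (simp add: sin_exp_eq field_simps)
    then show ?thesis using False by (simp add: field_simps)
  next
    case True
    have "schroedinger_on (\<lambda>_. 0) 0 a complex_of_real (\<lambda>_. 1)"
      unfolding schroedinger_on_def
      by (auto intro!: primitive_on_C1 derivative_eq_intros)
    from schroedinger_on_unique(1)[OF absolutely_integrable_zero_potential this schroedinger_on_schr_sol[OF absolutely_integrable_zero_potential], of 0 1 a]
    show ?thesis using a True by (simp add: schr_initial)
  qed
qed

text \<open>
  The description operator is resolved by existence and uniqueness of the regular solution.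
\<close>

lemma D_fun_eq_D_hat:
  assumes V: "\<And>b. V absolutely_integrable_on {0..b}" and a: "a \<ge> 0"
  shows "D_fun a V k = D_hat a V (k\<^sup>2)"
  unfolding D_fun_def
proof (rule the_equality)
  show "\<exists>\<phi> \<phi>'. regular_solution V k \<phi> \<phi>' \<and> D_hat a V (k\<^sup>2) =
     (if k = 0 then of_real a else sin (k * of_real a) / k) * \<phi>' a - cos (k * of_real a) * \<phi> a"
    by (intro exI[of _ "schr_sol V 0 1 (k\<^sup>2)"] exI[of _ "schr_deriv V 0 1 (k\<^sup>2)"] conjI regular_solution_schr_sol[OF V])
       (simp only: D_hat_def free_solution_trig[OF a])
  fix d assume "\<exists>\<phi> \<phi>'. regular_solution V k \<phi> \<phi>' \<and> d =
     (if k = 0 then of_real a else sin (k * of_real a) / k) * \<phi>' a - cos (k * of_real a) * \<phi> a"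
  then obtain \<phi> \<phi>' where r: "regular_solution V k \<phi> \<phi>'"
    and d: "d = (if k = 0 then of_real a else sin (k * of_real a) / k) * \<phi>' a - cos (k * of_real a) * \<phi> a" by blast
  show "d = D_hat a V (k\<^sup>2)"
    unfolding d regular_solution_unique[OF V r a] D_hat_def free_solution_trig[OF a] ..
qed

lemma D_hat_holomorphic:
  assumes V: "\<And>b. V absolutely_integrable_on {0..b}" and a: "a \<ge> 0"
  shows "D_hat a V holomorphic_on UNIV"
  unfolding D_hat_def[abs_def]
  by (intro holomorphic_intros schr_holomorphic V absolutely_integrable_zero_potential a)

text \<open>
  Both summands of \<open>D_hat\<close> contain one undifferentiated solution, which brings the factor
  \<open>1 / \<bar>\<kappa>\<bar>\<close>. On the positive axis \<open>\<kappa>\<close> is imaginary, so the exponential factors are \<open>1\<close> and the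
  function decays. Small values of \<open>\<mu>\<close> are covered by compactness.
\<close>

lemma D_hat_growth:
  assumes V: "\<And>b. V absolutely_integrable_on {0..b}" and a: "a > 0"
  obtains C where "C > 0" "\<And>\<mu>. norm (D_hat a V \<mu>) \<le> C * exp (2 * a * sqrt (norm \<mu>))"
    "\<And>x. x > 0 \<Longrightarrow> norm (D_hat a V (of_real x)) \<le> C / sqrt x"
proof -
  define W where "W = integral {0..a} (\<lambda>t. \<bar>V t\<bar>)"
  have W0: "W \<ge> 0" unfolding W_def by (rule integral_abs_nonneg[OF V])
  define K where "K = 2 * W + 1"
  have K: "K \<ge> 1" using W0 by (simp add: K_def)
  have big: "norm (D_hat a V (- (\<kappa>\<^sup>2))) \<le> 8 / norm \<kappa> * exp (2 * (a * \<bar>Re \<kappa>\<bar>))" if k: "norm \<kappa> \<ge> K" for \<kappa>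
  proof -
    have k0: "\<kappa> \<noteq> 0" using k K by auto
    have "norm (D_hat a V (- (\<kappa>\<^sup>2))) \<le> norm (schr_sol (\<lambda>_. 0) 0 1 (- (\<kappa>\<^sup>2)) a) * norm (schr_deriv V 0 1 (- (\<kappa>\<^sup>2)) a)
       + norm (schr_deriv (\<lambda>_. 0) 0 1 (- (\<kappa>\<^sup>2)) a) * norm (schr_sol V 0 1 (- (\<kappa>\<^sup>2)) a)"
      unfolding D_hat_def by (simp only: norm_mult[symmetric]) (rule norm_triangle_ineq4)
    also have "\<dots> \<le> (2 / norm \<kappa> * exp (\<bar>Re \<kappa>\<bar> * a)) * (2 * exp (\<bar>Re \<kappa>\<bar> * a)) + (2 * exp (\<bar>Re \<kappa>\<bar> * a)) * (2 / norm \<kappa> * exp (\<bar>Re \<kappa>\<bar> * a))"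
    proof (intro add_mono mult_mono)
      have kW: "2 * integral {0..a} (\<lambda>t. \<bar>V t\<bar>) \<le> norm \<kappa>" "2 * integral {0..a} (\<lambda>t. \<bar>0::real\<bar>) \<le> norm \<kappa>" "a \<in> {0..a}" "0 \<le> a"
        using k W0 a by (auto simp: K_def W_def)
      show "norm (schr_sol (\<lambda>_. 0) 0 1 (- (\<kappa>\<^sup>2)) a) \<le> 2 / norm \<kappa> * exp (\<bar>Re \<kappa>\<bar> * a)"
        "norm (schr_deriv (\<lambda>_. 0) 0 1 (- (\<kappa>\<^sup>2)) a) \<le> 2 * exp (\<bar>Re \<kappa>\<bar> * a)"
        using regular_solution_asymptotics(1,2)[OF absolutely_integrable_zero_potential kW(4) k0 kW(2,3)] by auto
      show "norm (schr_sol V 0 1 (- (\<kappa>\<^sup>2)) a) \<le> 2 / norm \<kappa> * exp (\<bar>Re \<kappa>\<bar> * a)"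
        "norm (schr_deriv V 0 1 (- (\<kappa>\<^sup>2)) a) \<le> 2 * exp (\<bar>Re \<kappa>\<bar> * a)"
        using regular_solution_asymptotics(1,2)[OF V kW(4) k0 kW(1,3)] by auto
    qed auto
    also have "\<dots> = 8 / norm \<kappa> * (exp (\<bar>Re \<kappa>\<bar> * a) * exp (\<bar>Re \<kappa>\<bar> * a))" by (simp add: field_simps)
    also have "exp (\<bar>Re \<kappa>\<bar> * a) * exp (\<bar>Re \<kappa>\<bar> * a) = exp (2 * (a * \<bar>Re \<kappa>\<bar>))" by (simp flip: exp_add add: mult.commute)
    finally show ?thesis .
  qed
  have "compact (D_hat a V ` cball 0 (K\<^sup>2))"
    using D_hat_holomorphic[OF V, of a] a
    by (intro compact_continuous_image) (auto intro: holomorphic_on_imp_continuous_on holomorphic_on_subset)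
  then obtain M where M: "\<forall>\<mu>\<in>cball 0 (K\<^sup>2). norm (D_hat a V \<mu>) \<le> M"
    using compact_imp_bounded[of "D_hat a V ` cball 0 (K\<^sup>2)"] unfolding bounded_iff by auto
  define C where "C = (\<bar>M\<bar> + 8) * K"
  have C: "C > 0" "C \<ge> 8" "C \<ge> \<bar>M\<bar> * K" "C \<ge> \<bar>M\<bar>"
  proof -
    have "\<bar>M\<bar> + 8 \<le> C" using mult_left_mono[of 1 K "\<bar>M\<bar> + 8"] K by (simp add: C_def)
    then show "C > 0" "C \<ge> 8" "C \<ge> \<bar>M\<bar>" using abs_ge_zero[of M] by linarith+
    show "C \<ge> \<bar>M\<bar> * K" using K by (simp add: C_def algebra_simps)
  qed
  have kap: "\<exists>\<kappa>. \<mu> = - (\<kappa>\<^sup>2) \<and> norm \<kappa> = sqrt (norm \<mu>)" for \<mu> :: complex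
  proof (intro exI conjI)
    show e: "\<mu> = - ((csqrt (- \<mu>))\<^sup>2)" by simp
    have "norm \<mu> = (norm (csqrt (- \<mu>)))\<^sup>2" by (subst e, simp only: norm_minus_cancel norm_power)
    then show "norm (csqrt (- \<mu>)) = sqrt (norm \<mu>)" by (simp only: real_sqrt_abs abs_norm_cancel)
  qed
  have 1: "norm (D_hat a V \<mu>) \<le> C * exp (2 * a * sqrt (norm \<mu>))" for \<mu>
  proof (cases "norm \<mu> \<le> K\<^sup>2")
    case True
    then have "norm (D_hat a V \<mu>) \<le> M" using M by simp
    then have "norm (D_hat a V \<mu>) \<le> C * 1" using C(4) abs_ge_self[of M] by linarith
    also have "\<dots> \<le> C * exp (2 * a * sqrt (norm \<mu>))" using C(1) a by (intro mult_left_mono) auto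
    finally show ?thesis .
  next
    case False
    obtain \<kappa> where k: "\<mu> = - (\<kappa>\<^sup>2)" "norm \<kappa> = sqrt (norm \<mu>)" using kap by blast
    have kK: "norm \<kappa> \<ge> K" unfolding k(2) using False by (intro real_le_rsqrt) auto
    have "norm (D_hat a V \<mu>) \<le> 8 / norm \<kappa> * exp (2 * (a * \<bar>Re \<kappa>\<bar>))" using big[OF kK] k(1) by simp
    also have "\<dots> \<le> C * exp (2 * a * sqrt (norm \<mu>))"
    proof (intro mult_mono)
      have "8 / norm \<kappa> \<le> 8 / 1" using kK K by (intro divide_left_mono) auto
      then show "8 / norm \<kappa> \<le> C" using C by linarith
      show "exp (2 * (a * \<bar>Re \<kappa>\<bar>)) \<le> exp (2 * a * sqrt (norm \<mu>))"
        using a abs_Re_le_cmod[of \<kappa>] k(2) by simp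
    qed (use C in auto)
    finally show ?thesis .
  qed
  have 2: "norm (D_hat a V (of_real x)) \<le> C / sqrt x" if x: "x > 0" for x
  proof (cases "x \<le> K\<^sup>2")
    case True
    then have "norm (D_hat a V (of_real x)) \<le> M" using M x by auto
    moreover have "sqrt x \<le> K" using True K by (intro real_le_lsqrt) (use x in auto)
    then have "\<bar>M\<bar> * sqrt x \<le> \<bar>M\<bar> * K" by (intro mult_left_mono) auto
    then have "\<bar>M\<bar> \<le> C / sqrt x" using C x by (simp add: field_simps)
    ultimately show ?thesis by linarith
  next
    case False
    define \<kappa> where "\<kappa> = \<i> * complex_of_real (sqrt x)"
    have k: "- (\<kappa>\<^sup>2) = of_real x" "norm \<kappa> = sqrt x" "Re \<kappa> = 0"
      using x by (auto simp: \<kappa>_def power_mult_distrib norm_mult simp flip: of_real_power)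
    have "norm \<kappa> \<ge> K" unfolding k(2) using False by (intro real_le_rsqrt) auto
    from big[OF this] have "norm (D_hat a V (of_real x)) \<le> 8 / sqrt x" using k by simp
    also have "\<dots> \<le> C / sqrt x" using C x by (intro divide_right_mono) auto
    finally show ?thesis .
  qed
  show thesis using that[of C] C 1 2 by blast
qed

section \<open>Zeros of the characteristic function are special transmission eigenvalues\<close>

lemma negligible_Times_UNIV:
  fixes N :: "real set"
  assumes "negligible N"
  shows "negligible (N \<times> (UNIV :: (real \<times> real) set))"
proof -
  obtain N' where N': "N' \<in> null_sets lborel" "N \<subseteq> N'"
    using assms unfolding negligible_iff_null_sets null_sets_completion_iff2 by blast
  have "N' \<times> (UNIV :: (real \<times> real) set) \<in> null_sets (lborel \<Otimes>\<^sub>M lborel)"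
    using N'(1) lborel.emeasure_pair_measure_Times[of N' lborel "UNIV :: (real \<times> real) set"]
    by (auto simp: null_sets_def)
  then have 1: "N' \<times> (UNIV :: (real \<times> real) set) \<in> null_sets lborel" by (simp only: lborel_prod)
  have 2: "N \<times> (UNIV :: (real \<times> real) set) \<subseteq> N' \<times> UNIV" using N'(2) by (rule Sigma_mono) simp
  have "N \<times> (UNIV :: (real \<times> real) set) \<in> null_sets lebesgue"
    unfolding null_sets_completion_iff2 using 1 2 by (intro bexI)
  then show ?thesis by (simp add: negligible_iff_null_sets)
qed

text \<open>
  Spherical coordinates are a differentiable map from a space of the same dimension and carry a
  null set of radii, times all angles, to a null set. Applying planar polar coordinates twice
  yields a radius that may be negative, whence the symmetrised set of radii.
\<close>

lemma negligible_norm_preimage: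
  fixes N :: "real set"
  assumes N: "negligible N"
  shows "negligible {x :: real^3. norm x \<in> N}"
proof -
  define M where "M = N \<union> uminus ` N"
  have M: "negligible M" unfolding M_def
    by (intro negligible_Un N negligible_differentiable_image_negligible[OF _ N])
       (auto intro!: derivative_intros simp: differentiable_on_def)
  define f :: "real \<times> real \<times> real \<Rightarrow> real^3"
    where "f = (\<lambda>v. vector [fst v * sin (fst (snd v)) * cos (snd (snd v)), fst v * sin (fst (snd v)) * sin (snd (snd v)), fst v * cos (fst (snd v))])"
  have feq: "f = (\<lambda>v. (fst v * sin (fst (snd v)) * cos (snd (snd v))) *\<^sub>R axis 1 1 + (fst v * sin (fst (snd v)) * sin (snd (snd v))) *\<^sub>R axis 2 1 + (fst v * cos (fst (snd v))) *\<^sub>R axis 3 1)"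
    by (intro ext) (simp add: f_def vec_eq_iff forall_3 axis_def)
  have "negligible (f ` (M \<times> UNIV))"
  proof (rule negligible_differentiable_image_negligible[OF _ negligible_Times_UNIV[OF M]])
    show "f differentiable_on M \<times> UNIV" unfolding differentiable_on_def
    proof
      fix v :: "real \<times> real \<times> real"
      have "(f has_derivative (\<lambda>h. ((fst h * sin (fst (snd v)) + fst v * (cos (fst (snd v)) * fst (snd h))) * cos (snd (snd v)) + fst v * sin (fst (snd v)) * (- sin (snd (snd v)) * snd (snd h))) *\<^sub>R axis 1 1
         + ((fst h * sin (fst (snd v)) + fst v * (cos (fst (snd v)) * fst (snd h))) * sin (snd (snd v)) + fst v * sin (fst (snd v)) * (cos (snd (snd v)) * snd (snd h))) *\<^sub>R axis 2 1
         + (fst h * cos (fst (snd v)) + fst v * (- sin (fst (snd v)) * fst (snd h))) *\<^sub>R axis 3 1)) (at v within M \<times> UNIV)"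
        unfolding feq by (auto intro!: derivative_eq_intros ext simp: algebra_simps)
      then show "f differentiable at v within M \<times> UNIV" by (auto simp: differentiable_def)
    qed
  qed simp
  moreover have "{x :: real^3. norm x \<in> N} \<subseteq> f ` (M \<times> UNIV)"
  proof
    fix x :: "real^3" assume x: "x \<in> {x. norm x \<in> N}"
    obtain s \<beta> where s: "x $ 1 = s * cos \<beta>" "x $ 2 = s * sin \<beta>" using polar_Ex by blast
    obtain r \<theta> where r: "x $ 3 = r * cos \<theta>" "s = r * sin \<theta>" using polar_Ex by blast
    have "(norm x)\<^sup>2 = (x $ 1)\<^sup>2 + (x $ 2)\<^sup>2 + (x $ 3)\<^sup>2"
      unfolding power2_norm_eq_inner by (simp add: inner_vec_def sum_3 power2_eq_square)
    also have "\<dots> = s\<^sup>2 * ((cos \<beta>)\<^sup>2 + (sin \<beta>)\<^sup>2) + r\<^sup>2 * (cos \<theta>)\<^sup>2" unfolding s r(1) by (simp only: distrib_left power_mult_distrib)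
    also have "\<dots> = r\<^sup>2 * ((sin \<theta>)\<^sup>2 + (cos \<theta>)\<^sup>2)" unfolding r(2) by (simp only: sin_cos_squared_add2 mult_1_right distrib_left power_mult_distrib)
    finally have "r\<^sup>2 = (norm x)\<^sup>2" by simp
    then have "r = norm x \<or> r = - norm x" by (simp add: power2_eq_iff)
    then have "r \<in> M" using x by (auto simp: M_def)
    moreover have "x = f (r, \<theta>, \<beta>)" by (simp add: f_def vec_eq_iff forall_3 s r)
    ultimately show "x \<in> f ` (M \<times> UNIV)" by blast
  qed
  ultimately show ?thesis by (rule negligible_subset)
qed

lemma abs_continuous_C1:
  assumes "\<And>x. x \<in> {b..c} \<Longrightarrow> (F has_vector_derivative f x) (at x within {b..c})" "continuous_on {b..c} f"
  shows "abs_continuous b c F"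
proof (rule abs_continuous_if_integral)
  show "f absolutely_integrable_on {b..c}" by (rule absolutely_integrable_continuous_real[OF assms(2)])
  fix x y assume xy: "b \<le> x" "x \<le> y" "y \<le> c"
  have "(f has_integral (F y - F x)) {x..y}"
    by (rule fundamental_theorem_of_calculus) (use xy in \<open>auto intro: has_vector_derivative_within_subset[OF assms(1)]\<close>)
  then show "F y - F x = integral {x..y} f" by (simp add: integral_unique)
qed

lemma norm_line_has_derivative:
  fixes z :: "real^3"
  assumes z: "z \<noteq> 0"
  shows "((\<lambda>t. norm (z + t *\<^sub>R axis i 1)) has_vector_derivative (z $ i / norm z)) (at 0)"
proof -
  have eq: "norm (z + t *\<^sub>R axis i 1) = sqrt ((norm z)\<^sup>2 + 2 * t * z $ i + t\<^sup>2)" for t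
  proof -
    have "(norm (z + t *\<^sub>R axis i 1))\<^sup>2 = (norm z)\<^sup>2 + 2 * t * z $ i + t\<^sup>2"
      unfolding power2_norm_eq_inner by (simp add: inner_add_left inner_add_right inner_axis inner_axis' inner_commute power2_eq_square algebra_simps)
    then show ?thesis by (metis norm_ge_zero real_sqrt_unique)
  qed
  have "((\<lambda>t. sqrt ((norm z)\<^sup>2 + 2 * t * z $ i + t\<^sup>2)) has_real_derivative (z $ i / norm z)) (at 0)"
    using z by (auto intro!: derivative_eq_intros simp: field_simps)
  then show ?thesis unfolding eq has_real_derivative_iff_has_vector_derivative .
qed

lemma radial_partial:
  fixes x :: "real^3"
  assumes x: "x \<noteq> 0" and f: "(f has_vector_derivative f') (at (norm x))"
  shows "has_partial (\<lambda>x. f (norm x)) i (f' * of_real (x $ i / norm x)) x"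
proof -
  have "(f has_vector_derivative f') (at (norm (x + 0 *\<^sub>R axis i 1)))" using f by simp
  from vector_diff_chain_at[OF norm_line_has_derivative[OF x, of i] this]
  show ?thesis unfolding has_partial_def by (simp add: o_def scaleR_conv_of_real mult.commute)
qed

text \<open>
  In three dimensions the Laplacian of a radial function is \<open>f'' + 2 f' / r\<close>. The second derivative is
  required at the one radius only, which suits an equation that holds almost everywhere.
\<close>

lemma radial_laplacian:
  fixes x :: "real^3"
  assumes x: "x \<noteq> 0"
    and f: "\<And>r. r > 0 \<Longrightarrow> (f has_vector_derivative f' r) (at r)"
    and f': "(f' has_vector_derivative f'') (at (norm x))"
    and F: "\<And>x. x \<noteq> 0 \<Longrightarrow> F x = f (norm x)"
  shows "has_laplacian F (f'' + 2 * f' (norm x) / of_real (norm x)) x"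
proof -
  define r where "r = norm x"
  have r: "r > 0" using x by (simp add: r_def)
  define g where "g = (\<lambda>i (z::real^3). f' (norm z) / of_real (norm z) * of_real (z $ i))"
  define h where "h = (\<lambda>i. (f'' / of_real r - f' r / of_real (r\<^sup>2)) * of_real (x $ i / r) * of_real (x $ i) + f' r / of_real r)"
  have cong: "has_partial F' i d z" if "has_partial G i d z" "z \<noteq> 0" "\<And>x. x \<noteq> 0 \<Longrightarrow> F' x = G x" for F' G i d and z :: "real^3"
    unfolding has_partial_def
  proof (rule has_vector_derivative_transform_within[OF that(1)[unfolded has_partial_def]])
    show "0 < norm z" using that by simp
    fix t :: real assume "dist t 0 < norm z"
    then have "z + t *\<^sub>R axis i 1 \<noteq> 0"
      by (metis add_eq_0_iff2 norm_minus_cancel norm_scaleR norm_axis_1 mult.right_neutral real_norm_def dist_0_norm less_irrefl dist_commute)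
    then show "G (z + t *\<^sub>R axis i 1) = F' (z + t *\<^sub>R axis i 1)" using that(3) by simp
  qed simp
  have 1: "\<forall>\<^sub>F z in nhds x. has_partial F i (g i z) z" for i
  proof (rule eventually_nhds_in_open[THEN eventually_mono])
    show "open (- {0::real^3})" by auto
    show "x \<in> - {0}" using x by simp
    fix z :: "real^3" assume "z \<in> - {0}"
    then have z: "z \<noteq> 0" by simp
    have "has_partial (\<lambda>x. f (norm x)) i (f' (norm z) * of_real (z $ i / norm z)) z"
      by (rule radial_partial[OF z]) (use f z in auto)
    from cong[OF this z F] show "has_partial F i (g i z) z" by (simp add: g_def)
  qed
  have 2: "has_partial (g i) i (h i) x" for i
  proof -
    have "((\<lambda>s. f' s / of_real s) has_vector_derivative (f'' / of_real r - f' r / of_real (r\<^sup>2))) (at (norm x))"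
    proof -
      have "((\<lambda>s::real. inverse (complex_of_real s)) has_vector_derivative - ((inverse (of_real r))\<^sup>2)) (at r)"
      proof -
        have "((\<lambda>z. inverse z) has_field_derivative - (inverse (complex_of_real r))\<^sup>2) (at (of_real r))"
          using r by (auto intro!: derivative_eq_intros simp: power2_eq_square)
        from has_vector_derivative_real_field[OF this] show ?thesis by (simp add: power_inverse)
      qed
      from has_vector_derivative_mult[OF f'[folded r_def] this]
      show ?thesis using r by (simp add: r_def[symmetric] field_simps power2_eq_square)
    qed
    from radial_partial[OF x this, of i]
    have a: "((\<lambda>t. f' (norm (x + t *\<^sub>R axis i 1)) / of_real (norm (x + t *\<^sub>R axis i 1))) has_vector_derivative
       (f'' / of_real r - f' r / of_real (r\<^sup>2)) * of_real (x $ i / r)) (at 0)"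
      by (simp add: has_partial_def r_def)
    have "((\<lambda>t. complex_of_real (x $ i + t)) has_vector_derivative 1) (at 0)"
      by (auto intro!: derivative_eq_intros)
    moreover have "(x + t *\<^sub>R axis i 1) $ i = x $ i + t" for t by (simp add: axis_def)
    ultimately have b: "((\<lambda>t. complex_of_real ((x + t *\<^sub>R axis i 1) $ i)) has_vector_derivative 1) (at 0)" by simp
    from has_vector_derivative_mult[OF a b] show ?thesis
      by (simp add: has_partial_def g_def h_def r_def add.commute)
  qed
  have 3: "(\<Sum>i\<in>UNIV. h i) = f'' + 2 * f' r / of_real r"
  proof -
    have "(\<Sum>i\<in>UNIV. (x $ i)\<^sup>2) = r\<^sup>2"
      unfolding r_def power2_norm_eq_inner by (simp add: inner_vec_def power2_eq_square)
    then have s: "(\<Sum>i\<in>UNIV. complex_of_real ((x $ i)\<^sup>2)) = of_real (r\<^sup>2)" by (simp only: of_real_sum[symmetric])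
    have "(\<Sum>i\<in>UNIV. h i) = (\<Sum>i\<in>UNIV. (f'' / of_real r - f' r / of_real (r\<^sup>2)) / of_real r * of_real ((x $ i)\<^sup>2)) + 3 * (f' r / of_real r)"
      unfolding h_def sum.distrib by (simp add: power2_eq_square mult.assoc)
    also have "\<dots> = (f'' / of_real r - f' r / of_real (r\<^sup>2)) / of_real r * of_real (r\<^sup>2) + 3 * (f' r / of_real r)"
      by (simp only: sum_distrib_left[symmetric] s)
    also have "\<dots> = f'' + 2 * f' r / of_real r" using r by (simp add: field_simps power2_eq_square)
    finally show ?thesis .
  qed
  show ?thesis unfolding has_laplacian_def using 1 2 3 by (auto simp: r_def intro!: exI[of _ g] exI[of _ h])
qed

text \<open>
  The profile \<open>c \<phi>(r) / r\<close> turns \<open>f'' + 2 f' / r\<close> into \<open>c \<phi>'' / r\<close>. Its limit at the origin is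
  \<open>c \<phi>'(0) = c\<close>.
\<close>

definition radial_extension :: "complex \<Rightarrow> (real \<Rightarrow> complex) \<Rightarrow> real \<Rightarrow> complex" where
  "radial_extension c \<phi> r = (if r = 0 then c else c * \<phi> r / of_real r)"

lemma radial_extension_has_vector_derivative:
  assumes r: "regular_solution V k \<phi> \<phi>'" and s: "s > 0"
  shows "(radial_extension c \<phi> has_vector_derivative c * (of_real s * \<phi>' s - \<phi> s) * of_real (1 / s\<^sup>2)) (at s)"
proof -
  have d: "(\<phi> has_vector_derivative \<phi>' s) (at s)"
    using r s at_within_Ici_pos[OF s] unfolding regular_solution_def by (metis less_imp_le)
  have "((\<lambda>z. inverse z) has_field_derivative - (inverse (complex_of_real s))\<^sup>2) (at (of_real s))"
    using s by (auto intro!: derivative_eq_intros simp: power2_eq_square)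
  from has_vector_derivative_mult[OF d has_vector_derivative_real_field[OF this]]
  have "((\<lambda>t. \<phi> t * inverse (of_real t)) has_vector_derivative (of_real s * \<phi>' s - \<phi> s) * of_real (1 / s\<^sup>2)) (at s)"
    using s by (simp add: field_simps power2_eq_square)
  then have "((\<lambda>t. c * (\<phi> t * inverse (of_real t))) has_vector_derivative c * ((of_real s * \<phi>' s - \<phi> s) * of_real (1 / s\<^sup>2))) (at s)"
    by (rule has_vector_derivative_mult_right)
  then have "((\<lambda>t. c * (\<phi> t * inverse (of_real t))) has_vector_derivative c * (of_real s * \<phi>' s - \<phi> s) * of_real (1 / s\<^sup>2)) (at s)"
    by (simp add: mult.assoc)
  then show ?thesis
    by (rule has_vector_derivative_transform_within_open[of _ _ _ "{0<..}"])
       (use s in \<open>auto simp: radial_extension_def field_simps\<close>)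
qed

lemma radial_extension_solution:
  assumes V: "\<And>b. V absolutely_integrable_on {0..b}" and r: "regular_solution V k \<phi> \<phi>'" and a: "a > 0"
  shows "radial_solution a V (k\<^sup>2) (\<lambda>x. radial_extension c \<phi> (norm x))"
  unfolding radial_solution_def
proof (intro conjI)
  let ?\<psi> = "radial_extension c \<phi>"
  define \<psi>' where "\<psi>' = (\<lambda>s. c * (of_real s * \<phi>' s - \<phi> s) * of_real (1 / s\<^sup>2))"
  have der': "(?\<psi> has_vector_derivative \<psi>' s) (at s)" if "s > 0" for s
    using radial_extension_has_vector_derivative[OF r that, of c] by (simp add: \<psi>'_def)
  have "continuous_on {0..a} ?\<psi>"
    unfolding continuous_on_eq_continuous_within
  proof
    fix s assume s: "s \<in> {0..a}"
    show "continuous (at s within {0..a}) ?\<psi>"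
    proof (cases "s = 0")
      case False
      then have "continuous (at s) ?\<psi>" using s der'[of s] has_vector_derivative_continuous by auto
      then show ?thesis by (rule continuous_at_imp_continuous_at_within)
    next
      case True
      have "(\<phi> has_vector_derivative 1) (at 0 within {0..})" "\<phi> 0 = 0" using r by (auto simp: regular_solution_def)
      then have lim: "((\<lambda>s. \<phi> s / of_real s) \<longlongrightarrow> 1) (at 0 within {0..})"
      proof -
        have "((\<lambda>y. (1 / norm (y - 0)) *\<^sub>R (\<phi> y - (\<phi> 0 + (y - 0) *\<^sub>R 1))) \<longlongrightarrow> 0) (at 0 within {0..})"
          using \<open>(\<phi> has_vector_derivative 1) (at 0 within {0..})\<close>
          unfolding has_vector_derivative_def has_derivative_within by blast
        then have "((\<lambda>y. \<phi> y / of_real y - 1) \<longlongrightarrow> 0) (at 0 within {0..})"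
          by (rule Lim_transform_within[OF _ zero_less_one]) (auto simp: \<open>\<phi> 0 = 0\<close> scaleR_conv_of_real field_simps)
        then show ?thesis by (simp only: LIM_zero_iff)
      qed
      have "((\<lambda>s. c * (\<phi> s / of_real s)) \<longlongrightarrow> c * 1) (at 0 within {0..a})"
        by (rule tendsto_mult[OF tendsto_const tendsto_within_subset[OF lim]]) auto
      then have "(?\<psi> \<longlongrightarrow> c * 1) (at 0 within {0..a})"
        by (rule Lim_transform_within[OF _ zero_less_one]) (auto simp: radial_extension_def)
      then show ?thesis using True by (simp add: continuous_within radial_extension_def)
    qed
  qed
  then show "continuous_on (cball 0 a) (\<lambda>x::real^3. ?\<psi> (norm x))"
    by (rule continuous_on_compose2) (auto intro!: continuous_intros)
  have S: "schroedinger_on V (k\<^sup>2) b \<phi> \<phi>'" for b by (rule regular_solution_imp_schroedinger_on[OF V r])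
  show "\<exists>\<psi> \<psi>'. (\<forall>x\<in>cball (0::real^3) a. ?\<psi> (norm x) = \<psi> (norm x)) \<and>
        (\<forall>r\<in>{0<..<a}. (\<psi> has_vector_derivative \<psi>' r) (at r)) \<and>
        (\<forall>b c. 0 < b \<and> b \<le> c \<and> c < a \<longrightarrow> abs_continuous b c \<psi>')"
  proof (rule exI[of _ ?\<psi>], rule exI[of _ \<psi>'], intro conjI allI impI ballI refl)
    fix s assume "s \<in> {0<..<a}" then show "(?\<psi> has_vector_derivative \<psi>' s) (at s)" by (intro der') auto
  next
    fix b d assume bd: "0 < b \<and> b \<le> d \<and> d < a"
    have p1: "primitive_on d (\<lambda>_. 1) complex_of_real" by (auto intro!: primitive_on_C1 derivative_eq_intros)
    have p2: "primitive_on d (\<lambda>t. (of_real (V t) - k\<^sup>2) * \<phi> t) \<phi>'" "primitive_on d \<phi>' \<phi>" using S by (auto simp: schroedinger_on_def)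
    have ac: "abs_continuous 0 d (\<lambda>t. c * (of_real t * \<phi>' t) + (- c) * \<phi> t)"
      by (rule primitive_on_abs_continuous[OF primitive_on_linear[OF primitive_on_mult[OF p1 p2(1)] p2(2)]])
    then have ac: "abs_continuous 0 d (\<lambda>t. c * (of_real t * \<phi>' t - \<phi> t))" by (simp add: algebra_simps)
    have cm: "continuous_on {b..d} (\<lambda>t. c * (of_real t * \<phi>' t - \<phi> t))"
      using schroedinger_on_continuous[OF S, of d] bd by (auto intro!: continuous_intros intro: continuous_on_subset)
    have dd: "((\<lambda>t. complex_of_real (1 / t\<^sup>2)) has_vector_derivative complex_of_real (- 2 / t ^ 3)) (at t within {b..d})" if "t \<in> {b..d}" for t
    proof -
      have "((\<lambda>t. 1 / t\<^sup>2) has_real_derivative - 2 / t ^ 3) (at t)"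
        using that bd by (auto intro!: derivative_eq_intros simp: field_simps power2_eq_square power3_eq_cube)
      then show ?thesis
        by (rule has_vector_derivative_of_real[OF has_field_derivative_at_within])
    qed
    have cd: "continuous_on {b..d} (\<lambda>t. complex_of_real (- 2 / t ^ 3))" "continuous_on {b..d} (\<lambda>t. complex_of_real (1 / t\<^sup>2))"
      using bd by (auto intro!: continuous_intros)
    obtain A where A: "\<forall>t\<in>{b..d}. norm (c * (of_real t * \<phi>' t - \<phi> t)) \<le> A"
      using compact_imp_bounded[OF compact_continuous_image[OF cm]] unfolding bounded_iff by auto
    obtain B where B: "\<forall>t\<in>{b..d}. norm (complex_of_real (1 / t\<^sup>2)) \<le> B"
      using compact_imp_bounded[OF compact_continuous_image[OF cd(2)]] unfolding bounded_iff by auto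
    show "abs_continuous b d \<psi>'" unfolding \<psi>'_def
      by (rule abs_continuous_mult[OF abs_continuous_subinterval[OF ac] abs_continuous_C1[OF dd cd(1)] A[rule_format] B[rule_format]])
         (use bd in auto)
  qed
  obtain N where N: "negligible N" "\<And>y. y \<notin> N \<Longrightarrow> y > 0 \<Longrightarrow> \<exists>w. (\<phi>' has_vector_derivative w) (at y) \<and> w + k\<^sup>2 * \<phi> y = of_real (V y) * \<phi> y"
    using r unfolding regular_solution_def AE_lebesgue_iff_negligible by blast
  show "AE x in lebesgue. x \<in> ball (0::real^3) a \<longrightarrow> (\<exists>l. has_laplacian (\<lambda>x. ?\<psi> (norm x)) l x \<and>
      - l + of_real (V (norm x)) * ?\<psi> (norm x) = k\<^sup>2 * ?\<psi> (norm x))"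
    unfolding AE_lebesgue_iff_negligible
  proof (intro exI[of _ "{x. norm x \<in> N} \<union> {0}"] conjI allI impI)
    show "negligible ({x::real^3. norm x \<in> N} \<union> {0})" by (intro negligible_Un negligible_norm_preimage N(1)) auto
    fix x :: "real^3" assume x: "x \<notin> {x. norm x \<in> N} \<union> {0}"
    define s where "s = norm x"
    have s: "s > 0" "s \<notin> N" using x by (auto simp: s_def)
    obtain w where w: "(\<phi>' has_vector_derivative w) (at s)" "w + k\<^sup>2 * \<phi> s = of_real (V s) * \<phi> s" using N(2)[OF s(2,1)] by blast
    have d: "(\<phi> has_vector_derivative \<phi>' s) (at s)"
      using r s(1) at_within_Ici_pos[OF s(1)] unfolding regular_solution_def by (metis less_imp_le)
    have i: "((\<lambda>t. complex_of_real (1 / t\<^sup>2)) has_vector_derivative complex_of_real (- 2 / s ^ 3)) (at s)"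
    proof (rule has_vector_derivative_of_real)
      show "((\<lambda>t. 1 / t\<^sup>2) has_real_derivative - 2 / s ^ 3) (at s)"
        using s(1) by (auto intro!: derivative_eq_intros simp: field_simps power2_eq_square power3_eq_cube)
    qed
    have one: "(complex_of_real has_vector_derivative 1) (at s)" by (auto intro!: derivative_eq_intros)
    have "((\<lambda>t. of_real t * \<phi>' t - \<phi> t) has_vector_derivative of_real s * w) (at s)"
      using has_vector_derivative_diff[OF has_vector_derivative_mult[OF one w(1)] d] by simp
    from has_vector_derivative_mult_right[OF this, of c]
    have "((\<lambda>t. c * (of_real t * \<phi>' t - \<phi> t)) has_vector_derivative c * (of_real s * w)) (at s)" .
    from has_vector_derivative_mult[OF this i]
    have "(\<psi>' has_vector_derivative c * (of_real s * \<phi>' s - \<phi> s) * of_real (- 2 / s ^ 3) + c * (of_real s * w) * of_real (1 / s\<^sup>2)) (at (norm x))"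
      by (simp add: \<psi>'_def[abs_def] s_def)
    from radial_laplacian[OF _ der' this refl] x
    have l: "has_laplacian (\<lambda>x. ?\<psi> (norm x)) (c * (of_real s * \<phi>' s - \<phi> s) * of_real (- 2 / s ^ 3) + c * (of_real s * w) * of_real (1 / s\<^sup>2) + 2 * \<psi>' s / of_real s) x"
      by (simp add: s_def)
    have "c * (of_real s * \<phi>' s - \<phi> s) * of_real (- 2 / s ^ 3) + c * (of_real s * w) * of_real (1 / s\<^sup>2) + 2 * \<psi>' s / of_real s = c * w / of_real s"
      using s by (simp add: \<psi>'_def field_simps power2_eq_square power3_eq_cube)
    with l have l: "has_laplacian (\<lambda>x. ?\<psi> (norm x)) (c * w / of_real s) x" by simp
    have w': "w = (of_real (V s) - k\<^sup>2) * \<phi> s" using w(2) by (simp add: left_diff_distrib eq_diff_eq)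
    show "\<exists>l. has_laplacian (\<lambda>x. ?\<psi> (norm x)) l x \<and> - l + of_real (V (norm x)) * ?\<psi> (norm x) = k\<^sup>2 * ?\<psi> (norm x)"
      by (intro exI conjI, rule l)
         (use s in \<open>simp add: w' s_def[symmetric] radial_extension_def field_simps\<close>)
  qed
qed

lemma radial_extension_normal_derivative:
  fixes x :: "real^3"
  assumes r: "regular_solution V k \<phi> \<phi>'" and a: "a > 0" and x: "norm x = a"
  shows "has_normal_derivative a (\<lambda>x. radial_extension c \<phi> (norm x)) (c * (of_real a * \<phi>' a - \<phi> a) * of_real (1 / a\<^sup>2)) x"
proof -
  have "((\<lambda>t. a + t) has_vector_derivative 1) (at 0 within {..0})" by (auto intro!: derivative_eq_intros)
  moreover have "(radial_extension c \<phi> has_vector_derivative c * (of_real a * \<phi>' a - \<phi> a) * of_real (1 / a\<^sup>2)) (at (a + 0) within (+) a ` {..0})"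
    using radial_extension_has_vector_derivative[OF r a, of c] by (auto intro: has_vector_derivative_at_within)
  ultimately have "(radial_extension c \<phi> \<circ> (\<lambda>t. a + t) has_vector_derivative 1 *\<^sub>R (c * (of_real a * \<phi>' a - \<phi> a) * of_real (1 / a\<^sup>2))) (at 0 within {..0})"
    by (rule vector_diff_chain_within)
  then have d: "((\<lambda>t. radial_extension c \<phi> (a + t)) has_vector_derivative (c * (of_real a * \<phi>' a - \<phi> a) * of_real (1 / a\<^sup>2))) (at 0 within {..0})"
    by (simp add: o_def)
  show ?thesis unfolding has_normal_derivative_def
  proof (rule has_vector_derivative_transform_within[OF d a])
    fix t :: real assume t: "t \<in> {..0}" "dist t 0 < a"
    have "x + t *\<^sub>R (x /\<^sub>R a) = (1 + t / a) *\<^sub>R x" by (simp add: scaleR_add_left divide_inverse)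
    then have "norm (x + t *\<^sub>R (x /\<^sub>R a)) = \<bar>1 + t / a\<bar> * a" using x by simp
    also have "\<dots> = a + t"
    proof -
      have "1 + t / a = (a + t) / a" using a by (simp add: field_simps)
      then show ?thesis using a t by simp
    qed
    finally show "radial_extension c \<phi> (a + t) = radial_extension c \<phi> (norm (x + t *\<^sub>R (x /\<^sub>R a)))" by simp
  qed simp
qed

text \<open>
  At a zero the boundary data \<open>(\<phi>(a), \<phi>'(a))\<close> are proportional to those of the free solution, by
  a factor \<open>c\<close>. The radial extensions of \<open>\<phi>\<close> and of \<open>c\<close> times the free solution match on the sphere
  together with their normal derivatives, and the first one has the value \<open>1\<close> at the origin.
\<close>

lemma zeros_are_special_te:
  assumes V: "\<And>b. V absolutely_integrable_on {0..b}" and a: "a > 0" and z: "D_hat a V \<mu> = 0"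
  shows "\<mu> \<in> special_te a V"
proof -
  define k where "k = csqrt \<mu>"
  have k: "k\<^sup>2 = \<mu>" by (simp add: k_def)
  define A where "A = schr_sol V 0 1 \<mu> a"
  define P where "P = schr_deriv V 0 1 \<mu> a"
  define S where "S = schr_sol (\<lambda>_. 0) 0 1 \<mu> a"
  define C where "C = schr_deriv (\<lambda>_. 0) 0 1 \<mu> a"
  have SP: "S * P = C * A" using z by (simp add: D_hat_def A_def P_def S_def C_def)
  have py: "C\<^sup>2 + \<mu> * S\<^sup>2 = 1" unfolding C_def S_def using a by (intro free_pythagoras) auto
  \<comment> \<open>the component of \<open>(P, A)\<close> along \<open>(C, S)\<close>, by \<open>C\<^sup>2 + \<mu> S\<^sup>2 = 1\<close>\<close>
  define c where "c = C * P + \<mu> * S * A"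
  have c: "A = c * S" "P = c * C" unfolding c_def using SP py by algebra+
  note r = regular_solution_schr_sol[OF V, of k, unfolded k]
  note r0 = regular_solution_schr_sol[OF absolutely_integrable_zero_potential, of k, unfolded k]
  let ?Psi = "\<lambda>x::real^3. radial_extension 1 (schr_sol V 0 1 \<mu>) (norm x)"
  let ?Free = "\<lambda>x::real^3. radial_extension c (schr_sol (\<lambda>_. 0) 0 1 \<mu>) (norm x)"
  have s: "radial_solution a V \<mu> ?Psi" "radial_solution a (\<lambda>_. 0) \<mu> ?Free"
    using radial_extension_solution[OF V r a, of 1] radial_extension_solution[OF absolutely_integrable_zero_potential r0 a, of c]
    by (simp_all only: k)
  have b: "?Psi x = ?Free x \<and> (\<exists>d. has_normal_derivative a ?Psi d x \<and> has_normal_derivative a ?Free d x)" if "x \<in> sphere 0 a" for x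
  proof
    have x: "norm x = a" using that by simp
    show "?Psi x = ?Free x" using x a c by (simp add: radial_extension_def A_def S_def)
    have "1 * (of_real a * P - A) * of_real (1 / a\<^sup>2) = c * (of_real a * C - S) * of_real (1 / a\<^sup>2)"
      unfolding c by (simp add: algebra_simps)
    then show "\<exists>d. has_normal_derivative a ?Psi d x \<and> has_normal_derivative a ?Free d x"
      using radial_extension_normal_derivative[OF r a x, of 1] radial_extension_normal_derivative[OF r0 a x, of c]
      unfolding A_def P_def S_def C_def by metis
  qed
  have "\<exists>x\<in>cball 0 a. ?Psi x \<noteq> 0 \<or> ?Free x \<noteq> 0"
    by (rule bexI[of _ 0]) (use a in \<open>auto simp: radial_extension_def\<close>)
  then show ?thesis unfolding special_te_def using s b by blast
qed

section \<open>Hadamard products of entire functions of order one half\<close>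

lemma entire_analytic_nonzero:
  assumes f: "f holomorphic_on UNIV" and w: "f w \<noteq> (0::complex)"
  shows "f analytic_on {z}" "eventually (\<lambda>w. f w \<noteq> 0) (at z)" "frequently (\<lambda>w. f w \<noteq> 0) (at z)"
proof -
  show "f analytic_on {z}" by (rule holomorphic_on_imp_analytic_at[OF f]) auto
  show ev: "eventually (\<lambda>w. f w \<noteq> 0) (at z)"
    using non_zero_neighbour_alt[OF f, of z w] w by (auto elim: eventually_mono)
  then show "frequently (\<lambda>w. f w \<noteq> 0) (at z)" by (rule eventually_frequently[rotated]) simp
qed

lemma entire_zorder:
  assumes f: "f holomorphic_on UNIV" and w: "f w \<noteq> (0::complex)"
  shows "zorder f z \<ge> 0" "zorder f z = 0 \<longleftrightarrow> f z \<noteq> 0"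
  using zorder_ge_0 zorder_eq_0_iff entire_analytic_nonzero[OF assms] by blast+

lemma zorder_linear_factor:
  assumes "e \<noteq> (0::complex)"
  shows "zorder (\<lambda>z. 1 - z / e) z = (if z = e then 1 else 0)"
proof (cases "z = e")
  case True
  have "zorder (\<lambda>z. 1 - z / e) e = 1"
    by (rule zorder_eqI[where S = UNIV and g = "\<lambda>_. - 1 / e"]) (use assms in \<open>auto simp: field_simps\<close>)
  then show ?thesis using True by simp
next
  case False
  then show ?thesis using assms by (auto intro!: zorder_eq_0I analytic_intros simp: field_simps)
qed

lemma divide_out_zero:
  assumes f: "f holomorphic_on UNIV" and e: "f e = (0::complex)"
  obtains g where "g holomorphic_on UNIV" "\<And>z. f z = (z - e) * g z"
proof
  show "(\<lambda>z. if z = e then deriv f e else (f z - f e) / (z - e)) holomorphic_on UNIV"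
    by (rule pole_lemma_open[OF f open_UNIV])
qed (use e in auto)

lemma divide_out_nonzero_zero:
  assumes f: "f holomorphic_on UNIV" and e: "f e = (0::complex)" "e \<noteq> 0"
  obtains g where "g holomorphic_on UNIV" "\<And>z. f z = (1 - z / e) * g z"
proof -
  obtain g where g: "g holomorphic_on UNIV" "\<And>z. f z = (z - e) * g z" using divide_out_zero[OF f e(1)] by blast
  show thesis
  proof (rule that[of "\<lambda>z. - e * g z"])
    show "(\<lambda>z. - e * g z) holomorphic_on UNIV" by (intro holomorphic_intros g)
    fix z show "f z = (1 - z / e) * (- e * g z)" unfolding g(2)[of z] using e(2) by (simp add: field_simps)
  qed
qed

lemma zorder_mult_linear_factor:
  assumes g: "g holomorphic_on UNIV" and e: "e \<noteq> 0" and nz: "f w \<noteq> (0::complex)" and f: "\<And>z. f z = (1 - z / e) * g z"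
  shows "zorder f z = zorder g z + (if z = e then 1 else 0)"
proof -
  have hf: "(\<lambda>z. (1 - z / e) * g z) holomorphic_on UNIV" using e by (intro holomorphic_intros g) auto
  have "zorder (\<lambda>z. (1 - z / e) * g z) z = zorder (\<lambda>z. 1 - z / e) z + zorder g z"
  proof (rule zorder_times_analytic)
    show "(\<lambda>z. 1 - z / e) analytic_on {z}" using e by (intro analytic_intros) auto
    show "g analytic_on {z}" by (rule holomorphic_on_imp_analytic_at[OF g]) auto
    show "eventually (\<lambda>z. (1 - z / e) * g z \<noteq> 0) (at z)"
      by (rule entire_analytic_nonzero(2)[OF hf, of w]) (use nz f in simp)
  qed
  moreover have "f = (\<lambda>z. (1 - z / e) * g z)" using f by auto
  ultimately show ?thesis by (simp add: zorder_linear_factor[OF e])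
qed

text \<open>
  The Borel--Caratheodory inequality for a logarithm \<open>h\<close> of \<open>g / g 0\<close>, whose real part is at most \<open>A\<close>
  and which vanishes at \<open>0\<close>.
\<close>

lemma borel_caratheodory_log:
  assumes g: "g holomorphic_on ball 0 R" and R: "R > 0" and nz: "\<And>z. z \<in> ball 0 R \<Longrightarrow> g z \<noteq> 0"
    and le: "\<And>z. z \<in> ball 0 R \<Longrightarrow> norm (g z) \<le> exp A * norm (g 0)" and A: "A > 0" and z: "norm z < R"
  obtains h where "g z = g 0 * exp h" "norm h \<le> 2 * A * (norm z / (R - norm z))"
proof -
  obtain l where l: "l holomorphic_on ball 0 R" "\<And>x. x \<in> ball 0 R \<Longrightarrow> exp (l x) = g x"
    using holomorphic_logarithm_exists[of "ball 0 R" g 0] g nz R by auto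
  have g0: "g 0 \<noteq> 0" using nz R by auto
  define h where "h = (\<lambda>z. l z - l 0)"
  have hh: "h holomorphic_on ball 0 R" unfolding h_def by (intro holomorphic_intros l)
  have h0: "h 0 = 0" by (simp add: h_def)
  have eh: "g x = g 0 * exp (h x)" if "x \<in> ball 0 R" for x
    using l(2)[OF that] l(2)[of 0] R g0 by (simp add: h_def exp_diff)
  have Re: "Re (h x) \<le> A" if "x \<in> ball 0 R" for x
  proof -
    have "norm (g 0) * exp (Re (h x)) \<le> norm (g 0) * exp A"
      using le[OF that] eh[OF that] by (simp add: norm_mult norm_exp_eq_Re mult.commute)
    then show ?thesis using g0 by simp
  qed
  \<comment> \<open>the half plane \<open>Re \<le> A\<close> is mapped into the unit disc by \<open>h / (2 A' - h)\<close> for every \<open>A' > A\<close>\<close>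
  have bound: "norm (h z) * (R - norm z) \<le> 2 * A' * norm z" if A': "A' > A" for A'
  proof -
    define k where "k = (\<lambda>w. h (of_real R * w) / (2 * of_real A' - h (of_real R * w)))"
    have inR: "of_real R * w \<in> ball 0 R" if "norm w < 1" for w :: complex
      using that R by (simp add: norm_mult)
    have den: "2 * of_real A' - h x \<noteq> 0" and lt: "norm (h x) < norm (2 * of_real A' - h x)" if "x \<in> ball 0 R" for x
    proof -
      have "Re (h x) < A'" using Re[OF that] A' by linarith
      then have "(Re (h x))\<^sup>2 < (2 * A' - Re (h x))\<^sup>2" using A A' 
        by (simp add: power2_eq_square algebra_simps)
      then have "(norm (h x))\<^sup>2 < (norm (2 * of_real A' - h x))\<^sup>2"
        by (simp add: cmod_power2)
      then show "norm (h x) < norm (2 * of_real A' - h x)" by (rule power2_less_imp_less) simp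
      then show "2 * of_real A' - h x \<noteq> 0" by auto
    qed
    have hc: "(\<lambda>w. h (of_real R * w)) holomorphic_on ball 0 1"
      by (rule holomorphic_on_compose_gen[OF _ hh, unfolded o_def]) (use inR in \<open>auto intro!: holomorphic_intros\<close>)
    have "k holomorphic_on ball 0 1" unfolding k_def
      using den inR by (intro holomorphic_intros hc) auto
    moreover have "norm (k w) < 1" if "norm w < 1" for w
      unfolding k_def norm_divide using lt[OF inR[OF that]] den[OF inR[OF that]] by (simp add: divide_less_eq)
    moreover have "norm (z / of_real R) < 1" using z R by (simp add: norm_divide)
    ultimately have "norm (k (z / of_real R)) \<le> norm (z / of_real R)"
      by (intro Schwarz_Lemma(1)) (auto simp: k_def h0)
    then have "norm (h z) / norm (2 * of_real A' - h z) \<le> norm z / R"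
      using R by (simp add: k_def norm_divide)
    then have "norm (h z) * R \<le> norm z * norm (2 * of_real A' - h z)"
      using den[of z] z R by (simp add: field_simps)
    also have "\<dots> \<le> norm z * (2 * A' + norm (h z))"
      using norm_triangle_ineq4[of "2 * of_real A'" "h z"] A A' by (intro mult_left_mono) auto
    finally show ?thesis by (simp add: algebra_simps)
  qed
  have "norm (h z) * (R - norm z) \<le> 2 * A * norm z"
  proof (rule field_le_epsilon)
    \<comment> \<open>\<open>A'\<close> is chosen so close to \<open>A\<close> that the error is at most \<open>e\<close>\<close>
    fix e :: real assume e: "e > 0"
    have "norm (h z) * (R - norm z) \<le> 2 * (A + e / (2 * (norm z + 1))) * norm z"
      by (rule bound) (use e in \<open>simp add: add_nonneg_pos\<close>)
    also have "\<dots> = 2 * A * norm z + e * (norm z / (norm z + 1))"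
    proof -
      have "norm z + 1 \<noteq> 0" by (smt (verit) norm_ge_zero)
      then show ?thesis by (simp add: field_simps)
    qed
    also have "\<dots> \<le> 2 * A * norm z + e * 1"
      using e by (intro add_left_mono mult_left_mono) (auto simp: divide_le_eq add_nonneg_pos)
    finally show "norm (h z) * (R - norm z) \<le> 2 * A * norm z + e" by simp
  qed
  then have "norm (h z) \<le> 2 * A * (norm z / (R - norm z))" using z by (simp add: field_simps)
  then show thesis using that eh[of z] z by auto
qed

text \<open>
  On the circle of radius \<open>4 R\<close> each of the \<open>N\<close> linear factors with a zero in the disc of radius
  \<open>R\<close> has modulus at least \<open>3\<close>; the maximum principle transports the bound inside. At \<open>w = 0\<close> this
  counts zeros, which replaces Jensen's formula.
\<close>

lemma partial_product_remainder_bound: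
  assumes g: "g holomorphic_on UNIV" and f: "\<And>z. f z = (\<Prod>n<N. 1 - z / e n) * g z"
    and growth: "\<And>z. norm (f z) \<le> C * exp (c * sqrt (norm z))"
    and e: "\<And>n. n < N \<Longrightarrow> e n \<noteq> 0 \<and> norm (e n) \<le> R" and R: "R > 0" and w: "norm w \<le> 4 * R"
  shows "norm (g w) * 3 ^ N \<le> C * exp (2 * c * sqrt R)"
proof -
  have "norm (g w) \<le> C * exp (2 * c * sqrt R) / 3 ^ N"
  proof (rule maximum_modulus_frontier[of g "cball 0 (4 * R)"])
    show "g holomorphic_on interior (cball 0 (4 * R))" using g holomorphic_on_subset by blast
    show "continuous_on (closure (cball 0 (4 * R))) g"
      using g holomorphic_on_subset holomorphic_on_imp_continuous_on by blast
    fix z :: complex assume "z \<in> frontier (cball 0 (4 * R))"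
    then have z: "norm z = 4 * R" using R by (simp add: frontier_cball)
    have "3 ^ N = (\<Prod>n<N. 3::real)" by simp
    also have "\<dots> \<le> (\<Prod>n<N. norm (1 - z / e n))"
    proof (rule prod_mono)
      fix n assume n: "n \<in> {..<N}"
      have "norm (z / e n) \<ge> 4" using e[of n] n z by (simp add: norm_divide le_divide_eq)
      moreover have "norm (z / e n) \<le> norm (1 - z / e n) + 1"
        using norm_triangle_ineq4[of 1 "1 - z / e n"] by simp
      ultimately show "0 \<le> (3::real) \<and> 3 \<le> norm (1 - z / e n)" by linarith
    qed
    finally have "3 ^ N * norm (g z) \<le> (\<Prod>n<N. norm (1 - z / e n)) * norm (g z)" by (rule mult_right_mono) simp
    also have "\<dots> = norm (f z)" by (simp add: f norm_mult prod_norm)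
    also have "\<dots> \<le> C * exp (c * sqrt (4 * R))" using growth[of z] z by simp
    also have "c * sqrt (4 * R) = 2 * c * sqrt R" by (simp add: real_sqrt_mult)
    finally show "norm (g z) \<le> C * exp (2 * c * sqrt R) / 3 ^ N" by (simp add: field_simps)
  qed (use w in auto)
  then show ?thesis by (simp add: field_simps)
qed

text \<open>
  The zeros \<open>e n\<close> are divided out of \<open>f\<close> one at a time in the order of their moduli, repeated
  according to multiplicity; \<open>g n\<close> is the cofactor after \<open>n\<close> divisions. Carrying the cofactors
  along encodes the multiplicities without naming them.
\<close>

definition peels_zeros :: "(complex \<Rightarrow> complex) \<Rightarrow> (nat \<Rightarrow> complex) \<Rightarrow> (nat \<Rightarrow> complex \<Rightarrow> complex) \<Rightarrow> bool" where
  "peels_zeros f e g \<longleftrightarrow>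
     (\<forall>n. g n holomorphic_on UNIV \<and> e n \<noteq> 0 \<and> norm (e n) \<le> norm (e (Suc n)) \<and>
          (\<forall>z. f z = (\<Prod>i<n. 1 - z / e i) * g n z) \<and> (\<forall>z. norm z < norm (e n) \<longrightarrow> g n z \<noteq> 0))"

lemma peels_zeros_mono:
  assumes "peels_zeros f e g" "m \<le> n" shows "norm (e m) \<le> norm (e n)"
  using assms(2) by (rule lift_Suc_mono_le[of "\<lambda>n. norm (e n)", rotated]) (use assms(1) in \<open>auto simp: peels_zeros_def\<close>)

lemma peels_zeros_count:
  assumes p: "peels_zeros f e g" and growth: "\<And>z. norm (f z) \<le> C * exp (c * sqrt (norm z))" and C: "C > 0" and f0: "f 0 \<noteq> 0"
  shows "real n \<le> ln (C / norm (f 0)) + 2 * c * sqrt (norm (e n))"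
proof -
  have g: "g n holomorphic_on UNIV" "e n \<noteq> 0" "\<And>z. f z = (\<Prod>i<n. 1 - z / e i) * g n z" and e: "\<And>n. e n \<noteq> 0"
    using p by (auto simp: peels_zeros_def)
  have g0: "g n 0 = f 0" using g(3)[of 0] by simp
  have "norm (g n 0) * 3 ^ n \<le> C * exp (2 * c * sqrt (norm (e n)))"
    by (rule partial_product_remainder_bound[OF g(1,3) growth]) (use e peels_zeros_mono[OF p] in auto)
  then have le: "3 ^ n \<le> (C / norm (f 0)) * exp (2 * c * sqrt (norm (e n)))"
    using f0 g0 by (simp add: field_simps)
  have pos: "C / norm (f 0) > 0" using C f0 by simp
  have "exp (real n) = exp 1 ^ n" by (simp add: exp_of_nat_mult[symmetric])
  also have "\<dots> \<le> 3 ^ n" by (intro power_mono exp_le) auto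
  also note le
  also have "(C / norm (f 0)) * exp (2 * c * sqrt (norm (e n))) = exp (ln (C / norm (f 0)) + 2 * c * sqrt (norm (e n)))"
    using pos by (simp add: exp_add)
  finally show ?thesis by simp
qed

text \<open>
  By the count of zeros \<open>\<bar>e n\<bar>\<close> grows at least quadratically in \<open>n\<close>.
\<close>

lemma peels_zeros_summable:
  assumes p: "peels_zeros f e g" and growth: "\<And>z. norm (f z) \<le> C * exp (c * sqrt (norm z))" and C: "C > 0" "c > 0" and f0: "f 0 \<noteq> 0"
  shows "summable (\<lambda>n. 1 / norm (e n))"
proof (rule summable_comparison_test_ev)
  define K where "K = \<bar>ln (C / norm (f 0))\<bar>"
  show "eventually (\<lambda>n. norm (1 / norm (e n)) \<le> (16 * c\<^sup>2) * (1 / real n ^ 2)) sequentially"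
  proof (rule eventually_sequentiallyI)
    fix n assume n: "n \<ge> nat \<lceil>2 * K\<rceil> + 1"
    have en: "e n \<noteq> 0" using p by (simp add: peels_zeros_def)
    have nK: "real n \<ge> 2 * K" "n > 0" using n by linarith+
    have "real n \<le> K + 2 * c * sqrt (norm (e n))"
      using peels_zeros_count[OF p growth C(1) f0, of n] unfolding K_def by linarith
    then have "real n \<le> 4 * c * sqrt (norm (e n))" using nK by linarith
    then have "(real n)\<^sup>2 \<le> (4 * c * sqrt (norm (e n)))\<^sup>2" by (intro power_mono) auto
    also have "\<dots> = 16 * c\<^sup>2 * norm (e n)" by (simp add: power_mult_distrib)
    finally show "norm (1 / norm (e n)) \<le> (16 * c\<^sup>2) * (1 / real n ^ 2)" using en nK by (simp add: field_simps)
  qed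
  show "summable (\<lambda>n. (16 * c\<^sup>2) * (1 / real n ^ 2))"
    using inverse_power_summable[of 2, where 'a = real] by (intro summable_mult) (simp add: field_simps)
qed

lemma peels_zeros_at_top:
  assumes p: "peels_zeros f e g" and growth: "\<And>z. norm (f z) \<le> C * exp (c * sqrt (norm z))" and C: "C > 0" "c > 0" and f0: "f 0 \<noteq> 0"
  shows "filterlim (\<lambda>n. norm (e n)) at_top sequentially"
proof -
  have "(\<lambda>n. 1 / norm (e n)) \<longlonglongrightarrow> 0" by (rule summable_LIMSEQ_zero[OF peels_zeros_summable[OF assms]])
  moreover have "\<forall>\<^sub>F n in sequentially. 1 / norm (e n) > 0" using p by (simp add: peels_zeros_def)
  ultimately have "filterlim (\<lambda>n. inverse (1 / norm (e n))) at_top sequentially"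
    by (rule filterlim_inverse_at_top)
  then show ?thesis by simp
qed

lemma growth_log_tendsto_0:
  assumes R: "filterlim R at_top F"
  shows "((\<lambda>n. 2 * (K + 2 * c * sqrt (R n)) * (r / (R n - r))) \<longlongrightarrow> 0) F"
proof -
  have "((\<lambda>R. 2 * (K + 2 * c * sqrt R) * (r / (R - r))) \<longlongrightarrow> 0) at_top"
  proof -
    have "((\<lambda>R. 2 * (K / sqrt R + 2 * c) * r / (sqrt R - r / sqrt R)) \<longlongrightarrow> 0) at_top"
    proof (rule real_tendsto_divide_at_top)
      have s: "filterlim sqrt at_top at_top" by (rule sqrt_at_top)
      show "((\<lambda>R. 2 * (K / sqrt R + 2 * c) * r) \<longlongrightarrow> 2 * (0 + 2 * c) * r) at_top"
        by (intro tendsto_intros real_tendsto_divide_at_top[OF tendsto_const s])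
      have "((\<lambda>R. - (r / sqrt R)) \<longlongrightarrow> - 0) at_top" by (intro tendsto_minus real_tendsto_divide_at_top[OF tendsto_const s])
      from filterlim_tendsto_add_at_top[OF this s]
      show "filterlim (\<lambda>R. sqrt R - r / sqrt R) at_top at_top" by simp
    qed
    moreover have "\<forall>\<^sub>F R in at_top. 2 * (K / sqrt R + 2 * c) * r / (sqrt R - r / sqrt R) = 2 * (K + 2 * c * sqrt R) * (r / (R - r))"
    proof (rule eventually_at_top_linorderI)
      fix R :: real assume R: "R \<ge> \<bar>r\<bar> + 1"
      define s where "s = sqrt R"
      have s: "s > 0" "R = s * s" using R by (auto simp: s_def)
      show "2 * (K / sqrt R + 2 * c) * r / (sqrt R - r / sqrt R) = 2 * (K + 2 * c * sqrt R) * (r / (R - r))"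
        unfolding s_def[symmetric] unfolding s(2) using s R by (simp add: field_simps)
    qed
    ultimately show ?thesis by (rule Lim_transform_eventually)
  qed
  then show ?thesis using R by (rule filterlim_compose)
qed

text \<open>
  On the disc of radius \<open>R n\<close> the function \<open>g n\<close> is \<open>g0 * exp h\<close> with \<open>Re h = O(sqrt (R n))\<close>. By the
  Borel--Caratheodory inequality \<open>h\<close> is \<open>O(1 / sqrt (R n))\<close> at a fixed point. The order being less
  than \<open>1\<close> is used here.
\<close>

lemma zero_free_remainder_tendsto:
  assumes g: "\<And>n. g n holomorphic_on UNIV" "\<And>n z. norm z < R n \<Longrightarrow> g n z \<noteq> 0" "\<And>n. R n > 0"
    and le: "\<And>n w. norm w \<le> R n \<Longrightarrow> norm (g n w) \<le> C * exp (2 * c * sqrt (R n))"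
    and g0: "\<And>n. g n 0 = g0" and C: "C > 0" "c > 0" and R: "filterlim R at_top sequentially"
  shows "(\<lambda>n. g n z) \<longlonglongrightarrow> g0"
proof -
  define K where "K = \<bar>ln (C / norm g0)\<bar> + 1"
  have gz: "g0 \<noteq> 0" using g(2)[of 0 0] g(3)[of 0] g0 by auto
  have ex: "\<exists>h. g n z = g0 * exp h \<and> norm h \<le> 2 * (K + 2 * c * sqrt (R n)) * (norm z / (R n - norm z))"
    if n: "norm z < R n" for n
  proof -
    have A: "K + 2 * c * sqrt (R n) > 0" using C g(3)[of n] by (simp add: K_def add_pos_nonneg)
    have "norm (g n w) \<le> exp (K + 2 * c * sqrt (R n)) * norm (g n 0)" if "w \<in> ball 0 (R n)" for w
    proof -
      have "norm (g n w) \<le> C * exp (2 * c * sqrt (R n))" using le[of w n] that by simp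
      also have "C = exp (ln (C / norm g0)) * norm g0" using C gz by simp
      also have "\<dots> * exp (2 * c * sqrt (R n)) \<le> exp K * norm g0 * exp (2 * c * sqrt (R n))"
        by (intro mult_right_mono) (auto simp: K_def)
      also have "\<dots> = exp (K + 2 * c * sqrt (R n)) * norm g0" by (simp add: exp_add)
      finally show ?thesis by (simp add: g0)
    qed
    from borel_caratheodory_log[OF holomorphic_on_subset[OF g(1)] g(3) _ this A n] g(2)
    obtain h where "g n z = g n 0 * exp h" "norm h \<le> 2 * (K + 2 * c * sqrt (R n)) * (norm z / (R n - norm z))" by auto
    then show ?thesis using g0 by auto
  qed
  have ev: "\<forall>\<^sub>F n in sequentially. norm z < R n" using R by (rule filterlim_at_top_dense[THEN iffD1, rule_format])
  obtain h where h: "\<And>n. norm z < R n \<Longrightarrow> g n z = g0 * exp (h n) \<and> norm (h n) \<le> 2 * (K + 2 * c * sqrt (R n)) * (norm z / (R n - norm z))"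
    using ex by metis
  have "\<forall>\<^sub>F n in sequentially. norm (h n) \<le> 2 * (K + 2 * c * sqrt (R n)) * (norm z / (R n - norm z))"
    using ev by eventually_elim (rule conjunct2[OF h])
  then have "h \<longlonglongrightarrow> 0" by (rule Lim_null_comparison[OF _ growth_log_tendsto_0[OF R]])
  then have "(\<lambda>n. g0 * exp (h n)) \<longlonglongrightarrow> g0 * exp 0" by (intro tendsto_intros)
  then have "(\<lambda>n. g n z) \<longlonglongrightarrow> g0 * exp 0"
  proof (rule Lim_transform_eventually)
    show "\<forall>\<^sub>F n in sequentially. g0 * exp (h n) = g n z" using ev by eventually_elim (simp add: h)
  qed
  then show ?thesis by simp
qed

text \<open>
  The cofactors \<open>g n\<close> have no zeros in growing discs and inherit the growth of \<open>f\<close>, so they tend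
  to the constant \<open>f 0\<close>.
\<close>

theorem hadamard_product_order_half:
  assumes p: "peels_zeros f e g" and growth: "\<And>z. norm (f z) \<le> C * exp (c * sqrt (norm z))" and C: "C > 0" "c > 0" and f0: "f 0 \<noteq> 0"
  shows "(\<lambda>n. \<Prod>i<n. 1 - z / e i) \<longlonglongrightarrow> f z / f 0"
proof -
  have g: "g n holomorphic_on UNIV" "e n \<noteq> 0" "f z = (\<Prod>i<n. 1 - z / e i) * g n z" "norm z < norm (e n) \<Longrightarrow> g n z \<noteq> 0" for n z
    using p by (auto simp: peels_zeros_def)
  have "(\<lambda>n. g n z) \<longlonglongrightarrow> f 0"
  proof (rule zero_free_remainder_tendsto[where g = g and R = "\<lambda>n. norm (e n)" and C = C and c = c])
    fix n and w :: complex assume w: "norm w \<le> norm (e n)"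
    then have w4: "norm w \<le> 4 * norm (e n)" using norm_ge_zero[of "e n"] by linarith
    have "norm (g n w) * 1 \<le> norm (g n w) * 3 ^ n" by (intro mult_left_mono) auto
    also have "\<dots> \<le> C * exp (2 * c * sqrt (norm (e n)))"
      by (rule partial_product_remainder_bound[OF g(1) g(3) growth])
         (use g(2) w4 peels_zeros_mono[OF p] in auto)
    finally show "norm (g n w) \<le> C * exp (2 * c * sqrt (norm (e n)))" by simp
  next
    show "filterlim (\<lambda>n. norm (e n)) at_top sequentially" by (rule peels_zeros_at_top[OF assms])
    show "g n 0 = f 0" for n using g(3)[of 0 n] by simp
  qed (use g C in auto)
  then have "(\<lambda>n. f z / g n z) \<longlonglongrightarrow> f z / f 0" using f0 by (intro tendsto_intros)
  moreover have "\<forall>\<^sub>F n in sequentially. f z / g n z = (\<Prod>i<n. 1 - z / e i)"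
  proof -
    have "\<forall>\<^sub>F n in sequentially. norm z < norm (e n)"
      using peels_zeros_at_top[OF assms] by (rule filterlim_at_top_dense[THEN iffD1, rule_format])
    then show ?thesis
    proof eventually_elim
      case (elim n)
      show ?case using g(3)[of z n] g(4)[OF elim] by (simp add: field_simps)
    qed
  qed
  ultimately show ?thesis by (rule Lim_transform_eventually)
qed

lemma zero_free_slow_growth_constant:
  assumes f: "f holomorphic_on UNIV" "\<And>z. f z \<noteq> 0" and growth: "\<And>z. norm (f z) \<le> C * exp (c * sqrt (norm z))" and C: "C > 0" "c > 0"
  shows "f z = f 0"
proof -
  have "(\<lambda>n. f z) \<longlonglongrightarrow> f 0"
  proof (rule zero_free_remainder_tendsto[where g = "\<lambda>n. f" and R = "\<lambda>n. real (Suc n)" and C = C and c = c])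
    fix n and w :: complex assume w: "norm w \<le> real (Suc n)"
    have "sqrt (norm w) \<le> sqrt (real (Suc n))" using w by (rule real_sqrt_le_mono)
    then have "c * sqrt (norm w) \<le> c * sqrt (real (Suc n))" using C by (intro mult_left_mono) auto
    also have "\<dots> \<le> 2 * c * sqrt (real (Suc n))" using C by simp
    finally have "C * exp (c * sqrt (norm w)) \<le> C * exp (2 * c * sqrt (real (Suc n)))" using C by (intro mult_left_mono) auto
    then show "norm (f w) \<le> C * exp (2 * c * sqrt (real (Suc n)))" using growth[of w] by linarith
  next
    show "filterlim (\<lambda>n. real (Suc n)) at_top sequentially"
      by (rule filterlim_compose[OF filterlim_real_sequentially filterlim_Suc])
  qed (use f C in auto)
  then show ?thesis by (simp add: LIMSEQ_const_iff)
qed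

lemma slow_growth_from_outside:
  assumes g: "g holomorphic_on UNIV" and C: "C > 0" "c > 0"
    and le: "\<And>z. norm z \<ge> r \<Longrightarrow> norm (g z) \<le> C * exp (c * sqrt (norm z))"
  shows "\<exists>C>0. \<forall>z. norm (g z :: complex) \<le> C * exp (c * sqrt (norm z))"
proof -
  have "compact (g ` cball 0 r)"
    using g by (intro compact_continuous_image) (auto intro: holomorphic_on_imp_continuous_on holomorphic_on_subset)
  then obtain M where M: "\<forall>z\<in>cball 0 r. norm (g z) \<le> M"
    using compact_imp_bounded[of "g ` cball 0 r"] unfolding bounded_iff by auto
  have "norm (g z) \<le> (C + \<bar>M\<bar>) * exp (c * sqrt (norm z))" for z
  proof (cases "norm z \<ge> r")
    case True
    have "C * exp (c * sqrt (norm z)) \<le> (C + \<bar>M\<bar>) * exp (c * sqrt (norm z))" by (intro mult_right_mono) auto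
    then show ?thesis using le[OF True] by linarith
  next
    case False
    then have "norm (g z) \<le> M" using M by simp
    also have "M \<le> (C + \<bar>M\<bar>) * 1" using C by simp
    also have "\<dots> \<le> (C + \<bar>M\<bar>) * exp (c * sqrt (norm z))" using C by (intro mult_left_mono) auto
    finally show ?thesis .
  qed
  moreover have "C + \<bar>M\<bar> > 0" using C by simp
  ultimately show ?thesis by blast
qed

text \<open>
  A function of this growth without zeros is constant, and a nonzero constant does not tend to \<open>0\<close>
  along the positive axis. So there is a zero, hence one of least modulus. Outside a disc the
  division only decreases the modulus, and the cofactor has the same properties as \<open>f\<close>; therefore
  the division can be repeated forever.
\<close>

lemma peeling_step:
  assumes f: "f holomorphic_on UNIV" "f 0 \<noteq> 0" and growth: "\<exists>C>0. \<forall>z. norm (f z) \<le> C * exp (c * sqrt (norm z))" and c: "c > 0"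
    and dec: "((\<lambda>x. f (of_real x)) \<longlongrightarrow> 0) at_top"
  obtains e g where "e \<noteq> 0" "f e = 0" "\<And>w. f w = 0 \<Longrightarrow> norm e \<le> norm w" "g holomorphic_on UNIV" "g 0 \<noteq> 0"
    "\<And>z. f z = (1 - z / e) * g z" "\<exists>C>0. \<forall>z. norm (g z) \<le> C * exp (c * sqrt (norm z))" "((\<lambda>x. g (of_real x)) \<longlongrightarrow> 0) at_top"
proof -
  obtain C where C: "C > 0" "\<And>z. norm (f z) \<le> C * exp (c * sqrt (norm z))" using growth by blast
  have "\<exists>z. f z = 0"
  proof (rule ccontr)
    assume "\<nexists>z. f z = 0"
    then have "f z = f 0" for z using zero_free_slow_growth_constant[OF f(1) _ C(2) C(1) c] by blast
    then have "(\<lambda>x::real. f (of_real x)) = (\<lambda>x. f 0)" by blast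
    then have "((\<lambda>x::real. f 0) \<longlongrightarrow> 0) at_top" using dec by simp
    then show False using f(2) by (simp add: tendsto_const_iff)
  qed
  then have "{z. f z = 0} \<noteq> {}" by blast
  moreover have "closed {z. f z = 0}"
    using continuous_closed_preimage_constant[OF holomorphic_on_imp_continuous_on[OF f(1)] closed_UNIV, of 0] by simp
  ultimately obtain e where "e \<in> {z. f z = 0}" "\<And>y. y \<in> {z. f z = 0} \<Longrightarrow> dist 0 e \<le> dist 0 y"
    using distance_attains_inf[of "{z. f z = 0}" 0] by metis
  then have e: "f e = 0" "\<And>w. f w = 0 \<Longrightarrow> norm e \<le> norm w" by auto
  have e0: "e \<noteq> 0" using e f by auto
  obtain g where g: "g holomorphic_on UNIV" "\<And>z. f z = (1 - z / e) * g z" using divide_out_nonzero_zero[OF f(1) e(1) e0] by blast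
  have le: "norm (g z) \<le> norm (f z)" if z: "norm z \<ge> 2 * norm e" for z
  proof -
    have "norm (z / e) \<ge> 2" using z e0 by (simp add: norm_divide le_divide_eq)
    then have "norm (1 - z / e) \<ge> 1" using norm_triangle_ineq4[of 1 "1 - z / e"] by simp
    then have "1 * norm (g z) \<le> norm (1 - z / e) * norm (g z)" by (intro mult_right_mono) auto
    then show ?thesis by (simp add: g(2) norm_mult)
  qed
  have gr: "\<exists>C>0. \<forall>z. norm (g z) \<le> C * exp (c * sqrt (norm z))"
    by (rule slow_growth_from_outside[OF g(1) C(1) c, of "2 * norm e"]) (rule order_trans[OF le C(2)])
  have "((\<lambda>x. g (of_real x)) \<longlongrightarrow> 0) at_top"
  proof (rule Lim_null_comparison)
    show "\<forall>\<^sub>F x in at_top. norm (g (of_real x)) \<le> norm (f (of_real x))"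
      by (rule eventually_at_top_linorderI[of "2 * norm e"]) (intro le, auto)
    show "((\<lambda>x. norm (f (of_real x))) \<longlongrightarrow> 0) at_top" using dec by (rule tendsto_norm_zero)
  qed
  moreover have "g 0 \<noteq> 0" using f(2) g(2)[of 0] by simp
  ultimately show thesis using that e0 e g gr by blast
qed

lemma peels_zeros_exists:
  assumes f: "f holomorphic_on UNIV" "f 0 \<noteq> 0" and growth: "\<exists>C>0. \<forall>z. norm (f z) \<le> C * exp (c * sqrt (norm z))" and c: "c > 0"
    and dec: "((\<lambda>x. f (of_real x)) \<longlongrightarrow> 0) at_top"
  obtains e g where "peels_zeros f e g" "\<And>n. f (e n) = 0"
proof -
  define Q where "Q = (\<lambda>h. h holomorphic_on UNIV \<and> h 0 \<noteq> (0::complex) \<and> (\<exists>C>0. \<forall>z. norm (h z) \<le> C * exp (c * sqrt (norm z))) \<and> ((\<lambda>x. h (of_real x)) \<longlongrightarrow> 0) at_top)"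
  define S where "S = (\<lambda>h e k. e \<noteq> 0 \<and> h e = 0 \<and> (\<forall>w. h w = 0 \<longrightarrow> norm e \<le> norm w) \<and> (\<forall>z::complex. h z = (1 - z / e) * (k z :: complex)))"
  have "\<exists>g. \<forall>n. (Q (g n) \<and> (n = 0 \<longrightarrow> g n = f)) \<and> (\<exists>e. S (g n) e (g (Suc n)))"
  proof (rule dependent_nat_choice)
    show "\<exists>h. Q h \<and> (0 = (0::nat) \<longrightarrow> h = f)" using f growth dec by (auto simp: Q_def)
    fix h and n :: nat assume "Q h \<and> (n = 0 \<longrightarrow> h = f)"
    then have h: "h holomorphic_on UNIV" "h 0 \<noteq> 0" "\<exists>C>0. \<forall>z. norm (h z) \<le> C * exp (c * sqrt (norm z))" "((\<lambda>x. h (of_real x)) \<longlongrightarrow> 0) at_top"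
      by (auto simp: Q_def)
    obtain e k where "e \<noteq> 0" "h e = 0" "\<And>w. h w = 0 \<Longrightarrow> norm e \<le> norm w" "k holomorphic_on UNIV" "k 0 \<noteq> 0"
      "\<And>z. h z = (1 - z / e) * k z" "\<exists>C>0. \<forall>z. norm (k z) \<le> C * exp (c * sqrt (norm z))" "((\<lambda>x. k (of_real x)) \<longlongrightarrow> 0) at_top"
      by (rule peeling_step[OF h(1-3) c h(4)], rule that)
    then have "Q k" "S h e k" by (auto simp: Q_def S_def)
    then show "\<exists>k. (Q k \<and> (Suc n = 0 \<longrightarrow> k = f)) \<and> (\<exists>e. S h e k)" by auto
  qed
  then obtain g where g: "\<And>n. Q (g n)" "g 0 = f" "\<And>n. \<exists>e. S (g n) e (g (Suc n))" by metis
  then obtain e where e: "\<And>n. S (g n) (e n) (g (Suc n))" by metis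
  have fac: "f z = (\<Prod>i<n. 1 - z / e i) * g n z" for n z
  proof (induction n)
    case 0 then show ?case using g(2) by simp
  next
    case (Suc n)
    have "g n z = (1 - z / e n) * g (Suc n) z" using e[of n] by (simp add: S_def)
    then show ?case using Suc by (simp add: mult_ac)
  qed
  have "peels_zeros f e g" unfolding peels_zeros_def
  proof (intro allI conjI)
    fix n
    show "g n holomorphic_on UNIV" using g(1)[of n] by (simp add: Q_def)
    show "e n \<noteq> 0" using e[of n] by (simp add: S_def)
    have "g (Suc n) (e (Suc n)) = 0" using e[of "Suc n"] by (simp add: S_def)
    then have "g n (e (Suc n)) = 0" using e[of n] by (simp add: S_def)
    then show "norm (e n) \<le> norm (e (Suc n))" using e[of n] by (simp add: S_def)
    show "f z = (\<Prod>i<n. 1 - z / e i) * g n z" for z by (rule fac)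
    show "norm z < norm (e n) \<longrightarrow> g n z \<noteq> 0" for z using e[of n] unfolding S_def by (meson not_less)
  qed
  moreover have "f (e n) = 0" for n using fac[of "e n" n] e[of n] by (simp add: S_def)
  ultimately show thesis using that by blast
qed

lemma peels_zeros_zorder:
  assumes p: "peels_zeros f e g" and f: "f 0 \<noteq> 0"
  shows "zorder f z = int (card {i. i < n \<and> e i = z}) + zorder (g n) z"
proof -
  have g: "g n holomorphic_on UNIV" "e n \<noteq> 0" "f z = (\<Prod>i<n. 1 - z / e i) * g n z" for n z
    using p by (auto simp: peels_zeros_def)
  have "zorder (\<lambda>z. (\<Prod>i<n. 1 - z / e i) * h z) z = int (card {i. i < n \<and> e i = z}) + zorder h z"
    if h: "h holomorphic_on UNIV" "h 0 \<noteq> 0" for h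
    using h
  proof (induction n arbitrary: h)
    case (Suc n)
    let ?k = "\<lambda>z. (1 - z / e n) * h z"
    have k: "?k holomorphic_on UNIV" using g(2) by (intro holomorphic_intros Suc.prems) auto
    have "zorder (\<lambda>z. (\<Prod>i<Suc n. 1 - z / e i) * h z) z = zorder (\<lambda>z. (\<Prod>i<n. 1 - z / e i) * ?k z) z"
      by (simp add: mult.assoc)
    also have "\<dots> = int (card {i. i < n \<and> e i = z}) + zorder ?k z" by (rule Suc.IH[OF k]) (use Suc.prems in simp)
    also have "zorder ?k z = zorder h z + (if z = e n then 1 else 0)"
      by (rule zorder_mult_linear_factor[OF Suc.prems(1) g(2), where w = 0]) (use Suc.prems in auto)
    finally have *: "zorder (\<lambda>z. (\<Prod>i<Suc n. 1 - z / e i) * h z) z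
      = int (card {i. i < n \<and> e i = z}) + (zorder h z + (if z = e n then 1 else 0))" .
    have "{i. i < Suc n \<and> e i = z} = (if z = e n then insert n {i. i < n \<and> e i = z} else {i. i < n \<and> e i = z})"
      by (auto simp: less_Suc_eq)
    then show ?case using * by auto
  qed simp
  from this[OF g(1)[of n]] have "zorder (\<lambda>z. (\<Prod>i<n. 1 - z / e i) * g n z) z = int (card {i. i < n \<and> e i = z}) + zorder (g n) z"
    using f g(3)[of 0 n] by simp
  moreover have "f = (\<lambda>z. (\<Prod>i<n. 1 - z / e i) * g n z)" by (intro ext g(3))
  ultimately show ?thesis by simp
qed

lemma peels_zeros_multiplicity:
  assumes p: "peels_zeros f e g" and growth: "\<And>z. norm (f z) \<le> C * exp (c * sqrt (norm z))" and C: "C > 0" "c > 0" and f0: "f 0 \<noteq> 0"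
  shows "finite {n. e n = z}" "int (card {n. e n = z}) = zorder f z"
proof -
  have g: "g n holomorphic_on UNIV" "norm z < norm (e n) \<Longrightarrow> g n z \<noteq> 0" for n z
    using p by (auto simp: peels_zeros_def)
  have "\<forall>\<^sub>F n in sequentially. norm z < norm (e n)"
    using peels_zeros_at_top[OF assms] by (rule filterlim_at_top_dense[THEN iffD1, rule_format])
  then obtain n where n: "norm z < norm (e n)" by (auto simp: eventually_sequentially)
  have eq: "{n. e n = z} = {i. i < n \<and> e i = z}"
  proof -
    have "i < n" if "e i = z" for i
      by (rule ccontr) (use peels_zeros_mono[OF p, of n i] n that in auto)
    then show ?thesis by auto
  qed
  show "finite {n. e n = z}" unfolding eq by simp
  have "zorder (g n) z = 0" by (rule zorder_eq_0I[OF holomorphic_on_imp_analytic_at[OF g(1)] g(2)[OF n]]) auto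
  then show "int (card {n. e n = z}) = zorder f z" unfolding eq using peels_zeros_zorder[OF p f0, of z n] by simp
qed

text \<open>
  Equal orders of vanishing allow the same factors to be divided out of \<open>f2\<close>, and the orders of the
  cofactors remain equal at each step.
\<close>

lemma peels_zeros_transfer:
  assumes p: "peels_zeros f1 e g1" and f: "f1 0 \<noteq> 0" "f2 holomorphic_on UNIV" "f2 0 \<noteq> 0" and ord: "\<And>z. zorder f1 z = zorder f2 z"
  obtains g2 where "peels_zeros f2 e g2"
proof -
  have g: "g1 n holomorphic_on UNIV" "e n \<noteq> 0" "norm (e n) \<le> norm (e (Suc n))" "norm z < norm (e n) \<Longrightarrow> g1 n z \<noteq> 0" for n z
    using p by (auto simp: peels_zeros_def)
  have g10: "g1 n 0 \<noteq> 0" for n using f(1) p unfolding peels_zeros_def by (metis mult_zero_right)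
  have "\<exists>h. h holomorphic_on UNIV \<and> (\<forall>z. f2 z = (\<Prod>i<n. 1 - z / e i) * h z) \<and> (\<forall>z. zorder h z = zorder (g1 n) z)" for n
  proof (induction n)
    case 0
    have "f1 z = (\<Prod>i<(0::nat). 1 - z / e i) * g1 0 z" for z using p unfolding peels_zeros_def by blast
    then have "g1 0 = f1" by (intro ext) simp
    then show ?case using f ord by auto
  next
    case (Suc n)
    then obtain h where h: "h holomorphic_on UNIV" "\<And>z. f2 z = (\<Prod>i<n. 1 - z / e i) * h z" "\<And>z. zorder h z = zorder (g1 n) z" by blast
    have h0: "h 0 \<noteq> 0" using h(2)[of 0] f(3) by auto
    have o1: "zorder (g1 n) z = zorder (g1 (Suc n)) z + (if z = e n then 1 else 0)" for z
    proof -
      have "zorder f1 z = int (card {i. i < Suc n \<and> e i = z}) + zorder (g1 (Suc n)) z" "zorder f1 z = int (card {i. i < n \<and> e i = z}) + zorder (g1 n) z"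
        using peels_zeros_zorder[OF p f(1)] by blast+
      moreover have "{i. i < Suc n \<and> e i = z} = (if z = e n then insert n {i. i < n \<and> e i = z} else {i. i < n \<and> e i = z})"
        by (auto simp: less_Suc_eq)
      ultimately show ?thesis by (auto split: if_splits)
    qed
    have "zorder (g1 (Suc n)) (e n) \<ge> 0" by (rule entire_zorder(1)[OF g(1) g10])
    then have "zorder h (e n) \<noteq> 0" using h(3)[of "e n"] o1[of "e n"] by simp
    then have "h (e n) = 0" using entire_zorder(2)[OF h(1) h0] by blast
    then obtain k where k: "k holomorphic_on UNIV" "\<And>z. h z = (1 - z / e n) * k z"
      using divide_out_nonzero_zero[OF h(1) _ g(2)] by blast
    have "zorder h z = zorder k z + (if z = e n then 1 else 0)" for z
      by (rule zorder_mult_linear_factor[OF k(1) g(2) h0 k(2)])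
    then have "zorder k z = zorder (g1 (Suc n)) z" for z using h(3)[of z] o1[of z] by simp
    moreover have "f2 z = (\<Prod>i<Suc n. 1 - z / e i) * k z" for z using h(2)[of z] k(2)[of z] by (simp add: mult_ac)
    ultimately show ?case using k(1) by blast
  qed
  then obtain h where h: "\<And>n. h n holomorphic_on UNIV" "\<And>n z. f2 z = (\<Prod>i<n. 1 - z / e i) * h n z" "\<And>n z. zorder (h n) z = zorder (g1 n) z"
    by metis
  have "h n z \<noteq> 0" if "norm z < norm (e n)" for n z
  proof -
    have "h n 0 \<noteq> 0" using h(2)[of 0 n] f(3) by auto
    then show ?thesis using g(4)[OF that] entire_zorder(2)[OF g(1) g10, of n z] entire_zorder(2)[OF h(1), of n 0 z] h(3)[of n z] by simp
  qed
  then have "peels_zeros f2 e h" unfolding peels_zeros_def using g h by auto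
  then show thesis by (rule that)
qed

section \<open>The characteristic function is determined by the spectral data\<close>

lemma divide_out_power:
  assumes F: "F holomorphic_on UNIV" "F w \<noteq> (0::complex)"
  obtains f d where "f holomorphic_on UNIV" "f 0 \<noteq> 0" "\<And>z. F z = z ^ d * f z"
proof -
  have "\<exists>f d. f holomorphic_on UNIV \<and> f 0 \<noteq> 0 \<and> (\<forall>z. F z = z ^ d * f z)"
    using F
  proof (induction "nat (zorder F 0)" arbitrary: F rule: less_induct)
    case less
    show ?case
    proof (cases "F 0 = 0")
      case False
      then show ?thesis using less.prems by (intro exI[of _ F] exI[of _ 0]) auto
    next
      case True
      obtain g where g: "g holomorphic_on UNIV" "\<And>z. F z = (z - 0) * g z"
        using divide_out_zero[OF less.prems(1) True] by blast
      have gw: "g w \<noteq> 0" using g(2)[of w] less.prems(2) by auto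
      have hF: "(\<lambda>z. z * g z) holomorphic_on UNIV" by (intro holomorphic_intros g)
      have "zorder (\<lambda>z. z * g z) 0 = zorder (\<lambda>z. z) 0 + zorder g 0"
      proof (rule zorder_times_analytic)
        show "g analytic_on {0}" by (rule holomorphic_on_imp_analytic_at[OF g(1)]) auto
        show "eventually (\<lambda>z. z * g z \<noteq> 0) (at 0)"
          by (rule entire_analytic_nonzero(2)[OF hF, of w]) (use less.prems g(2) in simp)
      qed (intro analytic_intros)
      moreover have "zorder (\<lambda>z::complex. z) 0 = 1" by (rule zorder_eqI[where S = UNIV and g = "\<lambda>_. 1"]) auto
      moreover have "F = (\<lambda>z. z * g z)" using g(2) by auto
      ultimately have "zorder F 0 = 1 + zorder g 0" by simp
      moreover have "zorder g 0 \<ge> 0" by (rule entire_zorder(1)[OF g(1) gw])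
      ultimately have "nat (zorder g 0) < nat (zorder F 0)" by simp
      from less.hyps[OF this g(1) gw] obtain f d where f: "f holomorphic_on UNIV" "f 0 \<noteq> 0" "\<forall>z. g z = z ^ d * f z" by blast
      have "\<forall>z. F z = z ^ Suc d * f z" using f(3) g(2) by (simp add: mult.assoc)
      then show ?thesis using f by blast
    qed
  qed
  then show thesis using that by blast
qed

lemma zorder_power_factor:
  assumes f: "f holomorphic_on UNIV" "f 0 \<noteq> (0::complex)" and F: "\<And>z. F z = z ^ d * f z"
  shows "zorder F 0 = int d" "z \<noteq> 0 \<Longrightarrow> zorder F z = zorder f z"
proof -
  have Feq: "F = (\<lambda>z. z ^ d * f z)" using F by auto
  show "zorder F 0 = int d"
    by (rule zorder_eqI[where S = UNIV and g = f]) (use f F in \<open>auto simp: power_int_def mult.commute\<close>)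
  assume z: "z \<noteq> 0"
  have ev: "eventually (\<lambda>z. z ^ d * f z \<noteq> 0) (at z)"
  proof -
    have "eventually (\<lambda>z. z \<noteq> 0) (at z)" using z by (intro eventually_neq_at_within)
    then show ?thesis using entire_analytic_nonzero(2)[OF f, of z] by eventually_elim simp
  qed
  have "zorder (\<lambda>z. z ^ d * f z) z = zorder (\<lambda>z. z ^ d) z + zorder f z"
    by (rule zorder_times_analytic[OF _ _ ev])
       (auto intro!: analytic_intros holomorphic_on_imp_analytic_at[OF f(1)])
  moreover have "zorder (\<lambda>z. z ^ d) z = 0" by (rule zorder_eq_0I) (use z in \<open>auto intro!: analytic_intros\<close>)
  ultimately show "zorder F z = zorder f z" using Feq by simp
qed

text \<open>
  The map \<open>k \<mapsto> k\<^sup>2\<close> is locally injective away from \<open>0\<close>, so that composition with it preserves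
  orders of vanishing; at \<open>\<mu> = 0\<close> the order is taken in the variable \<open>\<mu>\<close> by definition.
\<close>

lemma te_mult_eq_zorder:
  assumes V: "\<And>b. V absolutely_integrable_on {0..b}" and a: "a > 0" and nz: "D_hat a V w \<noteq> 0"
  shows "te_mult a V \<mu> = nat (zorder (D_hat a V) \<mu>)"
proof (cases "\<mu> = 0")
  case True
  have "(\<lambda>z. D_fun a V (csqrt z)) = D_hat a V" using D_fun_eq_D_hat[OF V, of a] a by auto
  then show ?thesis using True by (simp add: te_mult_def)
next
  case False
  define k where "k = csqrt \<mu>"
  have k: "k\<^sup>2 = \<mu>" "k \<noteq> 0" using False by (auto simp: k_def)
  note hol = D_hat_holomorphic[OF V less_imp_le[OF a]]
  have an: "D_hat a V analytic_on {k\<^sup>2}" by (rule entire_analytic_nonzero(1)[OF hol nz])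
  have "zorder (D_hat a V \<circ> (\<lambda>k. k\<^sup>2)) k = zorder (D_hat a V) (k\<^sup>2) * zorder (\<lambda>x. x\<^sup>2 - k\<^sup>2) k"
  proof (rule zorder_compose')
    show "isolated_singularity_at (D_hat a V) (k\<^sup>2)" by (rule isolated_singularity_at_analytic[OF an])
    show "not_essential (D_hat a V) (k\<^sup>2)" by (rule not_essential_analytic[OF an])
    show "eventually (\<lambda>w. D_hat a V w \<noteq> 0) (at (k\<^sup>2))" by (rule entire_analytic_nonzero(2)[OF hol nz])
    have "eventually (\<lambda>x. x \<noteq> k \<and> x \<noteq> - k) (at k)"
      by (intro eventually_conj eventually_neq_at_within)
    then show "eventually (\<lambda>x. x\<^sup>2 \<noteq> k\<^sup>2) (at k)" by eventually_elim (auto simp: power2_eq_iff)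
  qed (intro analytic_intros)
  moreover have "zorder (\<lambda>x. x\<^sup>2 - k\<^sup>2) k = 1"
    by (rule zorder_eqI[where S = UNIV and g = "\<lambda>x. x + k"]) (use k in \<open>auto intro!: holomorphic_intros simp: power2_eq_square algebra_simps\<close>)
  moreover have "D_fun a V = D_hat a V \<circ> (\<lambda>k. k\<^sup>2)" using D_fun_eq_D_hat[OF V less_imp_le[OF a]] by auto
  ultimately show ?thesis using False k by (simp add: te_mult_def k_def)
qed

text \<open>
  The factor \<open>z^d\<close> at the origin is split off first; for \<open>\<bar>z\<bar> \<ge> 1\<close> this does not increase the modulus,
  so growth and decay are inherited by \<open>f\<close>.
\<close>

lemma D_hat_peeling:
  assumes V: "\<And>b. V absolutely_integrable_on {0..b}" and a: "a > 0" and nz: "D_hat a V w \<noteq> 0"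
  obtains f C e g where "f holomorphic_on UNIV" "f 0 \<noteq> 0" "C > 0" "\<And>z. norm (f z) \<le> C * exp (2 * a * sqrt (norm z))"
    "\<And>z. D_hat a V z = z ^ te_mult a V 0 * f z" "peels_zeros f e g" "\<And>n. f (e n) = 0"
proof -
  note hol = D_hat_holomorphic[OF V less_imp_le[OF a]]
  obtain f d where f: "f holomorphic_on UNIV" "f 0 \<noteq> 0" "\<And>z. D_hat a V z = z ^ d * f z"
    using divide_out_power[OF hol nz] by blast
  have d: "te_mult a V 0 = d" using te_mult_eq_zorder[OF V a nz, of 0] zorder_power_factor(1)[OF f] by simp
  obtain C where C: "C > 0" "\<And>\<mu>. norm (D_hat a V \<mu>) \<le> C * exp (2 * a * sqrt (norm \<mu>))"
    "\<And>x. x > 0 \<Longrightarrow> norm (D_hat a V (of_real x)) \<le> C / sqrt x"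
    using D_hat_growth[OF V a] by blast
  have le: "norm (f z) \<le> norm (D_hat a V z)" if "norm z \<ge> 1" for z
  proof -
    have "1 * norm (f z) \<le> norm z ^ d * norm (f z)" using that by (intro mult_right_mono one_le_power) auto
    then show ?thesis by (simp add: f(3) norm_mult norm_power)
  qed
  have dec: "((\<lambda>x. f (of_real x)) \<longlongrightarrow> 0) at_top"
  proof (rule Lim_null_comparison)
    show "\<forall>\<^sub>F x in at_top. norm (f (of_real x)) \<le> C / sqrt x"
    proof (rule eventually_at_top_linorderI[of 1])
      fix x :: real assume x: "1 \<le> x"
      show "norm (f (of_real x)) \<le> C / sqrt x" by (rule order_trans[OF le C(3)]) (use x in auto)
    qed
    show "((\<lambda>x. C / sqrt x) \<longlongrightarrow> 0) at_top" by (rule real_tendsto_divide_at_top[OF tendsto_const sqrt_at_top])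
  qed
  have a2: "2 * a > 0" using a by simp
  have gr: "\<exists>C>0. \<forall>z. norm (f z) \<le> C * exp (2 * a * sqrt (norm z))"
    by (rule slow_growth_from_outside[OF f(1) C(1) a2, of 1]) (rule order_trans[OF le C(2)])
  then obtain C' where C': "C' > 0" "\<And>z. norm (f z) \<le> C' * exp (2 * a * sqrt (norm z))" by blast
  obtain e g where "peels_zeros f e g" "\<And>n. f (e n) = 0"
    using peels_zeros_exists[OF f(1,2) gr a2 dec] by blast
  then show thesis using that[OF f(1,2) C'] f(3) d by blast
qed

lemma peeled_zeros_enumerate:
  assumes V: "\<And>b. V absolutely_integrable_on {0..b}" and a: "a > 0"
    and f: "f holomorphic_on UNIV" "f 0 \<noteq> 0" "C > 0" "\<And>z. norm (f z) \<le> C * exp (2 * a * sqrt (norm z))"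
    "\<And>z. D_hat a V z = z ^ te_mult a V 0 * f z" "peels_zeros f e g" "\<And>n. f (e n) = 0"
  shows "enumerates_nonzero_te a V e"
  unfolding enumerates_nonzero_te_def
proof (intro conjI allI ballI)
  have e0: "e n \<noteq> 0" for n using f(6) by (simp add: peels_zeros_def)
  have "D_hat a V (e n) = 0" for n using f(5,7) by simp
  then show "e n \<in> special_te a V - {0}" for n using zeros_are_special_te[OF V a] e0 by auto
  fix \<mu> assume "\<mu> \<in> special_te a V - {0}"
  then have \<mu>: "\<mu> \<noteq> 0" by simp
  have a2: "2 * a > 0" using a by simp
  note m = peels_zeros_multiplicity[OF f(6,4,3) a2 f(2), of \<mu>]
  show "finite {n. e n = \<mu>}" by (rule m(1))
  have "D_hat a V \<noteq> (\<lambda>_. 0)"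
  proof
    assume z: "D_hat a V = (\<lambda>_. 0)"
    then have "f z = 0" if "z \<noteq> 0" for z using f(5)[of z] that by simp
    moreover have "\<exists>\<^sub>F z in at (0::complex). f z \<noteq> 0" by (rule entire_analytic_nonzero(3)[OF f(1,2)])
    ultimately show False by (auto simp: frequently_def eventually_at_filter)
  qed
  then obtain w where w: "D_hat a V w \<noteq> 0" by auto
  have "te_mult a V \<mu> = nat (zorder f \<mu>)"
    using te_mult_eq_zorder[OF V a w, of \<mu>] zorder_power_factor(2)[OF f(1,2,5) \<mu>] by simp
  then show "card {n. e n = \<mu>} = te_mult a V \<mu>" using m(2) by simp
qed

lemma canonical_product_estimates:
  fixes e :: "nat \<Rightarrow> complex"
  assumes s: "summable (\<lambda>n. 1 / norm (e n))"
  shows "convergent_prod (\<lambda>n. 1 - z / e n)" "(\<lambda>N. \<Prod>n<N. 1 - z / e n) \<longlonglongrightarrow> (\<Prod>n. 1 - z / e n)"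
    "norm ((\<Prod>n. 1 - z / e n) - 1) \<le> exp (norm z * (\<Sum>n. 1 / norm (e n))) - 1"
proof -
  have "summable (\<lambda>n. norm ((1 - z / e n) - 1))"
    using summable_mult[OF s, of "norm z"] by (simp add: norm_divide)
  then show c: "convergent_prod (\<lambda>n. 1 - z / e n)"
    by (intro abs_convergent_prod_imp_convergent_prod) (simp only: abs_convergent_prod_conv_summable)
  have "(\<lambda>N. \<Prod>n<Suc N. 1 - z / e n) \<longlonglongrightarrow> (\<Prod>n. 1 - z / e n)"
    using convergent_prod_LIMSEQ[OF c] by (simp only: lessThan_Suc_atMost)
  then show l: "(\<lambda>N. \<Prod>n<N. 1 - z / e n) \<longlonglongrightarrow> (\<Prod>n. 1 - z / e n)" by (rule LIMSEQ_imp_Suc)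
  show "norm ((\<Prod>n. 1 - z / e n) - 1) \<le> exp (norm z * (\<Sum>n. 1 / norm (e n))) - 1"
  proof (rule LIMSEQ_le_const2)
    show "(\<lambda>N. norm ((\<Prod>n<N. 1 - z / e n) - 1)) \<longlonglongrightarrow> norm ((\<Prod>n. 1 - z / e n) - 1)" by (intro tendsto_intros l)
    have "norm ((\<Prod>n<N. 1 - z / e n) - 1) \<le> exp (norm z * (\<Sum>n. 1 / norm (e n))) - 1" for N
    proof -
      have "norm ((\<Prod>n<N. 1 + (- z / e n)) - 1) \<le> (\<Prod>n<N. 1 + norm (- z / e n)) - 1"
        by (rule norm_prod_minus1_le_prod_minus1)
      also have "(\<Prod>n<N. 1 + norm (- z / e n)) \<le> (\<Prod>n<N. exp (norm (- z / e n)))"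
        by (rule prod_mono) auto
      also have "\<dots> = exp (norm z * (\<Sum>n<N. 1 / norm (e n)))"
        by (simp add: exp_sum[symmetric] norm_divide sum_distrib_left)
      also have "\<dots> \<le> exp (norm z * (\<Sum>n. 1 / norm (e n)))"
        by (simp, intro mult_left_mono sum_le_suminf s) auto
      finally show ?thesis by simp
    qed
    then show "\<exists>N. \<forall>n\<ge>N. norm ((\<Prod>n<n. 1 - z / e n) - 1) \<le> exp (norm z * (\<Sum>n. 1 / norm (e n))) - 1" by blast
  qed
qed

text \<open>
  The partial sums of the second series are grouped by value. A group contains at
  most all occurrences of its value, and these are as many in the first series.
\<close>

lemma summable_of_same_multiplicities:
  fixes e e' :: "nat \<Rightarrow> complex"
  assumes s: "summable (\<lambda>n. 1 / norm (e n))"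
    and fin: "\<And>\<mu>. finite {n. e n = \<mu>}" and fin': "\<And>\<mu>. finite {n. e' n = \<mu>}" and card: "\<And>\<mu>. card {n. e' n = \<mu>} = card {n. e n = \<mu>}"
  shows "summable (\<lambda>n. 1 / norm (e' n))"
proof (rule summableI_nonneg_bounded)
  fix N
  define U where "U = e' ` {..<N}"
  have finU: "finite U" by (simp add: U_def)
  have "(\<Sum>n<N. 1 / norm (e' n)) = (\<Sum>\<mu>\<in>U. \<Sum>n | n \<in> {..<N} \<and> e' n = \<mu>. 1 / norm (e' n))"
    unfolding U_def by (rule sum.image_gen) simp
  also have "\<dots> \<le> (\<Sum>\<mu>\<in>U. \<Sum>n | e n = \<mu>. 1 / norm (e n))"
  proof (rule sum_mono)
    fix \<mu> assume "\<mu> \<in> U"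
    have "(\<Sum>n | n \<in> {..<N} \<and> e' n = \<mu>. 1 / norm (e' n)) \<le> (\<Sum>n | e' n = \<mu>. 1 / norm (e' n))"
      by (rule sum_mono2[OF fin']) auto
    also have "\<dots> = (\<Sum>n | e' n = \<mu>. 1 / norm \<mu>)" by (rule sum.cong) auto
    also have "\<dots> = (\<Sum>n | e n = \<mu>. 1 / norm \<mu>)" using card[of \<mu>] by simp
    also have "\<dots> = (\<Sum>n | e n = \<mu>. 1 / norm (e n))" by (rule sum.cong) auto
    finally show "(\<Sum>n | n \<in> {..<N} \<and> e' n = \<mu>. 1 / norm (e' n)) \<le> (\<Sum>n | e n = \<mu>. 1 / norm (e n))" .
  qed
  also have "\<dots> = (\<Sum>n\<in>(\<Union>\<mu>\<in>U. {n. e n = \<mu>}). 1 / norm (e n))"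
    by (rule sum.UNION_disjoint[symmetric]) (use finU fin in auto)
  also have "\<dots> \<le> (\<Sum>n. 1 / norm (e n))" by (rule sum_le_suminf[OF s]) (use finU fin in auto)
  finally show "(\<Sum>n<N. 1 / norm (e' n)) \<le> (\<Sum>n. 1 / norm (e n))" .
qed simp

lemma enumerations_same_multiplicities:
  assumes "enumerates_nonzero_te a V e" "enumerates_nonzero_te a V e'"
  shows "finite {n. e n = \<mu>}" "card {n. e' n = \<mu>} = card {n. e n = \<mu>}"
proof -
  have out: "{n. e n = \<mu>} = {}" "{n. e' n = \<mu>} = {}" if "\<mu> \<notin> special_te a V - {0}"
    using assms that unfolding enumerates_nonzero_te_def by blast+
  show "finite {n. e n = \<mu>}" "card {n. e' n = \<mu>} = card {n. e n = \<mu>}"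
    using assms out unfolding enumerates_nonzero_te_def by (cases "\<mu> \<in> special_te a V - {0}"; auto)+
qed

text \<open>
  Existence of the constant is the Hadamard factorization. For uniqueness, an arbitrary enumeration of
  the eigenvalues has the same multiplicities as the peeled zeros, so its product converges
  absolutely and is continuous at \<open>0\<close> with value \<open>1\<close>; the constant is thus \<open>f 0\<close>, the leading
  coefficient of \<open>D_hat\<close> at the origin.
\<close>

lemma D_const_eq:
  assumes V: "\<And>b. V absolutely_integrable_on {0..b}" and a: "a > 0" and nz: "D_hat a V w \<noteq> 0"
    and f: "f holomorphic_on UNIV" "f 0 \<noteq> 0" "C > 0" "\<And>z. norm (f z) \<le> C * exp (2 * a * sqrt (norm z))"
    "\<And>z. D_hat a V z = z ^ te_mult a V 0 * f z" "peels_zeros f e g" "\<And>n. f (e n) = 0"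
  shows "D_const a V = f 0"
proof -
  let ?d = "te_mult a V 0"
  have Dk: "D_fun a V k = k ^ (2 * ?d) * f (k\<^sup>2)" for k
    using D_fun_eq_D_hat[OF V less_imp_le[OF a]] f(5) by (simp add: power_mult)
  have "D_fun a V (csqrt w) \<noteq> 0"
    using nz D_fun_eq_D_hat[OF V less_imp_le[OF a], of "csqrt w"] by simp
  then have "\<not> (\<forall>k. D_fun a V k = 0)" by blast
  then have "D_const a V = (THE \<gamma>. \<exists>e. enumerates_nonzero_te a V e \<and>
        (\<forall>k. convergent_prod (\<lambda>n. 1 - k\<^sup>2 / e n) \<and>
             D_fun a V k = \<gamma> * k ^ (2 * ?d) * (\<Prod>n. 1 - k\<^sup>2 / e n)))"
    unfolding D_const_def by (rule if_not_P)
  also have "\<dots> = f 0"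
  proof (rule the_equality)
    have a2: "2 * a > 0" using a by simp
    note s = peels_zeros_summable[OF f(6,4,3) a2 f(2)]
    note en = peeled_zeros_enumerate[OF V a f]
    have "(\<Prod>n. 1 - z / e n) = f z / f 0" for z
      by (rule LIMSEQ_unique[OF canonical_product_estimates(2)[OF s] hadamard_product_order_half[OF f(6,4,3) a2 f(2)]])
    then show "\<exists>e. enumerates_nonzero_te a V e \<and>
        (\<forall>k. convergent_prod (\<lambda>n. 1 - k\<^sup>2 / e n) \<and>
             D_fun a V k = f 0 * k ^ (2 * ?d) * (\<Prod>n. 1 - k\<^sup>2 / e n))"
      using en canonical_product_estimates(1)[OF s] Dk f(2) by (intro exI[of _ e]) auto
    fix \<gamma> assume "\<exists>e. enumerates_nonzero_te a V e \<and>
        (\<forall>k. convergent_prod (\<lambda>n. 1 - k\<^sup>2 / e n) \<and>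
             D_fun a V k = \<gamma> * k ^ (2 * ?d) * (\<Prod>n. 1 - k\<^sup>2 / e n))"
    then obtain e' where e': "enumerates_nonzero_te a V e'"
      "\<And>k. D_fun a V k = \<gamma> * k ^ (2 * ?d) * (\<Prod>n. 1 - k\<^sup>2 / e' n)" by blast
    have s': "summable (\<lambda>n. 1 / norm (e' n))"
      by (rule summable_of_same_multiplicities[OF s])
         (use enumerations_same_multiplicities[OF en e'(1)] enumerations_same_multiplicities[OF e'(1) en] in auto)
    have fz: "f z = \<gamma> * (\<Prod>n. 1 - z / e' n)" if "z \<noteq> 0" for z
      using e'(2)[of "csqrt z"] Dk[of "csqrt z"] that by (simp add: mult.commute mult.left_commute)
    have "((\<lambda>z. (\<Prod>n. 1 - z / e' n) - 1) \<longlongrightarrow> 0) (at 0)"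
    proof (rule Lim_null_comparison)
      show "\<forall>\<^sub>F z in at 0. norm ((\<Prod>n. 1 - z / e' n) - 1) \<le> exp (norm z * (\<Sum>n. 1 / norm (e' n))) - 1"
        using canonical_product_estimates(3)[OF s'] by (intro always_eventually) blast
      have "((\<lambda>z::complex. exp (norm z * (\<Sum>n. 1 / norm (e' n))) - 1) \<longlongrightarrow> exp (norm (0::complex) * (\<Sum>n. 1 / norm (e' n))) - 1) (at 0)"
        by (intro tendsto_intros)
      then show "((\<lambda>z::complex. exp (norm z * (\<Sum>n. 1 / norm (e' n))) - 1) \<longlongrightarrow> 0) (at 0)" by simp
    qed
    then have "((\<lambda>z. \<Prod>n. 1 - z / e' n) \<longlongrightarrow> 1) (at 0)" by (simp only: LIM_zero_iff)
    then have "((\<lambda>z. \<gamma> * (\<Prod>n. 1 - z / e' n)) \<longlongrightarrow> \<gamma> * 1) (at 0)" by (intro tendsto_mult tendsto_const)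
    then have l1: "(f \<longlongrightarrow> \<gamma> * 1) (at 0)"
      by (rule Lim_transform_eventually) (auto simp: eventually_at_filter fz)
    have "isCont f 0" using f(1) holomorphic_on_imp_continuous_on continuous_on_eq_continuous_at[OF open_UNIV] by blast
    then have l2: "(f \<longlongrightarrow> f 0) (at 0)" by (simp add: isCont_def)
    show "\<gamma> = f 0" using tendsto_unique[OF _ l1 l2] by simp
  qed
  finally show ?thesis .
qed

lemma D_const_nonzero:
  assumes V: "\<And>b. V absolutely_integrable_on {0..b}" and a: "a > 0" and nz: "D_hat a V w \<noteq> 0"
  shows "D_const a V \<noteq> 0"
proof -
  obtain f C e g where f: "f holomorphic_on UNIV" "f 0 \<noteq> 0" "C > 0" "\<And>z. norm (f z) \<le> C * exp (2 * a * sqrt (norm z))"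
    "\<And>z. D_hat a V z = z ^ te_mult a V 0 * f z" "peels_zeros f e g" "\<And>n. f (e n) = 0"
    by (rule D_hat_peeling[OF V a nz], rule that)
  show ?thesis using D_const_eq[OF V a nz f] f(2) by simp
qed

lemma D_const_zero:
  assumes V: "\<And>b. V absolutely_integrable_on {0..b}" and a: "a > 0" and z: "\<And>\<mu>. D_hat a V \<mu> = 0"
  shows "D_const a V = 0"
  using D_fun_eq_D_hat[OF V less_imp_le[OF a]] z by (simp add: D_const_def)

text \<open>
  The constant vanishes exactly if \<open>D_hat\<close> does, which settles the degenerate case. Otherwise the two
  functions have equal orders of vanishing everywhere: at eigenvalues by hypothesis, elsewhere both
  are nonzero. One sequence of zeros can then be peeled from both, and their normalised quotients by
  \<open>z^d\<close> are the limit of the same partial products.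
\<close>

lemma D_hat_from_spectral_data:
  assumes V1: "\<And>b. V1 absolutely_integrable_on {0..b}" and V2: "\<And>b. V2 absolutely_integrable_on {0..b}" and a: "a > 0"
    and te: "special_te a V1 = special_te a V2"
    and mult: "\<And>\<mu>. \<mu> \<in> special_te a V1 \<Longrightarrow> te_mult a V1 \<mu> = te_mult a V2 \<mu>"
    and const: "D_const a V1 = D_const a V2"
  shows "D_hat a V1 \<mu> = D_hat a V2 \<mu>"
proof (cases "(\<forall>\<mu>. D_hat a V1 \<mu> = 0) \<or> (\<forall>\<mu>. D_hat a V2 \<mu> = 0)")
  case True
  then have "D_const a V1 = 0" using D_const_zero[OF V1 a] D_const_zero[OF V2 a] const by metis
  then have "\<forall>\<mu>. D_hat a V1 \<mu> = 0" "\<forall>\<mu>. D_hat a V2 \<mu> = 0"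
    using D_const_nonzero[OF V1 a] D_const_nonzero[OF V2 a] const by metis+
  then show ?thesis by simp
next
  case False
  then obtain w1 w2 where w: "D_hat a V1 w1 \<noteq> 0" "D_hat a V2 w2 \<noteq> 0" by blast
  note hol1 = D_hat_holomorphic[OF V1 less_imp_le[OF a]] and hol2 = D_hat_holomorphic[OF V2 less_imp_le[OF a]]
  \<comment> \<open>\<open>nat\<close> loses no information, since orders of entire functions are nonnegative\<close>
  have ord: "zorder (D_hat a V1) z = zorder (D_hat a V2) z" for z
  proof (cases "z \<in> special_te a V1")
    case True
    then have "nat (zorder (D_hat a V1) z) = nat (zorder (D_hat a V2) z)"
      using mult[of z] te_mult_eq_zorder[OF V1 a w(1)] te_mult_eq_zorder[OF V2 a w(2)] by simp
    then show ?thesis using entire_zorder(1)[OF hol1 w(1), of z] entire_zorder(1)[OF hol2 w(2), of z] by simp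
  next
    case False
    then have "D_hat a V1 z \<noteq> 0" "D_hat a V2 z \<noteq> 0"
      using zeros_are_special_te[OF V1 a] zeros_are_special_te[OF V2 a] te by auto
    then show ?thesis using entire_zorder(2)[OF hol1 w(1), of z] entire_zorder(2)[OF hol2 w(2), of z] by simp
  qed
  have d: "te_mult a V1 0 = te_mult a V2 0"
    using te_mult_eq_zorder[OF V1 a w(1)] te_mult_eq_zorder[OF V2 a w(2)] ord by simp
  obtain f1 C1 e1 g1 where f1: "f1 holomorphic_on UNIV" "f1 0 \<noteq> 0" "C1 > 0" "\<And>z. norm (f1 z) \<le> C1 * exp (2 * a * sqrt (norm z))"
    "\<And>z. D_hat a V1 z = z ^ te_mult a V1 0 * f1 z" "peels_zeros f1 e1 g1" "\<And>n. f1 (e1 n) = 0"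
    by (rule D_hat_peeling[OF V1 a w(1)], rule that)
  obtain f2 C2 e2 g2 where f2: "f2 holomorphic_on UNIV" "f2 0 \<noteq> 0" "C2 > 0" "\<And>z. norm (f2 z) \<le> C2 * exp (2 * a * sqrt (norm z))"
    "\<And>z. D_hat a V2 z = z ^ te_mult a V2 0 * f2 z" "peels_zeros f2 e2 g2" "\<And>n. f2 (e2 n) = 0"
    by (rule D_hat_peeling[OF V2 a w(2)], rule that)
  have c: "f1 0 = f2 0" using D_const_eq[OF V1 a w(1) f1] D_const_eq[OF V2 a w(2) f2] const by simp
  have ordf: "zorder f1 z = zorder f2 z" for z
  proof (cases "z = 0")
    case True
    then show ?thesis using entire_zorder(2)[OF f1(1,2), of 0] entire_zorder(2)[OF f2(1,2), of 0] f1(2) f2(2) by simp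
  next
    case False
    then show ?thesis
      using zorder_power_factor(2)[OF f1(1,2,5) False] zorder_power_factor(2)[OF f2(1,2,5) False] ord by simp
  qed
  obtain h where h: "peels_zeros f2 e1 h" using peels_zeros_transfer[OF f1(6,2) f2(1,2) ordf] by blast
  have a2: "2 * a > 0" using a by simp
  have "f1 \<mu> / f1 0 = f2 \<mu> / f2 0"
    by (rule LIMSEQ_unique[OF hadamard_product_order_half[OF f1(6,4,3) a2 f1(2)] hadamard_product_order_half[OF h f2(4,3) a2 f2(2)]])
  then have "f1 \<mu> = f2 \<mu>" using c f1(2) by simp
  then show ?thesis using f1(5) f2(5) d by simp
qed

theorem theorem5p4:
  fixes a :: real and V1 V2 :: "real \<Rightarrow> real"
  assumes "a > 0"
    and "admissible a V1"
    and "admissible a V2"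
  shows "((\<forall>k. D_fun a V1 k = D_fun a V2 k) \<longrightarrow>
            (AE y in lebesgue. y > 0 \<longrightarrow> V1 y = V2 y)) \<and>
         (special_te a V1 = special_te a V2 \<and>
          (\<forall>\<mu>\<in>special_te a V1. te_mult a V1 \<mu> = te_mult a V2 \<mu>) \<and>
          D_const a V1 = D_const a V2 \<longrightarrow>
            (AE y in lebesgue. y > 0 \<longrightarrow> V1 y = V2 y))"
proof -
  have V1: "V1 absolutely_integrable_on {0..b}" and V2: "V2 absolutely_integrable_on {0..b}" for b
    using admissible_absolutely_integrable assms(2,3) by blast+
  have *: "AE y in lebesgue. y > 0 \<longrightarrow> V1 y = V2 y" if D: "\<And>\<mu>. D_hat a V1 \<mu> = D_hat a V2 \<mu>"
  proof -
    obtain N where N: "negligible N" "\<And>y. y \<in> {0<..<a} - N \<Longrightarrow> V1 y = V2 y"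
      using potential_from_D_hat[OF V1 V2 assms(1) D] by blast
    have "negligible (N \<union> {a})" using N(1) by (intro negligible_Un) auto
    moreover have "V1 y = V2 y" if "y \<notin> N \<union> {a}" "y > 0" for y
      using N(2)[of y] that assms(2,3) by (cases "y < a") (auto simp: admissible_def)
    ultimately show ?thesis unfolding AE_lebesgue_iff_negligible by blast
  qed
  have "D_hat a V1 \<mu> = D_hat a V2 \<mu>" if "\<forall>k. D_fun a V1 k = D_fun a V2 k" for \<mu>
    using that[rule_format, of "csqrt \<mu>"] D_fun_eq_D_hat[OF V1] D_fun_eq_D_hat[OF V2] assms(1) by simp
  moreover have "D_hat a V1 \<mu> = D_hat a V2 \<mu>"
    if "special_te a V1 = special_te a V2 \<and> (\<forall>\<mu>\<in>special_te a V1. te_mult a V1 \<mu> = te_mult a V2 \<mu>) \<and> D_const a V1 = D_const a V2" for \<mu>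
    using that by (intro D_hat_from_spectral_data[OF V1 V2 assms(1)]) auto
  ultimately show ?thesis using * by blast
qed

end
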